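(* Let $m\ge 2$ and $n\ge 1$ be integers and let $\boldsymbol\alpha$ be a real $m\times n$ matrix whose transpose satisfies \[ \omega(\boldsymbol\alpha^T) < \left(\frac{n}{m} - \frac{n}{2m^2(m-1)}\right)^{-1}. \] Then for every doubling approximation function $\psi$ such that $\sum_{q=1}^\infty q^{n-1}\psi^m(q)$ converges, the set $\mathcal{T}_\psi(\boldsymbol\alpha)$ has zero measure on every nondegenerate curve in $\mathbb R^m$ and on every nondegenerate analytic submanifold of $\mathbb R^m$; that is, $\mathcal{M}\cap \mathcal{T}_\psi(\boldsymbol\alpha)$ is null with respect to the induced Lebesgue measure on $\mathcal M$ for every such $\mathcal M$.
   Context: $\|\cdot\|$ is the Euclidean norm. An approximation function is a continuous nonincreasing function $\psi:(0,\infty)\to(0,\infty)$; it is doubling if there is $K>1$ with $\psi(x)\le K\psi(2x)$ for all $x>0$. For a real $a\times b$ matrix $A$ and a function $\psi$, $A$ is called $\psi$-approximable if there are infinitely many $(\mathbf p,\mathbf q)\in\mathbb Z^a\times(\mathbb Z^b\setminus\{\mathbf 0\})$ with $\|A\mathbf q+\mathbf p\|\le\psi(\|\mathbf q\|)$. The exponent of irrationality is $\omega(A)=\sup\{\tau>0: A \text{ is } (q\mapsto q^{-\tau})\text{-approximable}\}$. For an $m\times n$ matrix $\boldsymbol\alpha$, $\mathcal T_\psi(\boldsymbol\alpha)$ is the set of $\boldsymbol\beta\in\mathbb R^m$ such that there are infinitely many $(\mathbf p,\mathbf q)\in\mathbb Z^m\times(\mathbb Z^n\setminus\{\mathbf 0\})$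 with $\|\boldsymbol\alpha\mathbf q+\boldsymbol\beta+\mathbf p\|\le\psi(\|\mathbf q\|)$. If $\mathbf f:U\to\mathcal M\subset\mathbb R^m$ ($U\subset\mathbb R^k$ open) is a local parametrization of a manifold $\mathcal M$, then $\mathcal M$ is nondegenerate at $\mathbf f(\mathbf x)$ if for some $k\in\mathbb N$, $\mathbf f$ is $C^k$ and the partial derivatives of $\mathbf f$ at $\mathbf x$ of orders $1,\dots,k$ span $\mathbb R^m$; $\mathcal M$ is nondegenerate if it is nondegenerate at almost every point. Measure on a manifold means the induced (Hausdorff/pushforward Lebesgue) measure of the manifold's dimension. *)

theory Defs
  imports "HOL-Analysis.Analysis"
begin

section \<open>Diophantine approximation\<close>

definition int_points :: "(real ^ 'n) set" where
  "int_points = {v. \<forall>i. v $ i \<in> \<int>}"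

text \<open>Approximation functions live on \<open>(0,\<infinity>)\<close>; values of \<open>\<psi>\<close> at nonpositive arguments are
  irrelevant throughout.\<close>

definition approximation_function :: "(real \<Rightarrow> real) \<Rightarrow> bool" where
  "approximation_function \<psi> \<longleftrightarrow>
     continuous_on {0<..} \<psi> \<and> antimono_on {0<..} \<psi> \<and> (\<forall>x>0. \<psi> x > 0)"

definition doubling :: "(real \<Rightarrow> real) \<Rightarrow> bool" where
  "doubling \<psi> \<longleftrightarrow> (\<exists>K>1. \<forall>x>0. \<psi> x \<le> K * \<psi> (2 * x))"

definition approximable :: "(real \<Rightarrow> real) \<Rightarrow> real ^ 'b ^ 'a \<Rightarrow> bool" where
  "approximable \<psi> A \<longleftrightarrow>
     infinite {(p, q). p \<in> int_points \<and> q \<in> int_points - {0} \<and> norm (A *v q + p) \<le> \<psi> (norm q)}"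

definition irrationality_exponent :: "real ^ 'b ^ 'a \<Rightarrow> ereal" where
  "irrationality_exponent A = (SUP \<tau>\<in>{\<tau>. \<tau> > 0 \<and> approximable (\<lambda>q. q powr - \<tau>) A}. ereal \<tau>)"

definition inhomogeneously_approximable :: "(real \<Rightarrow> real) \<Rightarrow> real ^ 'n ^ 'm \<Rightarrow> (real ^ 'm) set" where
  "inhomogeneously_approximable \<psi> \<alpha> =
     {\<beta>. infinite {(p, q). p \<in> int_points \<and> q \<in> int_points - {0} \<and>
                          norm (\<alpha> *v q + \<beta> + p) \<le> \<psi> (norm q)}}"


section \<open>Differentiability and analyticity in several variables\<close>

definition partial_derivative ::
    "'d \<Rightarrow> (real ^ 'd \<Rightarrow> 'b::real_normed_vector) \<Rightarrow> real ^ 'd \<Rightarrow> 'b" where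
  "partial_derivative i f x = frechet_derivative f (at x) (axis i 1)"

primrec iterated_partial ::
    "'d list \<Rightarrow> (real ^ 'd \<Rightarrow> 'b::real_normed_vector) \<Rightarrow> real ^ 'd \<Rightarrow> 'b" where
  "iterated_partial [] f = f"
| "iterated_partial (i # js) f = partial_derivative i (iterated_partial js f)"

text \<open>Only meant for open \<open>U\<close>, where \<open>frechet_derivative\<close> at a point of \<open>U\<close> depends
  only on the values of the function in \<open>U\<close>.\<close>

primrec C_k_on ::
    "nat \<Rightarrow> (real ^ 'd \<Rightarrow> 'b::real_normed_vector) \<Rightarrow> (real ^ 'd) set \<Rightarrow> bool" where
  "C_k_on 0 f U \<longleftrightarrow> continuous_on U f"
| "C_k_on (Suc k) f U \<longleftrightarrow> f differentiable_on U \<and> (\<forall>i. C_k_on k (partial_derivative i f) U)"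

text \<open>Real analyticity: near each point of \<open>U\<close>, \<open>f\<close> is the sum of an (unconditionally convergent)
  power series, indexed by multi-indices \<open>\<nu> :: 'd \<Rightarrow> nat\<close>.\<close>

definition real_analytic_on ::
    "(real ^ 'd::finite \<Rightarrow> 'b::real_normed_vector) \<Rightarrow> (real ^ 'd) set \<Rightarrow> bool" where
  "real_analytic_on f U \<longleftrightarrow>
     (\<forall>x\<in>U. \<exists>r>0. \<exists>c :: ('d \<Rightarrow> nat) \<Rightarrow> 'b. \<forall>y\<in>ball x r.
        ((\<lambda>\<nu>. (\<Prod>i\<in>UNIV. ((y - x) $ i) ^ \<nu> i) *\<^sub>R c \<nu>) has_sum f y) UNIV)"


section \<open>Submanifolds of Euclidean space\<close>

text \<open>The dimension of a submanifold is \<open>CARD('d)\<close>. Submanifolds are embedded: a local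
  parametrization is an immersion of class \<open>C\<^sup>1\<close> that is a homeomorphism onto a relatively open
  subset of \<open>M\<close>.\<close>

definition local_parametrization ::
    "(real ^ 'm) set \<Rightarrow> (real ^ 'd) set \<Rightarrow> (real ^ 'd \<Rightarrow> real ^ 'm) \<Rightarrow> bool" where
  "local_parametrization M U f \<longleftrightarrow>
     open U \<and> C_k_on 1 f U \<and> (\<forall>x\<in>U. inj (frechet_derivative f (at x))) \<and>
     (\<exists>g. homeomorphism U (f ` U) f g) \<and> openin (top_of_set M) (f ` U)"

definition C1_submanifold :: "'d::finite itself \<Rightarrow> (real ^ 'm) set \<Rightarrow> bool" where
  "C1_submanifold _ M \<longleftrightarrow>
     (\<forall>y\<in>M. \<exists>(U :: (real ^ 'd) set) f. local_parametrization M U f \<and> y \<in> f ` U)"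

definition analytic_submanifold :: "'d::finite itself \<Rightarrow> (real ^ 'm) set \<Rightarrow> bool" where
  "analytic_submanifold _ M \<longleftrightarrow>
     (\<forall>y\<in>M. \<exists>(U :: (real ^ 'd) set) f.
        local_parametrization M U f \<and> real_analytic_on f U \<and> y \<in> f ` U)"

text \<open>Null sets of the induced measure on \<open>M\<close>, i.e. sets which are null for the pushforward of
  Lebesgue measure under every local parametrization.\<close>

definition null_on_manifold :: "'d::finite itself \<Rightarrow> (real ^ 'm) set \<Rightarrow> (real ^ 'm) set \<Rightarrow> bool" where
  "null_on_manifold _ M S \<longleftrightarrow>
     (\<forall>(U :: (real ^ 'd) set) f. local_parametrization M U f \<longrightarrow>
        {x \<in> U. f x \<in> S} \<in> null_sets lebesgue)"

text \<open>A submanifold has parametrizations of low regularity everywhere, so nondegeneracy at a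
  point asks for some parametrization, possibly of a small neighbourhood, that is regular enough.\<close>

definition nondegenerate_at :: "'d::finite itself \<Rightarrow> (real ^ 'm) set \<Rightarrow> real ^ 'm \<Rightarrow> bool" where
  "nondegenerate_at _ M y \<longleftrightarrow>
     (\<exists>(U :: (real ^ 'd) set) f x k.
        local_parametrization M U f \<and> x \<in> U \<and> f x = y \<and> C_k_on k f U \<and>
        span {iterated_partial js f x | js. 1 \<le> length js \<and> length js \<le> k} = UNIV)"

definition nondegenerate :: "'d::finite itself \<Rightarrow> (real ^ 'm) set \<Rightarrow> bool" where
  "nondegenerate d M \<longleftrightarrow> null_on_manifold d M {y \<in> M. \<not> nondegenerate_at d M y}"

definition nondegenerate_curve :: "(real ^ 'm) set \<Rightarrow> bool" where
  "nondegenerate_curve M \<longleftrightarrow> C1_submanifold TYPE(1) M \<and> nondegenerate TYPE(1) M"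

definition nondegenerate_analytic_submanifold :: "'d::finite itself \<Rightarrow> (real ^ 'm) set \<Rightarrow> bool" where
  "nondegenerate_analytic_submanifold d M \<longleftrightarrow> analytic_submanifold d M \<and> nondegenerate d M"

end

theory Submission
  imports Defs
begin

text \<open>
  Near a point where the partial derivatives of a parametrization \<open>f\<close> of orders at most \<open>m\<close>
  span \<open>\<real>\<^sup>m\<close>, van der Corput's lemma gives \<open>\<integral> e(v \<bullet> f) = O(|v|\<^bsup>-1/m\<^esup>)\<close> over a small ball. For
  \<open>Q = 2\<^bsup>k+1\<^esup>\<close> and \<open>N \<approx> 1 / \<psi>(2\<^sup>k)\<close>, the set of \<open>x\<close> such that \<open>f x + \<alpha> q\<close> is \<open>\<psi>\<close>-close to an
  integer point for some \<open>q\<close> of size about \<open>2\<^sup>k\<close> is detected by a product of Fejer-type kernels,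
  whose mean over the ball is bounded by a sum over frequencies \<open>|v| < N\<close> of the decay factor times
  a kernel in \<open>\<alpha>\<^sup>T v\<close> of length \<open>Q\<close>. If \<open>\<tau>\<close> exceeds the exponent of \<open>\<alpha>\<^sup>T\<close>, frequencies with
  \<open>\<alpha>\<^sup>T v\<close> in a common cell of side \<open>1/Q\<close> are \<open>Q\<^bsup>1/\<tau>\<^esup>\<close>-separated, and the sum has the expected order
  \<open>Q\<^sup>n \<psi>(2\<^sup>k)\<^sup>m\<close> as soon as \<open>1/\<tau> > (n/m)(1 - 1/m\<^sup>2)\<close>. This follows from the hypothesis, because
  \<open>2m\<^sup>2(m-1) \<ge> m\<^sup>3\<close> for \<open>m \<ge> 2\<close>, and Borel--Cantelli applies.

  Order \<open>m\<close> is enough at almost every nondegenerate point: at almost every point where the span of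
  the derivatives does not grow from order \<open>j\<close> to order \<open>j + 1\<close>, it does not grow afterwards.
\<close>

section \<open>Exponential sums and separated frequencies\<close>

text \<open>The decay |v|^(-1/m) is spent in the weaker product form prod max(1, |v_i|)^(-1/m^2),
  because a product weight splits the sum over separated frequencies into m one-dimensional sums.
  With \<sigma> = 1/m^2 and separation L of order Q^(1/\<tau>), each of these is O(1 +
  N^(1-\<sigma>)/L). Hence N may grow at most like 2^(s k) with s = 1/(\<tau>(1-\<sigma>)). Where
  \<psi>(2^k) is smaller than 2^(-s k), it is enlarged to 2^(-s k). The enlargement adds a multiple
  of 2^((n - s m) k) to the measure bound, which is summable exactly when 1/\<tau> >
  (n/m)(1-\<sigma>); this is where the condition on \<tau> comes from.

  The decay itself is a one-variable matter: polarization turns a nonvanishing mixed derivative of w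
  . f into a nonvanishing pure derivative in some direction u, and averaging over translations along
  u reduces a ball to segments. The direction and the order depend on w, and compactness of the unit
  sphere restores uniformity.\<close>

definition int_vec :: "('a::finite \<Rightarrow> int) \<Rightarrow> real ^ 'a" where
  "int_vec v = (\<chi> i. of_int (v i))"

definition int_box :: "nat \<Rightarrow> ('a::finite \<Rightarrow> int) set" where
  "int_box N = PiE UNIV (\<lambda>_. {0..<int N})"

definition exp_sum :: "nat \<Rightarrow> real ^ 'a::finite \<Rightarrow> complex" where
  "exp_sum N y = (\<Sum>h\<in>int_box N. cis (2 * pi * (int_vec h \<bullet> y)))"

lemma int_vec_nth [simp]: "int_vec v $ i = of_int (v i)"
  by (simp add: int_vec_def)

lemma int_vec_diff: "int_vec (\<lambda>i. a i - b i) = int_vec a - int_vec b"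
  by (simp add: vec_eq_iff)

lemma inj_int_vec: "inj int_vec"
  by (rule injI) (auto simp: vec_eq_iff)

lemma int_vec_eq_iff [simp]: "int_vec u = int_vec v \<longleftrightarrow> u = v"
  using inj_int_vec by (auto dest: injD)

lemma int_points_eq_range: "int_points = range int_vec"
proof -
  have "\<exists>z. v = int_vec z" if "\<forall>i. v $ i \<in> \<int>" for v :: "real ^ 'a"
  proof -
    have "\<forall>i. \<exists>z. v $ i = of_int z" using that by (auto elim: Ints_cases)
    then obtain z where "\<And>i. v $ i = of_int (z i)" by metis
    then show ?thesis by (intro exI[of _ z]) (auto simp: vec_eq_iff)
  qed
  then show ?thesis by (auto simp: int_points_def image_iff)
qed

lemma mem_int_box: "v \<in> int_box N \<longleftrightarrow> (\<forall>i. 0 \<le> v i \<and> v i < int N)"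
  by (auto simp: int_box_def PiE_def)

lemma finite_int_box [simp]: "finite (int_box N)"
  unfolding int_box_def by (intro finite_PiE) auto

lemma card_int_box: "card (int_box N :: ('a::finite \<Rightarrow> int) set) = N ^ CARD('a)"
  unfolding int_box_def by (subst card_PiE) auto

lemma cis_sum: "finite A \<Longrightarrow> cis (\<Sum>i\<in>A. f i) = (\<Prod>i\<in>A. cis (f i))"
  by (induction A rule: finite_induct) (auto simp: cis_mult[symmetric])

lemma exp_sum_eq_prod:
  "exp_sum N y = (\<Prod>i\<in>UNIV. \<Sum>k\<in>{0..<int N}. cis (2 * pi * (of_int k * y $ i)))"
  unfolding exp_sum_def int_box_def
  by (subst prod_sum_PiE) (auto simp: inner_vec_def sum_distrib_left cis_sum)

lemma norm_exp_sum_sq: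
  "of_real ((cmod (exp_sum N y))\<^sup>2) =
     (\<Sum>h\<in>int_box N. \<Sum>h'\<in>int_box N. cis (2 * pi * (int_vec (\<lambda>i. h i - h' i) \<bullet> y)))"
proof -
  have "of_real ((cmod (exp_sum N y))\<^sup>2) = exp_sum N y * cnj (exp_sum N y)"
    by (rule complex_norm_square)
  also have "\<dots> = (\<Sum>h\<in>int_box N. \<Sum>h'\<in>int_box N.
      cis (2 * pi * (int_vec h \<bullet> y)) * cnj (cis (2 * pi * (int_vec h' \<bullet> y))))"
    by (simp add: exp_sum_def sum_product)
  also have "\<dots> = (\<Sum>h\<in>int_box N. \<Sum>h'\<in>int_box N. cis (2 * pi * (int_vec (\<lambda>i. h i - h' i) \<bullet> y)))"
    by (simp add: cis_cnj cis_mult int_vec_diff inner_diff_left algebra_simps)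
  finally show ?thesis .
qed

section \<open>Bounds for one-dimensional geometric sums of exponentials\<close>

text \<open>A weak form of Jordan's inequality. A split at pi/3 is enough for it: below, sin y - y/3
  has derivative cos y - 1/3 >= 0; above, sin y is at least sqrt 3 / 2.\<close>

lemma sin_pi_ge: "x \<le> sin (pi * x)" if "0 \<le> x" "x \<le> 1/2"
proof -
  have "pi * x / 3 \<le> sin (pi * x)" 
  proof -
    let ?y = "pi * x"
    have y: "0 \<le> ?y" "?y \<le> pi/2" using that by (auto simp: mult_left_mono)
    show ?thesis
    proof (cases "?y \<le> pi/3")
      case True
      have "sin ?y - ?y/3 \<ge> sin 0 - 0/3"
      proof (rule DERIV_nonneg_imp_nondecreasing[of 0 ?y "\<lambda>y. sin y - y/3"])
        fix t assume "0 \<le> t" "t \<le> ?y"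
        then have "cos (pi/3) \<le> cos t" using True pi_gt_zero by (intro cos_monotone_0_pi_le) linarith+
        then have "cos t - 1/3 \<ge> 0" by (simp add: cos_60)
        moreover have "((\<lambda>y. sin y - y/3) has_real_derivative cos t - 1/3) (at t)"
          by (auto intro!: derivative_eq_intros)
        ultimately show "\<exists>y. ((\<lambda>y. sin y - y/3) has_real_derivative y) (at t) \<and> 0 \<le> y" by blast
      qed (use y in auto)
      then show ?thesis by simp
    next
      case False
      then have "sin (pi/3) \<le> sin ?y" using y pi_gt_zero by (intro sin_monotone_2pi_le) linarith+
      moreover have "pi * x / 3 \<le> 2/3" using y pi_less_4 by linarith
      moreover have "sqrt 3 / 2 \<ge> 2/3" using real_le_rsqrt[of "4/3" 3] by (simp add: power2_eq_square)
      ultimately show ?thesis by (simp add: sin_60)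
    qed
  qed
  moreover have "x \<le> pi * x / 3" using mult_right_mono[of 3 pi x] pi_gt3 that by simp
  ultimately show ?thesis by linarith
qed

text \<open>In the closed form (1 - z^M) / (1 - z) the numerator is at most 2 and the denominator
  has modulus 2 |sin (pi \<rho>)| >= 2 |\<rho>|.\<close>

lemma norm_geometric_cis_le:
  fixes \<rho> :: real
  assumes "\<bar>\<rho>\<bar> \<le> 1/2" and "\<rho> \<noteq> 0"
  shows "cmod (\<Sum>k\<in>{0..<int M}. cis (2 * pi * (of_int k * \<rho>))) \<le> 1 / \<bar>\<rho>\<bar>"
proof -
  define z where "z = cis (2 * pi * \<rho>)"
  have "(\<Sum>k\<in>{0..<int M}. cis (2 * pi * (of_int k * \<rho>))) = (\<Sum>k<M. z ^ k)"
  proof (rule sum.reindex_bij_witness[where i = int and j = nat])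
    fix a assume "a \<in> {0..<int M}"
    then have "real_of_int a = real (nat a)" by simp
    moreover have "z ^ nat a = cis (real (nat a) * (2 * pi * \<rho>))"
      unfolding z_def by (rule Complex.DeMoivre)
    ultimately show "z ^ nat a = cis (2 * pi * (of_int a * \<rho>))"
      by (simp only: mult_ac)
  qed auto
  moreover have "(1 - z) * (\<Sum>k<M. z ^ k) = 1 - z ^ M"
    by (rule one_diff_power_eq[symmetric])
  then have "cmod (1 - z) * cmod (\<Sum>k<M. z ^ k) = cmod (1 - z ^ M)"
    by (metis norm_mult)
  moreover have "cmod (1 - z ^ M) \<le> 2"
    using norm_triangle_ineq4[of 1 "z^M"] by (simp add: z_def norm_power)
  moreover have "2 * \<bar>\<rho>\<bar> \<le> cmod (1 - z)"
  proof -
    have "cmod (1 - z)^2 = (1 - cos (2*pi*\<rho>))^2 + (sin (2*pi*\<rho>))^2"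
      by (simp add: z_def cmod_power2)
    also have "\<dots> = 2 - 2 * cos (2*pi*\<rho>)"
      using sin_cos_squared_add[of "2*pi*\<rho>"] by (simp add: power2_eq_square algebra_simps)
    also have "\<dots> = (2 * sin (pi*\<rho>))^2"
      using cos_double_sin[of "pi*\<rho>"] by (simp add: power2_eq_square algebra_simps)
    finally have "\<bar>cmod (1 - z)\<bar> = \<bar>2 * sin (pi*\<rho>)\<bar>"
      by (simp only: power2_eq_iff abs_eq_iff)
    then have "cmod (1 - z) = \<bar>2 * sin (pi*\<rho>)\<bar>" by simp
    moreover have "\<bar>\<rho>\<bar> \<le> \<bar>sin (pi * \<rho>)\<bar>"
      using sin_pi_ge[of \<rho>] sin_pi_ge[of "-\<rho>"] assms by (cases "\<rho> \<ge> 0") auto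
    ultimately show ?thesis by simp
  qed
  ultimately have "2 * \<bar>\<rho>\<bar> * cmod (\<Sum>k<M. z ^ k) \<le> 2"
    by (metis mult_right_mono norm_ge_zero order_trans)
  then show ?thesis
    using assms \<open>(\<Sum>k\<in>{0..<int M}. _ k) = _\<close> by (simp add: field_simps)
qed

text \<open>The signed distance to the nearest integer; the sign is kept so that cells on both sides
  of an integer receive different indices.\<close>

definition frac_dist :: "real \<Rightarrow> real" where
  "frac_dist x = x - of_int (round x)"

lemma abs_frac_dist_le: "\<bar>frac_dist x\<bar> \<le> 1/2"
  using of_int_round_abs_le[of x] by (simp add: frac_dist_def abs_minus_commute)

text \<open>The trivial bound 2 Q serves the cells next to an integer, where 1 + k^2 is at most 2;
  elsewhere the reciprocal distance to the nearest integer decays like Q/|k|. The form 1 / (1 + k^2)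
  merges both cases and is summable over k.\<close>

lemma norm_geometric_cis_cell:
  assumes "Q > 0" and k: "k = \<lfloor>real Q * frac_dist x\<rfloor>"
  shows "(cmod (\<Sum>k\<in>{0..<int (2 * Q)}. cis (2 * pi * (of_int k * x))))\<^sup>2
           \<le> 8 * (real Q)\<^sup>2 / (1 + (of_int k)\<^sup>2)"
proof -
  define S where "S = cmod (\<Sum>k\<in>{0..<int (2 * Q)}. cis (2 * pi * (of_int k * x)))"
  have S1: "S \<le> 2 * real Q"
  proof -
    have "S \<le> (\<Sum>k\<in>{0..<int (2 * Q)}. 1)"
      unfolding S_def by (rule order_trans[OF norm_sum]) (auto intro!: sum_mono)
    then show ?thesis by simp
  qed
  have per: "cis (2 * pi * (of_int j * x)) = cis (2 * pi * (of_int j * frac_dist x))" for j :: int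
  proof -
    have "cis (2 * pi * (of_int j * x)) =
        cis (2 * pi * (of_int j * frac_dist x)) * cis (2 * pi * of_int (j * round x))"
      by (simp add: frac_dist_def cis_mult algebra_simps)
    then show ?thesis by (simp add: cis_multiple_2pi)
  qed
  have S2: "S \<le> 1 / \<bar>frac_dist x\<bar>" if "frac_dist x \<noteq> 0"
    using norm_geometric_cis_le[OF abs_frac_dist_le that, of "2*Q"] by (simp add: S_def per)
  have k': "of_int k \<le> real Q * frac_dist x" "real Q * frac_dist x < of_int k + 1"
    using k by linarith+
  have "S\<^sup>2 \<le> 8 * (real Q)\<^sup>2 / (1 + (of_int k)\<^sup>2)"
  proof (cases "\<bar>k\<bar> \<le> 1")
    case True
    then have "k\<^sup>2 \<le> 1" by (simp add: abs_square_le_1)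
    then have "(of_int k :: real)\<^sup>2 \<le> 1" by (metis of_int_le_1_iff of_int_power)
    then have "4 * (real Q)\<^sup>2 * (1 + (of_int k)\<^sup>2) \<le> 4 * (real Q)\<^sup>2 * 2"
      by (intro mult_left_mono) auto
    moreover have "S\<^sup>2 \<le> (2 * real Q)\<^sup>2" using S1 by (intro power_mono) (auto simp: S_def)
    then have "S\<^sup>2 * (1 + (of_int k)\<^sup>2) \<le> 4 * (real Q)\<^sup>2 * (1 + (of_int k)\<^sup>2)"
      by (intro mult_right_mono) auto
    ultimately have "S\<^sup>2 * (1 + (of_int k)\<^sup>2) \<le> 8 * (real Q)\<^sup>2" by linarith
    then show ?thesis by (simp add: pos_le_divide_eq add_pos_nonneg)
  next
    case False
    \<comment> \<open>For negative k rounding down costs one unit, |k| - 1 < Q |frac_dist x|, and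
      |k| >= 2 turns this into a factor 2.\<close>
    have 1: "\<bar>of_int k\<bar> \<le> 2 * (real Q * \<bar>frac_dist x\<bar>)"
    proof (cases "k \<ge> 0")
      case True
      then have "0 \<le> real Q * frac_dist x" using k' by (simp add: order_trans[of 0 "of_int k"])
      then have "real Q * frac_dist x = real Q * \<bar>frac_dist x\<bar>" using assms(1) by (auto simp add: zero_le_mult_iff)
      then show ?thesis using k' True by linarith
    next
      case neg: False
      with False have "k \<le> -2" by auto
      then have "of_int k \<le> (-2::real)" by linarith
      moreover have "real Q * \<bar>frac_dist x\<bar> \<ge> - (real Q * frac_dist x)"
        by (metis abs_ge_minus_self abs_mult abs_of_nat)
      ultimately show ?thesis using k' by linarith
    qed
    have kpos: "\<bar>of_int k\<bar> > (1::real)" using False by linarith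
    have nz: "frac_dist x \<noteq> 0" using 1 kpos by auto
    have "S * \<bar>frac_dist x\<bar> \<le> 1" using S2[OF nz] nz by (simp add: field_simps)
    moreover have "S * \<bar>of_int k\<bar> \<le> S * (2 * (real Q * \<bar>frac_dist x\<bar>))"
      using 1 by (intro mult_left_mono) (auto simp: S_def)
    ultimately have "S * \<bar>of_int k\<bar> \<le> 2 * real Q"
      using mult_left_mono[of "S * \<bar>frac_dist x\<bar>" 1 "2 * real Q"] by (simp add: algebra_simps)
    then have "(S * \<bar>of_int k\<bar>)\<^sup>2 \<le> (2 * real Q)\<^sup>2"
      by (intro power_mono) (auto simp: S_def)
    then have 2: "S\<^sup>2 * (of_int k)\<^sup>2 \<le> 4 * (real Q)\<^sup>2" by (simp add: power_mult_distrib)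
    have "1 \<le> (of_int k :: real)\<^sup>2" using kpos by (metis abs_le_square_iff abs_of_nonneg less_imp_le one_power2 zero_le_one)
    then have "S\<^sup>2 * 1 \<le> S\<^sup>2 * (of_int k)\<^sup>2" by (intro mult_left_mono) auto
    with 2 have "S\<^sup>2 * (1 + (of_int k)\<^sup>2) \<le> 8 * (real Q)\<^sup>2" by (simp add: algebra_simps)
    then show ?thesis by (simp add: pos_le_divide_eq add_pos_nonneg)
  qed
  then show ?thesis by (simp add: S_def)
qed

lemma sum_Un_le:
  fixes f :: "'a \<Rightarrow> real"
  assumes "finite A" "finite B" "\<And>x. f x \<ge> 0"
  shows "sum f (A \<union> B) \<le> sum f A + sum f B"
proof -
  have "sum f (A \<inter> B) \<ge> 0" using assms(3) by (intro sum_nonneg)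
  then show ?thesis using assms(1,2) by (simp add: sum_Un)
qed

text \<open>The correction 4 / (M + 1) makes the bound inductive: the two new terms are at most 4 /
  ((M + 1)(M + 2)), which telescopes. What is wanted is the bound 5, uniform in M.\<close>

lemma sum_inverse_square_int_le: "(\<Sum>k\<in>{- int M..int M}. 1 / (1 + (real_of_int k)\<^sup>2)) \<le> 5 - 4 / (real M + 1)"
proof (induction M)
  case (Suc M)
  have "{- int (Suc M)..int (Suc M)} = insert (- int (Suc M)) (insert (int (Suc M)) {- int M..int M})"
    by auto
  then have "(\<Sum>k\<in>{- int (Suc M)..int (Suc M)}. 1 / (1 + (real_of_int k)\<^sup>2)) =
      2 / (1 + (real M + 1)\<^sup>2) + (\<Sum>k\<in>{- int M..int M}. 1 / (1 + (real_of_int k)\<^sup>2))"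
    by (simp add: power2_eq_square algebra_simps)
  also have "2 / (1 + (real M + 1)\<^sup>2) \<le> 4 / ((real M + 1) * (real M + 2))"
    by (simp add: divide_simps add_pos_nonneg) (simp add: power2_eq_square algebra_simps)
  also have "4 / ((real M + 1) * (real M + 2)) = 4 / (real M + 1) - 4 / (real M + 2)"
    by (simp add: divide_simps)
  finally show ?case using Suc by (simp add: add.commute[of 2])
qed simp

text \<open>Comparison with the integral of x^(-\<sigma>), whose value M^(1-\<sigma>) / (1-\<sigma>)
  is at most 2 M^(1-\<sigma>) since \<sigma> \<le> 1/2.\<close>

lemma sum_powr_le:
  assumes "0 \<le> \<sigma>" "\<sigma> \<le> 1/2"
  shows "(\<Sum>j\<in>{1..M}. real j powr - \<sigma>) \<le> 2 * real M powr (1 - \<sigma>)"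
proof (induction M)
  case (Suc M)
  have "(real M + 1) powr - \<sigma> \<le> 2 * (real M + 1) powr (1 - \<sigma>) - 2 * real M powr (1 - \<sigma>)"
  proof -
    let ?a = "real M + 1"
    have a_powr: "?a powr (1 - \<sigma>) = real M * ?a powr - \<sigma> + ?a powr - \<sigma>"
      using powr_add[of ?a 1 "- \<sigma>"] by (simp add: distrib_right)
    have "real M powr (1 - \<sigma>) \<le> real M * ?a powr - \<sigma> + 1/2 * ?a powr - \<sigma>"
    proof (cases "M = 0")
      case False
      have "\<exists>z>real M. z < ?a \<and> ?a powr (1 - \<sigma>) - real M powr (1 - \<sigma>)
              = (?a - real M) * ((1 - \<sigma>) * z powr - \<sigma>)"
      proof (rule MVT2)
        fix x assume "real M \<le> x" "x \<le> real M + 1"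
        then have "x > 0" using False by linarith
        from has_real_derivative_powr[OF this, of "1 - \<sigma>"]
        show "((\<lambda>x. x powr (1 - \<sigma>)) has_real_derivative (1 - \<sigma>) * x powr - \<sigma>) (at x)"
          by simp
      qed simp
      then obtain z where z: "z > real M" "z < ?a" and
        e: "?a powr (1 - \<sigma>) - real M powr (1 - \<sigma>) = (1 - \<sigma>) * z powr - \<sigma>" by auto
      have "1/2 * ?a powr - \<sigma> \<le> (1 - \<sigma>) * z powr - \<sigma>"
        using z False assms by (intro mult_mono powr_mono2') auto
      then show ?thesis using e a_powr by linarith
    qed simp
    then show ?thesis using a_powr by linarith
  qed
  then show ?case using Suc by (simp add: add.commute)
qed simp

section \<open>Weighted sums over separated frequencies\<close>

text \<open>The maximum with 1 gives a vanishing coordinate the factor 1; without it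
  \<open>0 powr - \<sigma>\<close> would be 0 and the weight would no longer bound Fourier
  coefficients from above.\<close>

definition decay_weight :: "real \<Rightarrow> ('a::finite \<Rightarrow> int) \<Rightarrow> real" where
  "decay_weight \<sigma> v = (\<Prod>i\<in>UNIV. max 1 \<bar>of_int (v i)\<bar> powr - \<sigma>)"

lemma decay_weight_nonneg [simp]: "decay_weight \<sigma> v \<ge> 0"
  by (auto simp: decay_weight_def intro: prod_nonneg)

text \<open>Each half-open cube of side \<open>L\<close> contains at most one point of \<open>A\<close>.\<close>

lemma sum_decay_weight_separated:
  fixes A :: "('a::finite \<Rightarrow> int) set"
  assumes \<sigma>: "0 \<le> \<sigma>" "\<sigma> \<le> 1/2" and "L \<ge> 1" and "N \<ge> 1" and B: "B \<ge> 0" "real N powr (1 - \<sigma>) \<le> B * L"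
    and box: "\<And>v i. v \<in> A \<Longrightarrow> \<bar>v i\<bar> < int N"
    and sep: "\<And>u v. u \<in> A \<Longrightarrow> v \<in> A \<Longrightarrow> u \<noteq> v \<Longrightarrow> real CARD('a) * L \<le> norm (int_vec u - int_vec v)"
  shows "(\<Sum>v\<in>A. decay_weight \<sigma> v) \<le> (11 + 8 * B) ^ CARD('a)"
proof -
  define \<mu> where "\<mu> v = (\<lambda>i. \<lfloor>real_of_int (v i) / L\<rfloor>)" for v :: "'a \<Rightarrow> int"
  define R where "R = nat \<lceil>real N / L\<rceil>"
  \<comment> \<open>\<open>e k\<close> bounds the one-dimensional weight on the cell [k L, (k + 1)
    L): for either sign of k its points have modulus at least L (|k| - 1), which says nothing for
    |k| \<le> 1.\<close>
  define e where "e k = (if \<bar>k\<bar> \<le> 1 then 1 else (L * (\<bar>real_of_int k\<bar> - 1)) powr - \<sigma>)" for k :: int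
  have inj: "inj_on \<mu> A"
  proof (rule inj_onI, rule ccontr)
    fix u v assume uv: "u \<in> A" "v \<in> A" "\<mu> u = \<mu> v" "u \<noteq> v"
    have "\<bar>(int_vec u - int_vec v) $ i\<bar> < L" for i
    proof -
      have "\<lfloor>real_of_int (u i) / L\<rfloor> = \<lfloor>real_of_int (v i) / L\<rfloor>"
        using uv(3) by (auto simp: \<mu>_def fun_eq_iff)
      then have "\<bar>real_of_int (u i) / L - real_of_int (v i) / L\<bar> < 1" by linarith
      moreover have "real_of_int (u i) / L - real_of_int (v i) / L = (real_of_int (u i) - real_of_int (v i)) / L"
        by (simp add: diff_divide_distrib)
      ultimately show ?thesis using \<open>L \<ge> 1\<close> by (simp add: abs_divide)
    qed
    then have "(\<Sum>i\<in>UNIV. \<bar>(int_vec u - int_vec v) $ i\<bar>) < (\<Sum>i\<in>(UNIV::'a set). L)"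
      by (intro sum_strict_mono) auto
    then have "norm (int_vec u - int_vec v) < real CARD('a) * L"
      using norm_le_l1_cart[of "int_vec u - int_vec v"] by simp
    with sep[OF uv(1,2,4)] show False by simp
  qed
  have e0: "e k \<ge> 0" for k by (simp add: e_def)
  have range: "\<mu> v i \<in> {- int R..int R}" if "v \<in> A" for v i
  proof -
    have "\<bar>real_of_int (v i)\<bar> \<le> real N" using box[OF that, of i] by linarith
    then have "\<bar>real_of_int (v i) / L\<bar> \<le> real N / L" using \<open>L \<ge> 1\<close> by (simp add: divide_right_mono abs_divide)
    moreover have "real N / L \<ge> 0" using \<open>L \<ge> 1\<close> by simp
    then have "int R = \<lceil>real N / L\<rceil>" unfolding R_def by linarith
    moreover have "- \<lceil>y\<rceil> \<le> \<lfloor>x\<rfloor> \<and> \<lfloor>x\<rfloor> \<le> \<lceil>y\<rceil>" if "\<bar>x\<bar> \<le> y" for x y :: real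
      using that by linarith
    ultimately show ?thesis unfolding \<mu>_def by (metis atLeastAtMost_iff)
  qed
  have le: "decay_weight \<sigma> v \<le> (\<Prod>i\<in>UNIV. e (\<mu> v i))" for v
    unfolding decay_weight_def
  proof (intro prod_mono conjI)
    fix i
    show "max 1 \<bar>real_of_int (v i)\<bar> powr - \<sigma> \<le> e (\<mu> v i)"
    proof (cases "\<bar>\<mu> v i\<bar> \<le> 1")
      case True
      have "max 1 \<bar>real_of_int (v i)\<bar> powr - \<sigma> \<le> 1 powr - \<sigma>"
        using \<sigma> by (intro powr_mono2') auto
      then show ?thesis using True by (simp add: e_def)
    next
      case False
      have "\<bar>real_of_int (\<mu> v i)\<bar> - 1 \<le> \<bar>real_of_int (v i) / L\<bar>"
        unfolding \<mu>_def by linarith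
      then have "L * (\<bar>real_of_int (\<mu> v i)\<bar> - 1) \<le> \<bar>real_of_int (v i)\<bar>"
        using \<open>L \<ge> 1\<close> by (simp add: abs_divide field_simps)
      moreover have "0 < L * (\<bar>real_of_int (\<mu> v i)\<bar> - 1)" using False \<open>L \<ge> 1\<close> by (intro mult_pos_pos) auto
      ultimately show ?thesis using False \<sigma> by (auto simp: e_def intro!: powr_mono2')
    qed
  qed auto
  \<comment> \<open>The three cells -1, 0, 1 contribute 3, and the remaining cells contribute at
    most 4 + 4 B for each sign.\<close>
  have sum_e: "(\<Sum>k\<in>{- int R..int R}. e k) \<le> 11 + 8 * B"
  proof -
    have "(\<Sum>k\<in>{- int R..int R}. e k) \<le>
        (\<Sum>k\<in>{-1,0,1} \<union> ((\<lambda>j. int j + 1) ` {1..R} \<union> (\<lambda>j. - int j - 1) ` {1..R}). e k)"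
    proof (intro sum_mono2 subsetI)
      fix k assume k: "k \<in> {- int R..int R}"
      have "k \<in> {-1,0,1} \<or> k = int (nat (k - 1)) + 1 \<and> nat (k-1) \<in> {1..R}
          \<or> k = - int (nat (-k - 1)) - 1 \<and> nat (-k-1) \<in> {1..R}"
        using k by auto
      then show "k \<in> {-1,0,1} \<union> ((\<lambda>j. int j + 1) ` {1..R} \<union> (\<lambda>j. - int j - 1) ` {1..R})"
        by blast
    qed (auto simp: e0)
    also have "\<dots> \<le> (\<Sum>k\<in>{-1,0,1}. e k) + ((\<Sum>k\<in>(\<lambda>j. int j + 1) ` {1..R}. e k) + (\<Sum>k\<in>(\<lambda>j. - int j - 1) ` {1..R}. e k))"
      by (intro order_trans[OF sum_Un_le] add_mono) (auto simp: e0 intro!: sum_Un_le)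
    also have "(\<Sum>k\<in>(\<lambda>j. int j + 1) ` {1..R}. e k) = (\<Sum>j\<in>{1..R}. (L * real j) powr - \<sigma>)"
      by (subst sum.reindex) (auto simp: inj_on_def e_def intro!: sum.cong)
    also have "(\<Sum>k\<in>(\<lambda>j. - int j - 1) ` {1..R}. e k) = (\<Sum>j\<in>{1..R}. (L * real j) powr - \<sigma>)"
      by (subst sum.reindex) (auto simp: inj_on_def e_def intro!: sum.cong)
    also have "(\<Sum>k\<in>{-1,0,1}. e k) = 3" by (simp add: e_def)
    also have "(\<Sum>j\<in>{1..R}. (L * real j) powr - \<sigma>) = L powr - \<sigma> * (\<Sum>j\<in>{1..R}. real j powr - \<sigma>)"
      using \<open>L \<ge> 1\<close> by (simp add: powr_mult sum_distrib_left)
    also have "\<dots> \<le> L powr - \<sigma> * (2 * real R powr (1 - \<sigma>))"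
      by (intro mult_left_mono sum_powr_le \<sigma>) auto
    also have "\<dots> \<le> 4 + 4 * B"
    proof -
      have "real R \<le> 2 * max 1 (real N / L)"
      proof -
        have "real (nat \<lceil>y\<rceil>) \<le> 2 * max 1 y" if "y \<ge> 0" for y :: real
        proof -
          have "real (nat \<lceil>y\<rceil>) \<le> y + 1" using that by linarith
          then show ?thesis by simp
        qed
        then show ?thesis using \<open>L \<ge> 1\<close> by (simp add: R_def)
      qed
      then have "real R powr (1 - \<sigma>) \<le> (2 * max 1 (real N / L)) powr (1 - \<sigma>)"
        using \<sigma> by (intro powr_mono2) auto
      also have "\<dots> = 2 powr (1 - \<sigma>) * (max 1 (real N / L)) powr (1 - \<sigma>)"
        by (simp add: powr_mult)
      also have "\<dots> \<le> 2 * (1 + (real N / L) powr (1 - \<sigma>))"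
      proof (intro mult_mono)
        show "2 powr (1 - \<sigma>) \<le> (2::real)" using \<sigma> powr_mono[of "1 - \<sigma>" 1 2] by simp
      qed (auto simp: max_def)
      finally have "L powr - \<sigma> * real R powr (1 - \<sigma>) \<le> L powr - \<sigma> * (2 * (1 + (real N / L) powr (1 - \<sigma>)))"
        by (intro mult_left_mono) auto
      also have "\<dots> = 2 * L powr - \<sigma> + 2 * (real N powr (1 - \<sigma>) / L)"
        using \<open>L \<ge> 1\<close> by (simp add: powr_divide powr_diff powr_minus field_simps)
      also have "\<dots> \<le> 2 * 1 + 2 * B"
      proof (intro add_mono mult_left_mono)
        show "L powr - \<sigma> \<le> 1" using \<open>L \<ge> 1\<close> \<sigma> powr_mono[of "-\<sigma>" 0 L] by simp
        show "real N powr (1 - \<sigma>) / L \<le> B" using B \<open>L \<ge> 1\<close> by (simp add: field_simps)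
      qed auto
      finally show ?thesis by simp
    qed
    finally show ?thesis by simp
  qed
  have "(\<Sum>v\<in>A. decay_weight \<sigma> v) \<le> (\<Sum>v\<in>A. \<Prod>i\<in>UNIV. e (\<mu> v i))"
    by (intro sum_mono le)
  also have "\<dots> = (\<Sum>w\<in>\<mu> ` A. \<Prod>i\<in>UNIV. e (w i))"
    using inj by (simp add: sum.reindex)
  also have "\<dots> \<le> (\<Sum>w\<in>PiE (UNIV :: 'a set) (\<lambda>_. {- int R..int R}). \<Prod>i\<in>UNIV. e (w i))"
  proof (rule sum_mono2)
    show "\<mu> ` A \<subseteq> PiE UNIV (\<lambda>_. {- int R..int R})" using range by auto
  qed (auto intro!: prod_nonneg e0 finite_PiE)
  also have "\<dots> = (\<Prod>i\<in>(UNIV::'a set). \<Sum>k\<in>{- int R..int R}. e k)"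
    using prod_sum_PiE[of "UNIV :: 'a set" "\<lambda>_. {- int R..int R}" "\<lambda>_. e"] by simp
  also have "\<dots> \<le> (11 + 8 * B) ^ CARD('a)"
    unfolding prod_constant by (intro power_mono sum_e sum_nonneg e0)
  finally show ?thesis .
qed

text \<open>For \<tau> above the exponent only finitely many pairs violate the bound with constant
  1. The constant c absorbs them, provided that the form vanishes at none of them.\<close>

lemma irrationality_exponent_lessE:
  fixes A :: "real ^ 'b::finite ^ 'a::finite"
  assumes "irrationality_exponent A < ereal X" "X > 0"
  obtains \<tau> c where "0 < \<tau>" "\<tau> < X" "c > 0"
    "\<And>u p. u \<noteq> (\<lambda>_. 0) \<Longrightarrow> c * norm (int_vec u) powr - \<tau> \<le> norm (A *v int_vec u + int_vec p)"
proof -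
  \<comment> \<open>The exponent may be negative, even minus infinity for an empty supremum; the
    maximum forces \<tau> > 0.\<close>
  have "max 0 (irrationality_exponent A) < ereal X" using assms by simp
  then obtain \<tau> where \<tau>: "max 0 (irrationality_exponent A) < ereal \<tau>" "ereal \<tau> < ereal X"
    using ereal_dense2 by blast
  then have \<tau>': "0 < \<tau>" "irrationality_exponent A < ereal \<tau>" "\<tau> < X" by auto
  define S where "S = {(p, q). p \<in> int_points \<and> q \<in> int_points - {0} \<and> norm (A *v q + p) \<le> norm q powr - \<tau>}"
  have "\<not> approximable (\<lambda>q. q powr - \<tau>) A"
  proof
    assume "approximable (\<lambda>q. q powr - \<tau>) A"
    then have "ereal \<tau> \<le> irrationality_exponent A"
      unfolding irrationality_exponent_def using \<open>0 < \<tau>\<close> by (intro SUP_upper) auto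
    with \<tau>'(2) show False by simp
  qed
  then have fin: "finite S" by (simp add: approximable_def S_def)
  \<comment> \<open>A zero of the form persists under all positive integer multiples of (p, q),
    which would put infinitely many pairs into the finite set \<open>S\<close>.\<close>
  have nz: "A *v q + p \<noteq> 0" if "(p, q) \<in> S" for p q
  proof
    assume 0: "A *v q + p = 0"
    have pq: "p \<in> int_points" "q \<in> int_points" "q \<noteq> 0" using that by (auto simp: S_def)
    have "(real j *\<^sub>R p, real j *\<^sub>R q) \<in> S" if "j \<in> {1..}" for j :: nat
    proof -
      have "A *v (real j *\<^sub>R q) + real j *\<^sub>R p = real j *\<^sub>R (A *v q + p)"
        by (simp add: matrix_vector_mult_scaleR algebra_simps)
      then show ?thesis using pq that 0 by (auto simp: S_def int_points_def)
    qed
    then have "(\<lambda>j::nat. (real j *\<^sub>R p, real j *\<^sub>R q)) ` {1..} \<subseteq> S" by auto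
    moreover have "inj_on (\<lambda>j::nat. (real j *\<^sub>R p, real j *\<^sub>R q)) {1..}"
      using pq by (auto simp: inj_on_def)
    ultimately have "finite {1::nat..}" using finite_imageD[OF finite_subset[OF _ fin]] by auto
    then show False using infinite_Ici by blast
  qed
  define c where "c = Min (insert 1 ((\<lambda>(p, q). norm (A *v q + p) * norm q powr \<tau>) ` S))"
  have "c > 0" unfolding c_def using fin nz by (subst Min_gr_iff) (auto simp: S_def)
  moreover have "c * norm (int_vec u) powr - \<tau> \<le> norm (A *v int_vec u + int_vec p)" if "u \<noteq> (\<lambda>_. 0)" for u p
  proof -
    let ?q = "int_vec u" and ?p = "int_vec p :: real ^ 'a"
    have q0: "?q \<noteq> 0" using that by (auto simp: vec_eq_iff fun_eq_iff)
    have pos: "norm ?q powr \<tau> > 0" "norm ?q powr - \<tau> = inverse (norm ?q powr \<tau>)" using q0 by (auto simp: powr_minus)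
    show ?thesis
    proof (cases "(?p, ?q) \<in> S")
      case True
      then have "norm (A *v ?q + ?p) * norm ?q powr \<tau> \<in> (\<lambda>(p, q). norm (A *v q + p) * norm q powr \<tau>) ` S"
        by (intro image_eqI[of _ _ "(?p, ?q)"]) auto
      then have "c \<le> norm (A *v ?q + ?p) * norm ?q powr \<tau>"
        unfolding c_def using fin by (intro Min_le) auto
      then show ?thesis unfolding pos(2) divide_inverse[symmetric] by (simp only: pos_divide_le_eq[OF pos(1)])
    next
      case False
      then have "norm ?q powr - \<tau> \<le> norm (A *v ?q + ?p)"
        using q0 by (auto simp: S_def int_points_def)
      moreover have "c \<le> 1" unfolding c_def using fin by (intro Min_le) auto
      then have "c * norm ?q powr - \<tau> \<le> 1 * norm ?q powr - \<tau>"
        by (intro mult_right_mono) auto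
      ultimately show ?thesis by simp
    qed
  qed
  ultimately show thesis using \<tau>' that by blast
qed

text \<open>Split the torus into cells of side \<open>1/Q\<close>: the kernel decays quadratically with the cell index,
  while the frequencies falling into one cell are separated because \<open>A\<close> is not too well approximable.\<close>

lemma sum_decay_weight_kernel:
  fixes A :: "real ^ 'b::finite ^ 'a::finite" and X :: "('b \<Rightarrow> int) set" and c \<tau> :: real and Q :: nat
  defines "L \<equiv> (c * real Q / real CARD('a)) powr (1 / \<tau>) / real CARD('b)"
  assumes "c > 0" "\<tau> > 0" "Q > 0"
    and dioph: "\<And>u p. u \<noteq> (\<lambda>_. 0) \<Longrightarrow> c * norm (int_vec u) powr - \<tau> \<le> norm (A *v int_vec u + int_vec p)"
    and \<sigma>: "0 \<le> \<sigma>" "\<sigma> \<le> 1/2" and "L \<ge> 1" and "N \<ge> 1" and B: "B \<ge> 0" "real N powr (1 - \<sigma>) \<le> B * L"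
    and "finite X" and box: "\<And>v i. v \<in> X \<Longrightarrow> \<bar>v i\<bar> < int N"
  shows "(\<Sum>v\<in>X. decay_weight \<sigma> v * (cmod (exp_sum (2 * Q) (A *v int_vec v)))\<^sup>2)
           \<le> (40 * (real Q)\<^sup>2) ^ CARD('a) * (11 + 8 * B) ^ CARD('b)"
proof -
  define \<kappa> where "\<kappa> v = (\<lambda>j. \<lfloor>real Q * frac_dist ((A *v int_vec v) $ j)\<rfloor>)" for v
  define K where "K k = (\<Prod>j\<in>UNIV. 8 * (real Q)\<^sup>2 / (1 + (real_of_int (k j))\<^sup>2))" for k :: "'a \<Rightarrow> int"
  define T where "T = PiE (UNIV::'a set) (\<lambda>_. {- int Q..int Q})"
  have K0: "K k \<ge> 0" for k by (auto simp: K_def intro!: prod_nonneg)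
  have K: "(cmod (exp_sum (2 * Q) (A *v int_vec v)))\<^sup>2 \<le> K (\<kappa> v)" for v
  proof -
    have "(cmod (exp_sum (2 * Q) (A *v int_vec v)))\<^sup>2 =
        (\<Prod>j\<in>UNIV. (cmod (\<Sum>k\<in>{0..<int (2 * Q)}. cis (2 * pi * (of_int k * (A *v int_vec v) $ j))))\<^sup>2)"
      unfolding exp_sum_eq_prod by (simp only: prod_norm[symmetric] prod_power_distrib)
    also have "\<dots> \<le> K (\<kappa> v)"
      unfolding K_def by (intro prod_mono conjI norm_geometric_cis_cell \<open>Q > 0\<close>) (auto simp: \<kappa>_def)
    finally show ?thesis .
  qed
  have \<kappa>T: "\<kappa> ` X \<subseteq> T"
  proof -
    have "\<lfloor>real Q * frac_dist y\<rfloor> \<in> {- int Q..int Q}" for y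
    proof -
      have "\<bar>real Q * frac_dist y\<bar> \<le> real Q * 1"
        unfolding abs_mult using abs_frac_dist_le[of y] by (intro mult_mono) auto
      then show ?thesis by simp linarith
    qed
    then show ?thesis by (auto simp: \<kappa>_def T_def)
  qed
  have fiber: "(\<Sum>v\<in>{v \<in> X. \<kappa> v = k}. decay_weight \<sigma> v * (cmod (exp_sum (2 * Q) (A *v int_vec v)))\<^sup>2)
      \<le> K k * (11 + 8 * B) ^ CARD('b)" for k
  proof -
    have "(\<Sum>v\<in>{v \<in> X. \<kappa> v = k}. decay_weight \<sigma> v) \<le> (11 + 8 * B) ^ CARD('b)"
    proof (rule sum_decay_weight_separated[OF \<sigma> \<open>L \<ge> 1\<close> \<open>N \<ge> 1\<close> B])
      fix u v assume uv: "u \<in> {v \<in> X. \<kappa> v = k}" "v \<in> {v \<in> X. \<kappa> v = k}" "u \<noteq> v"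
      define w where "w = (\<lambda>i. u i - v i)"
      \<comment> \<open>With this p the integer parts cancel: A w + p is the difference of two
        vectors of signed fractional parts lying in the same cell, so each coordinate is smaller
        than 1/Q.\<close>
      define p where "p j = round ((A *v int_vec v) $ j) - round ((A *v int_vec u) $ j)" for j
      have w0: "w \<noteq> (\<lambda>_. 0)" using uv(3) by (auto simp: w_def fun_eq_iff)
      have wv: "int_vec w = int_vec u - int_vec v" by (simp add: w_def int_vec_diff)
      have "\<bar>(A *v int_vec w + int_vec p) $ j\<bar> < 1 / real Q" for j
      proof -
        have "\<kappa> u j = \<kappa> v j" using uv by auto
        then have "\<lfloor>real Q * frac_dist ((A *v int_vec u) $ j)\<rfloor> = \<lfloor>real Q * frac_dist ((A *v int_vec v) $ j)\<rfloor>"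
          by (simp add: \<kappa>_def)
        then have "\<bar>real Q * frac_dist ((A *v int_vec u) $ j) - real Q * frac_dist ((A *v int_vec v) $ j)\<bar> < 1"
          by linarith
        moreover have "real Q * frac_dist ((A *v int_vec u) $ j) - real Q * frac_dist ((A *v int_vec v) $ j)
            = real Q * (A *v int_vec w + int_vec p) $ j"
          by (simp add: wv matrix_vector_mult_diff_distrib frac_dist_def p_def algebra_simps)
        ultimately have "real Q * \<bar>(A *v int_vec w + int_vec p) $ j\<bar> < 1" by (simp only: abs_mult abs_of_nat)
        then show ?thesis using \<open>Q > 0\<close> by (simp add: pos_less_divide_eq mult.commute)
      qed
      then have "(\<Sum>j\<in>UNIV. \<bar>(A *v int_vec w + int_vec p) $ j\<bar>) < (\<Sum>j\<in>(UNIV::'a set). 1 / real Q)"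
        by (intro sum_strict_mono) auto
      then have "norm (A *v int_vec w + int_vec p) < real CARD('a) / real Q"
        using norm_le_l1_cart[of "A *v int_vec w + int_vec p"] by simp
      \<comment> \<open>Solving this for the norm of w gives more than (c Q / CARD('a))^(1/\<tau>),
        which is CARD('b) * L; this is the origin of \<open>L\<close>.\<close>
      then have "c * norm (int_vec w) powr - \<tau> < real CARD('a) / real Q"
        using dioph[OF w0, of p] by linarith
      moreover have nw: "norm (int_vec w) > 0" using w0 by (auto simp: vec_eq_iff fun_eq_iff)
      ultimately have "c * real Q / real CARD('a) < norm (int_vec w) powr \<tau>"
        using \<open>Q > 0\<close> by (simp add: powr_minus field_simps)
      then have "(c * real Q / real CARD('a)) powr (1 / \<tau>) \<le> (norm (int_vec w) powr \<tau>) powr (1 / \<tau>)"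
        using \<open>c > 0\<close> \<open>\<tau> > 0\<close> by (intro powr_mono2) auto
      also have "\<dots> = norm (int_vec w)" using nw \<open>\<tau> > 0\<close> by (simp add: powr_powr)
      finally show "real CARD('b) * L \<le> norm (int_vec u - int_vec v)"
        by (simp add: L_def wv)
    qed (use box in auto)
    then have "K k * (\<Sum>v\<in>{v \<in> X. \<kappa> v = k}. decay_weight \<sigma> v) \<le> K k * (11 + 8 * B) ^ CARD('b)"
      by (intro mult_left_mono K0)
    moreover have "(\<Sum>v\<in>{v \<in> X. \<kappa> v = k}. decay_weight \<sigma> v * (cmod (exp_sum (2 * Q) (A *v int_vec v)))\<^sup>2)
        \<le> (\<Sum>v\<in>{v \<in> X. \<kappa> v = k}. decay_weight \<sigma> v * K k)"
      using K by (intro sum_mono mult_left_mono) auto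
    ultimately show ?thesis unfolding sum_distrib_right[symmetric] by (simp only: mult.commute[of _ "K k"])
  qed
  have "(\<Sum>v\<in>X. decay_weight \<sigma> v * (cmod (exp_sum (2 * Q) (A *v int_vec v)))\<^sup>2) =
      (\<Sum>k\<in>T. \<Sum>v\<in>{v \<in> X. \<kappa> v = k}. decay_weight \<sigma> v * (cmod (exp_sum (2 * Q) (A *v int_vec v)))\<^sup>2)"
    using \<kappa>T \<open>finite X\<close> by (intro sum.group[symmetric]) (auto simp: T_def intro!: finite_PiE)
  also have "\<dots> \<le> (\<Sum>k\<in>T. K k * (11 + 8 * B) ^ CARD('b))"
    by (intro sum_mono fiber)
  also have "\<dots> = (\<Sum>k\<in>T. K k) * (11 + 8 * B) ^ CARD('b)"
    by (simp add: sum_distrib_right)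
  \<comment> \<open>The sum over all cells factorizes over the coordinates. The factor 40 is 8 from
    the kernel bound times 5 from \<open>sum_inverse_square_int_le\<close>.\<close>
  also have "(\<Sum>k\<in>T. K k) = (\<Prod>j\<in>(UNIV::'a set). \<Sum>k\<in>{- int Q..int Q}. 8 * (real Q)\<^sup>2 / (1 + (real_of_int k)\<^sup>2))"
    using prod_sum_PiE[of "UNIV :: 'a set" "\<lambda>_. {- int Q..int Q}" "\<lambda>_ k. 8 * (real Q)\<^sup>2 / (1 + (real_of_int k)\<^sup>2)"]
    by (simp add: T_def K_def)
  also have "\<dots> = (8 * (real Q)\<^sup>2 * (\<Sum>k\<in>{- int Q..int Q}. 1 / (1 + (real_of_int k)\<^sup>2))) ^ CARD('a)"
    by (simp add: sum_distrib_left)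
  also have "\<dots> \<le> (8 * (real Q)\<^sup>2 * 5) ^ CARD('a)"
  proof (intro power_mono mult_left_mono)
    show "(\<Sum>k\<in>{- int Q..int Q}. 1 / (1 + (real_of_int k)\<^sup>2)) \<le> 5"
      using sum_inverse_square_int_le[of Q] by (rule order_trans) simp
  qed (auto intro!: mult_nonneg_nonneg sum_nonneg)
  finally show ?thesis using B by (simp add: mult_right_mono)
qed

section \<open>A counting polynomial and the convergence argument\<close>

text \<open>Periodicity removes the unknown integer translation p from the detection
  problem.\<close>

lemma exp_sum_add_int_vec: "exp_sum N (y + int_vec p) = exp_sum N y"
proof -
  have "cis (2 * pi * (int_vec h \<bullet> (y + int_vec p))) = cis (2 * pi * (int_vec h \<bullet> y))" for h
  proof -
    have "int_vec h \<bullet> int_vec p = of_int (\<Sum>i\<in>UNIV. h i * p i)"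
      by (simp add: inner_vec_def)
    then have "2 * pi * (int_vec h \<bullet> (y + int_vec p)) =
        2 * pi * (int_vec h \<bullet> y) + 2 * pi * of_int (\<Sum>i\<in>UNIV. h i * p i)"
      by (simp only: inner_add_right distrib_left)
    then show ?thesis
      using cis_multiple_2pi[OF Ints_of_int, of "\<Sum>i\<in>UNIV. h i * p i"]
      by (simp only: cis_mult[symmetric] mult_1_right)
  qed
  then show ?thesis by (simp add: exp_sum_def)
qed

text \<open>There is no cancellation: after translation by p every phase has modulus at most pi/4 <
  pi/3, so each of the N^CARD('a) terms has real part at least 1/2.\<close>

lemma exp_sum_lower_bound:
  fixes y :: "real ^ 'a::finite"
  assumes y: "\<And>i. \<bar>(y + int_vec p) $ i\<bar> \<le> \<delta>" and N: "real CARD('a) * real N * \<delta> \<le> 1 / 8"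
  shows "real N ^ CARD('a) / 2 \<le> cmod (exp_sum N y)"
proof -
  define z where "z = y + int_vec p"
  have "1 / 2 \<le> Re (cis (2 * pi * (int_vec h \<bullet> z)))" if "h \<in> int_box N" for h
  proof -
    have "\<bar>int_vec h \<bullet> z\<bar> \<le> (\<Sum>i\<in>UNIV. \<bar>int_vec h $ i * z $ i\<bar>)"
      unfolding inner_vec_def by simp
    also have "\<dots> \<le> (\<Sum>i\<in>(UNIV::'a set). real N * \<delta>)"
      unfolding abs_mult
    proof (intro sum_mono mult_mono)
      fix i
      have "0 \<le> h i \<and> h i < int N" using that by (simp add: mem_int_box)
      then show "\<bar>int_vec h $ i\<bar> \<le> real N" by simp
      show "\<bar>z $ i\<bar> \<le> \<delta>" using y by (simp add: z_def)
    qed auto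
    finally have "\<bar>int_vec h \<bullet> z\<bar> \<le> 1 / 8" using N by (simp add: mult.assoc)
    then have "\<bar>2 * pi * (int_vec h \<bullet> z)\<bar> \<le> 2 * pi * (1 / 8)"
      unfolding abs_mult by (intro mult_mono) auto
    then have 1: "\<bar>2 * pi * (int_vec h \<bullet> z)\<bar> \<le> pi / 3" using pi_gt_zero by linarith
    have "cos (pi / 3) \<le> cos \<bar>2 * pi * (int_vec h \<bullet> z)\<bar>"
      using 1 pi_gt_zero by (intro cos_monotone_0_pi_le) linarith+
    then show ?thesis by (simp only: cos_60 cos_abs_real cis.simps)
  qed
  then have "(\<Sum>h\<in>(int_box N :: ('a \<Rightarrow> int) set). 1 / 2) \<le> (\<Sum>h\<in>int_box N. Re (cis (2 * pi * (int_vec h \<bullet> z))))"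
    by (intro sum_mono)
  then have "real N ^ CARD('a) / 2 \<le> Re (exp_sum N z)"
    by (simp add: exp_sum_def card_int_box Re_sum)
  also have "\<dots> \<le> cmod (exp_sum N z)" by (rule complex_Re_le_cmod)
  finally show ?thesis by (simp add: z_def exp_sum_add_int_vec)
qed

text \<open>A nonnegative trigonometric polynomial that is at least \<open>1\<close> at \<open>y\<close> whenever
  \<open>\<alpha> q + y\<close> is within \<open>O(1/N)\<close> of an integer point for some \<open>q\<close> of size at most \<open>Q\<close>.\<close>

definition detector :: "nat \<Rightarrow> nat \<Rightarrow> real ^ 'n::finite ^ 'm::finite \<Rightarrow> real ^ 'm \<Rightarrow> real" where
  "detector N Q \<alpha> y = 4 / (real N ^ (2 * CARD('m)) * real Q ^ CARD('n)) *
     (\<Sum>r\<in>int_box (2 * Q). \<Sum>r'\<in>int_box (2 * Q).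
        (cmod (exp_sum N (y + \<alpha> *v int_vec (\<lambda>i. r i - r' i))))\<^sup>2)"

lemma detector_nonneg [simp]: "detector N Q \<alpha> y \<ge> 0"
  by (auto simp: detector_def intro!: mult_nonneg_nonneg sum_nonneg divide_nonneg_nonneg)

text \<open>A vector q with entries of modulus at most Q is a difference of two points of the box of
  side 2 Q in at least Q^n ways, namely by common shifts of its positive and negative parts. Each of
  these pairs contributes at least N^(2 m) / 4, which explains both the side 2 Q and the
  normalization of the detector.\<close>

lemma detector_ge_1:
  fixes \<alpha> :: "real ^ 'n::finite ^ 'm::finite"
  assumes "N > 0" "Q > 0" and q: "\<And>j. \<bar>q j\<bar> \<le> int Q"
    and y: "\<And>i. \<bar>(y + \<alpha> *v int_vec q + int_vec p) $ i\<bar> \<le> \<delta>" and N: "real CARD('m) * real N * \<delta> \<le> 1 / 8"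
  shows "1 \<le> detector N Q \<alpha> y"
proof -
  define F where "F r r' = (cmod (exp_sum N (y + \<alpha> *v int_vec (\<lambda>i. r i - r' i :: int))))\<^sup>2" for r r'
  define \<phi> where "\<phi> s = ((\<lambda>j. s j + max 0 (q j)), (\<lambda>j. s j + max 0 (- q j)))" for s :: "'n \<Rightarrow> int"
  have F: "real N ^ (2 * CARD('m)) / 4 \<le> case_prod F (\<phi> s)" for s
  proof -
    have "(\<lambda>j. (s j + max 0 (q j)) - (s j + max 0 (- q j))) = q" by (auto simp: max_def)
    then have e: "case_prod F (\<phi> s) = (cmod (exp_sum N (y + \<alpha> *v int_vec q)))\<^sup>2"
      by (simp add: F_def \<phi>_def)
    have "(real N ^ CARD('m) / 2)\<^sup>2 \<le> (cmod (exp_sum N (y + \<alpha> *v int_vec q)))\<^sup>2"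
      by (intro power_mono exp_sum_lower_bound[of _ p \<delta>] y N) auto
    then show ?thesis by (simp add: e power_divide power_mult[symmetric] mult.commute)
  qed
  have inj: "inj_on \<phi> (int_box Q)"
    by (rule inj_onI) (auto simp: \<phi>_def fun_eq_iff)
  have sub: "\<phi> ` int_box Q \<subseteq> int_box (2 * Q) \<times> int_box (2 * Q)"
  proof -
    have "\<phi> s \<in> int_box (2 * Q) \<times> int_box (2 * Q)" if "s \<in> int_box Q" for s
    proof -
      have "0 \<le> s j + max 0 (q j) \<and> s j + max 0 (q j) < int (2 * Q) \<and>
          0 \<le> s j + max 0 (- q j) \<and> s j + max 0 (- q j) < int (2 * Q)" for j
        using that[unfolded mem_int_box, rule_format, of j] q[of j] by (auto simp: max_def)
      then show ?thesis by (auto simp: \<phi>_def mem_int_box)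
    qed
    then show ?thesis by blast
  qed
  have "real Q ^ CARD('n) * (real N ^ (2 * CARD('m)) / 4) = (\<Sum>s\<in>(int_box Q :: ('n \<Rightarrow> int) set). real N ^ (2 * CARD('m)) / 4)"
    by (simp add: card_int_box)
  also have "\<dots> \<le> (\<Sum>s\<in>int_box Q. case_prod F (\<phi> s))"
    by (intro sum_mono F)
  also have "\<dots> = (\<Sum>x\<in>\<phi> ` int_box Q. case_prod F x)"
    using inj by (simp add: sum.reindex)
  also have "\<dots> \<le> (\<Sum>x\<in>int_box (2 * Q) \<times> int_box (2 * Q). case_prod F x)"
    by (rule sum_mono2) (use sub in \<open>auto simp: F_def\<close>)
  also have "\<dots> = (\<Sum>r\<in>int_box (2 * Q). \<Sum>r'\<in>int_box (2 * Q). F r r')"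
    by (simp add: sum.cartesian_product)
  finally show ?thesis using assms(1,2) by (simp add: detector_def F_def field_simps)
qed

text \<open>Duality: since h . (\<alpha> r) = r . (\<alpha>^T h), exchanging the sums turns the sum
  over r and r' into a kernel evaluated at \<alpha>^T (h - h'), while the dependence on y is
  confined to one exponential per pair.\<close>

lemma detector_eq:
  fixes \<alpha> :: "real ^ 'n::finite ^ 'm::finite"
  shows "of_real (detector N Q \<alpha> y) = of_real (4 / (real N ^ (2 * CARD('m)) * real Q ^ CARD('n))) *
    (\<Sum>h\<in>int_box N. \<Sum>h'\<in>int_box N. 
        cis (2 * pi * (int_vec (\<lambda>i. h i - h' i) \<bullet> y)) *
        of_real ((cmod (exp_sum (2 * Q) (transpose \<alpha> *v int_vec (\<lambda>i. h i - h' i))))\<^sup>2))"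
proof -
  have tr: "int_vec a \<bullet> (y + \<alpha> *v int_vec b) = int_vec a \<bullet> y + int_vec b \<bullet> (transpose \<alpha> *v int_vec a)" for a b
    by (simp add: inner_add_right dot_lmul_matrix[symmetric] inner_commute transpose_matrix_vector)
  define E where "E h h' = cis (2 * pi * (int_vec (\<lambda>i. h i - h' i) \<bullet> y))" for h h' :: "'m \<Rightarrow> int"
  define G where "G r r' h h' = cis (2 * pi * (int_vec (\<lambda>i. r i - r' i) \<bullet> (transpose \<alpha> *v int_vec (\<lambda>i. h i - h' i))))"
    for r r' :: "'n \<Rightarrow> int" and h h' :: "'m \<Rightarrow> int"
  let ?R = "int_box (2 * Q) :: ('n \<Rightarrow> int) set" and ?H = "int_box N :: ('m \<Rightarrow> int) set"
  have "(\<Sum>r\<in>?R. \<Sum>r'\<in>?R. complex_of_real ((cmod (exp_sum N (y + \<alpha> *v int_vec (\<lambda>i. r i - r' i))))\<^sup>2)) =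
      (\<Sum>r\<in>?R. \<Sum>r'\<in>?R. \<Sum>h\<in>?H. \<Sum>h'\<in>?H. E h h' * G r r' h h')"
    unfolding norm_exp_sum_sq tr distrib_left cis_mult E_def G_def ..
  also have "\<dots> = (\<Sum>r\<in>?R. \<Sum>h\<in>?H. \<Sum>r'\<in>?R. \<Sum>h'\<in>?H. E h h' * G r r' h h')"
    by (intro sum.cong refl sum.swap)
  also have "\<dots> = (\<Sum>h\<in>?H. \<Sum>r\<in>?R. \<Sum>h'\<in>?H. \<Sum>r'\<in>?R. E h h' * G r r' h h')"
    by (subst sum.swap) (intro sum.cong refl sum.swap)
  also have "\<dots> = (\<Sum>h\<in>?H. \<Sum>h'\<in>?H. \<Sum>r\<in>?R. \<Sum>r'\<in>?R. E h h' * G r r' h h')"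
    by (intro sum.cong refl sum.swap)
  also have "\<dots> = (\<Sum>h\<in>?H. \<Sum>h'\<in>?H. E h h' * (\<Sum>r\<in>?R. \<Sum>r'\<in>?R. G r r' h h'))"
    by (simp only: sum_distrib_left)
  finally show ?thesis
    unfolding detector_def E_def G_def norm_exp_sum_sq[symmetric] of_real_mult of_real_sum by simp
qed

lemma set_integrable_sum:
  fixes f :: "'i \<Rightarrow> 'a \<Rightarrow> 'b::{banach, second_countable_topology}"
  assumes "\<And>i. i \<in> I \<Longrightarrow> set_integrable M S (f i)"
  shows "set_integrable M S (\<lambda>x. \<Sum>i\<in>I. f i x)"
  unfolding set_integrable_def scaleR_sum_right
  by (intro Bochner_Integration.integrable_sum assms[unfolded set_integrable_def])

lemma set_lebesgue_integral_sum:
  fixes f :: "'i \<Rightarrow> 'a \<Rightarrow> 'b::{banach, second_countable_topology}"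
  assumes "\<And>i. i \<in> I \<Longrightarrow> set_integrable M S (f i)"
  shows "(LINT x:S|M. (\<Sum>i\<in>I. f i x)) = (\<Sum>i\<in>I. LINT x:S|M. f i x)"
  unfolding set_lebesgue_integral_def scaleR_sum_right
  by (intro Bochner_Integration.integral_sum assms[unfolded set_integrable_def])

text \<open>Integrating term by term leaves a decay weight times \<open>W\<close> for each pair (h,
  h'). For fixed h' the differences h - h' are distinct frequencies with entries below N in modulus,
  so T bounds the inner sum. The N^m choices of h' cancel half of the normalization N^(2 m).\<close>

lemma detector_integral_le:
  fixes \<alpha> :: "real ^ 'n::finite ^ 'm::finite" and f :: "real ^ 'd::finite \<Rightarrow> real ^ 'm" and Q :: nat
  defines "W \<equiv> \<lambda>v. (cmod (exp_sum (2 * Q) (transpose \<alpha> *v int_vec v)))\<^sup>2"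
  assumes S: "S \<in> sets borel" "emeasure lborel S < \<infinity>" and f: "continuous_on S f"
    and decay: "\<And>v. cmod (LINT x:S|lborel. cis (2 * pi * (int_vec v \<bullet> f x))) \<le> C * decay_weight \<sigma> v"
    and T: "\<And>X. finite X \<Longrightarrow> (\<And>v i. v \<in> X \<Longrightarrow> \<bar>v i\<bar> < int N) \<Longrightarrow> (\<Sum>v\<in>X. decay_weight \<sigma> v * W v) \<le> T"
    and "N > 0" "C \<ge> 0"
  shows "set_integrable lborel S (\<lambda>x. detector N Q \<alpha> (f x))"
    and "(LINT x:S|lborel. detector N Q \<alpha> (f x)) \<le> 4 * C * T / (real N ^ CARD('m) * real Q ^ CARD('n))"
proof -
  define a where "a = 4 / (real N ^ (2 * CARD('m)) * real Q ^ CARD('n))"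
  have a0: "a \<ge> 0" by (simp add: a_def)
  have W0 [simp]: "W v \<ge> 0" for v by (simp add: W_def)
  define E where "E v = (\<lambda>x. cis (2 * pi * (int_vec v \<bullet> f x)))" for v
  have intE: "set_integrable lborel S (E v)" for v
    unfolding set_integrable_def
  proof (rule integrableI_bounded_set[where A = S and B = 1])
    have "continuous_on S (E v)" unfolding E_def cis_conv_exp by (intro continuous_intros f)
    from borel_measurable_continuous_on_indicator[OF S(1) this]
    show "(\<lambda>x. indicat_real S x *\<^sub>R E v x) \<in> borel_measurable lborel" by simp
  qed (use S in \<open>auto simp: E_def indicator_def\<close>)
  define G where "G x = of_real a * (\<Sum>h\<in>int_box N. \<Sum>h'\<in>int_box N. 
        E (\<lambda>i. h i - h' i) x * of_real (W (\<lambda>i. h i - h' i)))" for x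
  have D: "detector N Q \<alpha> (f x) = Re (G x)" for x
    using arg_cong[OF detector_eq[of N Q \<alpha> "f x"], of Re] unfolding Re_complex_of_real a_def E_def W_def G_def .
  have intsum: "set_integrable lborel S G"
    unfolding G_def by (intro set_integrable_mult_right set_integrable_sum set_integrable_mult_left intE impI)
  have "set_integrable lborel S (\<lambda>x. Re (G x))"
    using integrable_Re[OF intsum[unfolded set_integrable_def]] by (simp add: set_integrable_def)
  then show "set_integrable lborel S (\<lambda>x. detector N Q \<alpha> (f x))" by (simp only: D)
  have "(LINT x:S|lborel. detector N Q \<alpha> (f x)) = Re (LINT x:S|lborel. G x)"
    using integral_Re[OF intsum[unfolded set_integrable_def]] by (simp add: D set_lebesgue_integral_def)
  also have "\<dots> = Re (of_real a * (\<Sum>h\<in>int_box N. \<Sum>h'\<in>int_box N. 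
        (LINT x:S|lborel. E (\<lambda>i. h i - h' i) x) * of_real (W (\<lambda>i. h i - h' i))))"
    by (simp add: G_def set_lebesgue_integral_sum set_integrable_sum set_integrable_mult_left intE)
  also have "\<dots> \<le> cmod (of_real a * (\<Sum>h\<in>int_box N. \<Sum>h'\<in>int_box N. 
        (LINT x:S|lborel. E (\<lambda>i. h i - h' i) x) * of_real (W (\<lambda>i. h i - h' i))))"
    by (rule complex_Re_le_cmod)
  also have "\<dots> \<le> a * (\<Sum>h\<in>int_box N. \<Sum>h'\<in>int_box N. C * decay_weight \<sigma> (\<lambda>i. h i - h' i) * W (\<lambda>i. h i - h' i))"
    unfolding norm_mult norm_of_real abs_of_nonneg[OF a0]
    by (intro mult_left_mono order_trans[OF norm_sum] sum_mono a0)
      (auto simp: norm_mult W0 E_def[abs_def] intro!: mult_right_mono decay)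
  also have "\<dots> = a * (\<Sum>h'\<in>int_box N. \<Sum>h\<in>int_box N. C * (decay_weight \<sigma> (\<lambda>i. h i - h' i) * W (\<lambda>i. h i - h' i)))"
    by (subst sum.swap) (simp only: mult.assoc)
  also have "\<dots> \<le> a * (\<Sum>h'\<in>(int_box N :: ('m \<Rightarrow> int) set). C * T)"
    unfolding sum_distrib_left[symmetric]
  proof (intro mult_left_mono sum_mono a0 \<open>C \<ge> 0\<close>)
    fix h' :: "'m \<Rightarrow> int" assume h': "h' \<in> int_box N"
    let ?X = "(\<lambda>h i. h i - h' i) ` int_box N"
    have "(\<Sum>h\<in>int_box N. decay_weight \<sigma> (\<lambda>i. h i - h' i) * W (\<lambda>i. h i - h' i)) =
        (\<Sum>v\<in>?X. decay_weight \<sigma> v * W v)"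
      by (subst sum.reindex) (auto simp: inj_on_def fun_eq_iff)
    also have "\<dots> \<le> T"
    proof (rule T)
      fix v i assume "v \<in> ?X"
      then obtain h where "h \<in> int_box N" "v = (\<lambda>i. h i - h' i)" by blast
      then show "\<bar>v i\<bar> < int N"
        using h'[unfolded mem_int_box, rule_format, of i] by (auto simp: mem_int_box dest: spec[of _ i])
    qed simp
    finally show "(\<Sum>h\<in>int_box N. decay_weight \<sigma> (\<lambda>i. h i - h' i) * W (\<lambda>i. h i - h' i)) \<le> T" .
  qed
  also have "\<dots> = 4 * C * T / (real N ^ CARD('m) * real Q ^ CARD('n))"
    using \<open>N > 0\<close> by (simp add: a_def card_int_box mult_2 power_add)
  finally show "(LINT x:S|lborel. detector N Q \<alpha> (f x)) \<le> 4 * C * T / (real N ^ CARD('m) * real Q ^ CARD('n))" .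
qed

section \<open>Dyadic reduction and the Borel-Cantelli argument\<close>

text \<open>Cauchy condensation. In the block from 2^k to 2^(k+1) the power of q is smallest at the
  left end and \<psi> at the right end, so the block sum controls the next dyadic term with a loss
  of 2^n.\<close>

lemma dyadic_summable:
  fixes \<psi> :: "real \<Rightarrow> real"
  assumes anti: "\<And>x y. 0 < x \<Longrightarrow> x \<le> y \<Longrightarrow> \<psi> y \<le> \<psi> x" and pos: "\<And>x. 0 < x \<Longrightarrow> \<psi> x > 0" and "n \<ge> 1"
    and sum: "summable (\<lambda>q. real (Suc q) ^ (n - 1) * \<psi> (real (Suc q)) ^ m)"
  shows "summable (\<lambda>k. 2 ^ (k * n) * \<psi> (2 ^ k) ^ m)"
proof -
  define G where "G q = real q ^ (n - 1) * \<psi> (real q) ^ m" for q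
  define a where "a k = 2 ^ (k * n) * \<psi> (2 ^ k) ^ m" for k :: nat
  have block: "a (Suc k) \<le> 2 ^ n * (\<Sum>q\<in>{2^k..<2^Suc k}. G q)" for k
  proof -
    have "(\<Sum>q\<in>{2^k..<(2::nat)^Suc k}. (2^k) ^ (n - 1) * \<psi> (2 ^ Suc k) ^ m) \<le> (\<Sum>q\<in>{2^k..<2^Suc k}. G q)"
      unfolding G_def
    proof (intro sum_mono mult_mono power_mono)
      fix q :: nat assume q: "q \<in> {2^k..<2^Suc k}"
      then have "real (2 ^ k) \<le> real q" "real q \<le> real (2 ^ Suc k)"
        unfolding of_nat_le_iff by auto
      then have q': "2 ^ k \<le> real q" "real q \<le> 2 ^ Suc k" by simp_all
      moreover have "(0::real) < 2 ^ k" by simp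
      ultimately have qp: "0 < real q" by linarith
      show "2 ^ k \<le> real q" by (rule q')
      show "\<psi> (2 ^ Suc k) \<le> \<psi> (real q)" by (rule anti[OF qp q'(2)])
    qed (use pos in \<open>auto intro: less_imp_le\<close>)
    moreover have "(\<Sum>q\<in>{2^k..<(2::nat)^Suc k}. ((2::real)^k) ^ (n - 1) * \<psi> (2 ^ Suc k) ^ m) =
        (2^k) ^ n * \<psi> (2 ^ Suc k) ^ m"
      using \<open>n \<ge> 1\<close> by (cases n) (auto simp: algebra_simps)
    ultimately have "(2^k) ^ n * \<psi> (2 ^ Suc k) ^ m \<le> (\<Sum>q\<in>{2^k..<2^Suc k}. G q)"
      by linarith
    moreover have "a (Suc k) = 2 ^ n * ((2^k) ^ n * \<psi> (2 ^ Suc k) ^ m)"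
      by (simp add: a_def power_add power_mult)
    ultimately show ?thesis by (simp only: mult_left_mono zero_le_power zero_le_numeral)
  qed
  have "(\<Sum>k<K. a (Suc k)) \<le> 2 ^ n * (\<Sum>q\<in>{1..<2^K}. G q)" for K
  proof (induction K)
    case (Suc K)
    have "(\<Sum>q\<in>{1..<2^Suc K}. G q) = (\<Sum>q\<in>{1..<2^K}. G q) + (\<Sum>q\<in>{2^K..<2^Suc K}. G q)"
      by (rule sum.atLeastLessThan_concat[symmetric]) auto
    then show ?case using Suc block[of K] by (simp add: distrib_left)
  qed simp
  moreover have "(\<Sum>q\<in>{1..<2^K}. G q) \<le> (\<Sum>q. G (Suc q))" for K :: nat
  proof -
    have "(\<Sum>q\<in>{1..<2^K}. G q) = (\<Sum>q\<in>{..<2^K - 1}. G (Suc q))"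
      by (rule sum.reindex_bij_witness[of _ Suc "\<lambda>q. q - 1"]) auto
    also have "\<dots> \<le> (\<Sum>q. G (Suc q))"
    proof (rule sum_le_suminf)
      show "summable (\<lambda>q. G (Suc q))" using sum by (simp add: G_def)
      show "0 \<le> G (Suc q)" for q using pos[of "real (Suc q)"] by (auto simp: G_def intro!: mult_nonneg_nonneg)
    qed auto
    finally show ?thesis .
  qed
  ultimately have "(\<Sum>k<K. a (Suc k)) \<le> 2 ^ n * (\<Sum>q. G (Suc q))" for K
    by (meson mult_left_mono order_trans zero_le_numeral zero_le_power)
  moreover have "a (Suc k) \<ge> 0" for k using pos[of "2 ^ Suc k"] by (simp add: a_def)
  ultimately have "summable (\<lambda>k. a (Suc k))" by (intro summableI_nonneg_bounded)
  then have "summable a" by (simp only: summable_Suc_iff)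
  then show ?thesis by (simp add: a_def[abs_def])
qed

lemma finite_bounded_int_points: "finite {v \<in> int_points. norm (v :: real ^ 'a::finite) \<le> R}"
proof -
  have "{v \<in> int_points. norm v \<le> R} \<subseteq> int_vec ` PiE (UNIV::'a set) (\<lambda>_. {- \<lceil>R\<rceil>..\<lceil>R\<rceil>})"
  proof
    fix v :: "real ^ 'a" assume "v \<in> {v \<in> int_points. norm v \<le> R}"
    then obtain z where z: "v = int_vec z" "norm v \<le> R" by (auto simp: int_points_eq_range)
    have "z i \<in> {- \<lceil>R\<rceil>..\<lceil>R\<rceil>}" for i
    proof -
      have "\<bar>real_of_int (z i)\<bar> \<le> R" using component_le_norm_cart[of v i] z by simp
      then show ?thesis by simp linarith
    qed
    then show "v \<in> int_vec ` PiE UNIV (\<lambda>_. {- \<lceil>R\<rceil>..\<lceil>R\<rceil>})" using z by auto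
  qed
  then show ?thesis by (rule finite_subset) (auto intro!: finite_PiE)
qed

lemma norm_int_points_ge_1:
  assumes "q \<in> int_points" "q \<noteq> 0" shows "1 \<le> norm q"
proof -
  obtain i where "q $ i \<noteq> 0" using assms(2) by (auto simp: vec_eq_iff)
  moreover have "q $ i \<in> \<int>" using assms(1) by (simp add: int_points_def)
  ultimately have "1 \<le> \<bar>q $ i\<bar>" by (metis Ints_nonzero_abs_ge1)
  then show ?thesis using component_le_norm_cart[of q i] by linarith
qed

text \<open>Infinitely many solutions force q to be unbounded: for bounded q, p is bounded too,
  because \<psi> (norm q) \<le> \<psi> 1. Then k is the integer part of the binary logarithm of norm
  q, and monotonicity replaces \<psi> (norm q) by \<psi> (2^k).\<close>

lemma inhomogeneously_approximable_dyadic: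
  fixes \<alpha> :: "real ^ 'n::finite ^ 'm::finite"
  assumes anti: "\<And>x y. 0 < x \<Longrightarrow> x \<le> y \<Longrightarrow> \<psi> y \<le> \<psi> x"
    and "y \<in> inhomogeneously_approximable \<psi> \<alpha>"
  obtains k u v where "k \<ge> K" "norm (int_vec u) \<le> 2 ^ Suc k"
    "norm (\<alpha> *v int_vec u + y + int_vec v) \<le> \<psi> (2 ^ k)"
proof -
  define Z where "Z = {(p, q). p \<in> int_points \<and> q \<in> int_points - {0} \<and> norm (\<alpha> *v q + y + p) \<le> \<psi> (norm q)}"
  have "infinite Z" using assms(2) by (simp add: inhomogeneously_approximable_def Z_def)
  have "\<exists>p q. (p, q) \<in> Z \<and> 2 ^ K \<le> norm q"
  proof (rule ccontr)
    assume "\<not> ?thesis"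
    then have small: "norm q \<le> 2 ^ K" if "(p, q) \<in> Z" for p q using that by force
    obtain B where B: "\<And>x. norm (\<alpha> *v x) \<le> B * norm x"
      using linear_bounded[OF matrix_vector_mul_linear[of \<alpha>]] by auto
    have "Z \<subseteq> {p \<in> int_points. norm p \<le> \<psi> 1 + \<bar>B\<bar> * 2 ^ K + norm y} \<times> {q \<in> int_points. norm q \<le> 2 ^ K}"
    proof clarify
      fix p q assume pq: "(p, q) \<in> Z"
      then have q: "p \<in> int_points" "q \<in> int_points" "q \<noteq> 0" "norm (\<alpha> *v q + y + p) \<le> \<psi> (norm q)"
        by (auto simp: Z_def)
      have "\<psi> (norm q) \<le> \<psi> 1" using norm_int_points_ge_1[OF q(2,3)] by (intro anti) auto
      moreover have "norm (\<alpha> *v q) \<le> \<bar>B\<bar> * 2 ^ K"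
        by (rule order_trans[OF B]) (intro mult_mono small[OF pq]; simp)
      moreover have "norm p \<le> norm (\<alpha> *v q + y + p) + norm (\<alpha> *v q) + norm y"
      proof -
        have "p = (\<alpha> *v q + y + p) - \<alpha> *v q - y" by simp
        then have "norm p = norm ((\<alpha> *v q + y + p) - \<alpha> *v q - y)" by simp
        also have "\<dots> \<le> norm ((\<alpha> *v q + y + p) - \<alpha> *v q) + norm y" by (rule norm_triangle_ineq4)
        also have "norm ((\<alpha> *v q + y + p) - \<alpha> *v q) \<le> norm (\<alpha> *v q + y + p) + norm (\<alpha> *v q)"
          by (rule norm_triangle_ineq4)
        finally show ?thesis by simp
      qed
      ultimately show "p \<in> {p \<in> int_points. norm p \<le> \<psi> 1 + \<bar>B\<bar> * 2 ^ K + norm y} \<and> q \<in> {q \<in> int_points. norm q \<le> 2 ^ K}"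
        using q small[OF pq] by auto
    qed
    then have "finite Z"
      by (rule finite_subset) (intro finite_cartesian_product finite_bounded_int_points)
    with \<open>infinite Z\<close> show False ..
  qed
  then obtain p q where pq: "(p, q) \<in> Z" "2 ^ K \<le> norm q" by blast
  then obtain u v where uv: "q = int_vec u" "p = int_vec v"
    by (auto simp: Z_def int_points_eq_range)
  define k where "k = nat \<lfloor>log 2 (norm q)\<rfloor>"
  have q1: "1 \<le> norm q" using pq norm_int_points_ge_1[of q] by (auto simp: Z_def)
  then have q0: "q \<noteq> 0" by auto
  have l0: "0 \<le> log 2 (norm q)" using zero_le_log_cancel_iff[of 2 "norm q"] q1 by linarith
  have "real k \<le> log 2 (norm q)" "log 2 (norm q) \<le> real (Suc k)" using l0 unfolding k_def by linarith+
  then have k: "2 ^ k \<le> norm q" "norm q \<le> 2 ^ Suc k"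
    using q0 by (simp_all add: le_log_iff log_le_iff powr_realpow[symmetric] del: of_nat_Suc power_Suc)
  have "real K \<le> log 2 (norm q)"
    using pq(2) q0 by (simp add: le_log_iff powr_realpow)
  then have "K \<le> k" unfolding k_def by linarith
  moreover have "\<psi> (norm q) \<le> \<psi> (2 ^ k)" by (intro anti k) simp
  then have "norm (\<alpha> *v int_vec u + y + int_vec v) \<le> \<psi> (2 ^ k)"
    using pq(1) by (auto simp: Z_def uv)
  ultimately show thesis using that[of k u v] k uv by simp
qed

lemma continuous_on_detector:
  assumes "continuous_on S f" shows "continuous_on S (\<lambda>x. detector N Q \<alpha> (f x))"
  unfolding detector_def exp_sum_def cis_conv_exp by (intro continuous_intros assms)

text \<open>Markov's inequality for the detector bounds the measure of the bad set at scale k. The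
  kernel sum is O(Q^(2 n)), the normalization removes Q^n, and N^(-m) is O(\<delta>^m), which leaves
  the summable quantity Q^n \<delta>^m.\<close>

proposition inhomogeneously_approximable_negligible_of_fourier_decay:
  fixes \<alpha> :: "real ^ 'n::finite ^ 'm::finite" and \<psi> :: "real \<Rightarrow> real"
    and f :: "real ^ 'd::finite \<Rightarrow> real ^ 'm"
  defines "m \<equiv> CARD('m)" and "n \<equiv> CARD('n)"
  assumes "m \<ge> 2"
    and irr: "irrationality_exponent (transpose \<alpha>) <
           ereal (inverse (real n / real m - real n / (2 * (real m)\<^sup>2 * (real m - 1))))"
    and \<psi>: "approximation_function \<psi>"
    and sum: "summable (\<lambda>q. real (Suc q) ^ (n - 1) * \<psi> (real (Suc q)) ^ m)"
    and S: "S \<in> sets borel" "emeasure lborel S < \<infinity>" and f: "continuous_on S f"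
    and decay: "\<And>v. cmod (LINT x:S|lborel. cis (2 * pi * (int_vec v \<bullet> f x))) \<le> C * decay_weight (1 / (real m)\<^sup>2) v"
    and "C \<ge> 0"
  shows "negligible {x \<in> S. f x \<in> inhomogeneously_approximable \<psi> \<alpha>}"
proof -
  define Y where "Y = real n / real m - real n / (2 * (real m)\<^sup>2 * (real m - 1))"
  define \<sigma> where "\<sigma> = 1 / (real m)\<^sup>2"
  have n1: "n \<ge> 1" by (simp add: n_def)
  have m2: "real m \<ge> 2" using \<open>m \<ge> 2\<close> by simp
  have m4: "(real m)\<^sup>2 \<ge> 4" using power_mono[OF m2, of 2] by simp
  then have \<sigma>: "0 < \<sigma>" "\<sigma> \<le> 1/4"
    using m2 divide_left_mono[of 4 "(real m)\<^sup>2" 1] by (simp_all add: \<sigma>_def)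
  have YY: "real n / real m * (1 - \<sigma>) \<le> Y"
  proof -
    have "(real m)\<^sup>2 * real m \<le> 2 * (real m)\<^sup>2 * (real m - 1)"
      using mult_left_mono[of "real m" "2 * (real m - 1)" "(real m)\<^sup>2"] m2 by (simp add: mult_ac)
    then have "real n / (2 * (real m)\<^sup>2 * (real m - 1)) \<le> real n / ((real m)\<^sup>2 * real m)"
      using m2 by (intro divide_left_mono) auto
    moreover have "real n / real m * (1 - \<sigma>) = real n / real m - real n / ((real m)\<^sup>2 * real m)"
      using m2 by (simp add: \<sigma>_def right_diff_distrib mult.commute)
    ultimately show ?thesis by (simp add: Y_def)
  qed
  have "real n / real m * (1 - \<sigma>) > 0" using n1 m2 \<sigma> by (intro mult_pos_pos) auto
  then have Y0: "Y > 0" using YY by linarith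
  obtain \<tau> c where \<tau>: "0 < \<tau>" "\<tau> < inverse Y" and "c > 0" and
    dioph: "\<And>u p. u \<noteq> (\<lambda>_. 0) \<Longrightarrow> c * norm (int_vec u) powr - \<tau> \<le> norm (transpose \<alpha> *v int_vec u + int_vec p)"
    using irrationality_exponent_lessE[OF irr[folded Y_def]] Y0 by (metis inverse_positive_iff_positive)
  \<comment> \<open>With this s, N \<le> 2^(s k) implies N^(1-\<sigma>) \<le> 2^(k/\<tau>), which is
    the order of magnitude of \<open>L k\<close>.\<close>
  define s where "s = 1 / (\<tau> * (1 - \<sigma>))"
  have s\<sigma>: "s * (1 - \<sigma>) = 1 / \<tau>" using \<sigma> by (simp add: s_def)
  have s0: "s > 0" using \<tau> \<sigma> by (simp add: s_def)
  have nsm: "real n < s * real m"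
  proof -
    have "\<tau> * (real n / real m * (1 - \<sigma>)) \<le> \<tau> * Y"
      using YY \<tau> by (intro mult_left_mono) auto
    also have "\<tau> * Y < 1" using \<tau> Y0 by (simp add: field_simps)
    finally have "\<tau> * (real n / real m * (1 - \<sigma>)) < 1" .
    then show ?thesis using m2 \<tau> \<sigma> by (simp add: s_def field_simps)
  qed
  have anti: "\<psi> y \<le> \<psi> x" if "0 < x" "x \<le> y" for x y
    using \<psi> that by (auto simp: approximation_function_def monotone_on_def)
  have \<psi>pos: "\<psi> x > 0" if "x > 0" for x using \<psi> that by (simp add: approximation_function_def)
  have sum2: "summable (\<lambda>k. 2 ^ (k * n) * \<psi> (2 ^ k) ^ m)"
    by (rule dyadic_summable[OF anti \<psi>pos n1 sum])
  \<comment> \<open>The second entry enforces N \<le> 2^(s k) even where \<psi> decays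
    faster.\<close>
  define \<delta> where "\<delta> k = max (\<psi> (2 ^ k)) (2 powr (- s * real k))" for k :: nat
  define Q where "Q k = (2::nat) ^ Suc k" for k :: nat
  \<comment> \<open>The divisor 8 m gives m N \<delta> \<le> 1/8, as the lower bound for the
    exponential sum requires.\<close>
  define N where "N k = nat \<lfloor>1 / (8 * real m * \<delta> k)\<rfloor>" for k
  define L where "L k = (c * real (Q k) / real n) powr (1 / \<tau>) / real m" for k
  define \<kappa> where "\<kappa> = (c / real n) powr (1 / \<tau>) / real m"
  have \<kappa>0: "\<kappa> > 0" using \<open>c > 0\<close> n1 m2 by (simp add: \<kappa>_def)
  have L: "L k = \<kappa> * 2 powr (real (Suc k) / \<tau>)" for k
  proof -
    have "c * real (Q k) / real n = (c / real n) * 2 powr real (Suc k)"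
      by (simp add: Q_def powr_realpow[symmetric] del: of_nat_Suc power_Suc)
    then have "(c * real (Q k) / real n) powr (1 / \<tau>) = (c / real n) powr (1 / \<tau>) * 2 powr (real (Suc k) / \<tau>)"
      by (simp only: powr_mult powr_powr times_divide_eq_right mult_1_right)
    then show ?thesis by (simp add: L_def \<kappa>_def)
  qed
  have \<delta>0: "\<delta> k > 0" for k by (simp add: \<delta>_def less_max_iff_disj)
  have ev1: "eventually (\<lambda>k. \<delta> k \<le> 1 / (8 * real m)) sequentially"
  proof -
    define e where "e = 1 / (8 * real m)"
    have e0: "e > 0" using m2 by (simp add: e_def)
    have "(\<lambda>k. 2 ^ (k * n) * \<psi> (2 ^ k) ^ m) \<longlonglongrightarrow> 0" using sum2 by (rule summable_LIMSEQ_zero)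
    then have "eventually (\<lambda>k. 2 ^ (k * n) * \<psi> (2 ^ k) ^ m < e ^ m) sequentially"
      using e0 by (intro order_tendstoD) auto
    moreover have "(\<lambda>k. (2 powr (-s)) ^ k) \<longlonglongrightarrow> 0"
      using s0 powr_less_mono[of "-s" 0 2] by (intro LIMSEQ_realpow_zero) auto
    then have "eventually (\<lambda>k. (2 powr (-s)) ^ k < e) sequentially"
      using e0 by (intro order_tendstoD) auto
    ultimately show ?thesis
    proof eventually_elim
      case (elim k)
      have "\<psi> (2 ^ k) ^ m \<le> 2 ^ (k * n) * \<psi> (2 ^ k) ^ m"
        using mult_right_mono[of 1 "2 ^ (k * n)" "\<psi> (2 ^ k) ^ m"] \<psi>pos[of "2 ^ k"] by simp
      with elim have "\<psi> (2 ^ k) ^ m < e ^ m" by linarith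
      then have "\<psi> (2 ^ k) < e" by (rule power_less_imp_less_base) (use e0 in simp)
      moreover have "2 powr (- s * real k) = (2 powr (-s)) ^ k"
        by (simp add: powr_realpow[symmetric] powr_powr)
      ultimately show ?case using elim by (simp add: \<delta>_def e_def)
    qed
  qed
  have ev2: "eventually (\<lambda>k. L k \<ge> 1) sequentially"
  proof -
    have "(\<lambda>k. (2 powr (- (1/\<tau>))) ^ k) \<longlonglongrightarrow> 0"
      using \<tau> powr_less_mono[of "-(1/\<tau>)" 0 2] by (intro LIMSEQ_realpow_zero) auto
    then have "eventually (\<lambda>k. (2 powr (- (1/\<tau>))) ^ k < \<kappa>) sequentially"
      using \<kappa>0 by (intro order_tendstoD) auto
    then show ?thesis
    proof eventually_elim
      case (elim k)
      have "(2 powr (- (1/\<tau>))) ^ k = 2 powr (- (real k / \<tau>))"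
        by (simp add: powr_realpow[symmetric] powr_powr)
      then have "1 \<le> \<kappa> * 2 powr (real k / \<tau>)"
        using elim by (simp add: powr_minus field_simps)
      also have "\<dots> \<le> \<kappa> * 2 powr (real (Suc k) / \<tau>)"
        using \<kappa>0 \<tau> by (intro mult_left_mono powr_mono divide_right_mono) auto
      finally show ?case by (simp add: L)
    qed
  qed
  obtain k0 where k0: "\<And>k. k \<ge> k0 \<Longrightarrow> \<delta> k \<le> 1 / (8 * real m)" "\<And>k. k \<ge> k0 \<Longrightarrow> L k \<ge> 1"
    using eventually_conj[OF ev1 ev2] by (auto simp: eventually_sequentially)
  have N: "N k \<ge> 1" "real (N k) \<le> 1 / (8 * real m * \<delta> k)" "1 / real (N k) \<le> 16 * real m * \<delta> k" if "k \<ge> k0" for k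
  proof -
    define y where "y = 1 / (8 * real m * \<delta> k)"
    have "8 * real m * \<delta> k > 0" using m2 \<delta>0[of k] by simp
    moreover have "8 * real m * \<delta> k \<le> 1" using k0(1)[OF that] m2 by (simp add: field_simps)
    ultimately have y1: "y \<ge> 1" by (simp add: y_def)
    have Ny: "N k = nat \<lfloor>y\<rfloor>" by (simp add: N_def y_def)
    show 1: "N k \<ge> 1" using y1 unfolding Ny by linarith
    show "real (N k) \<le> 1 / (8 * real m * \<delta> k)" using y1 unfolding Ny y_def[symmetric] by linarith
    \<comment> \<open>Rounding down a number y >= 1 loses at most a factor 2, which turns 8 m into
      16 m.\<close>
    have "y \<le> real (N k) + 1" using y1 unfolding Ny by linarith
    then have "y \<le> 2 * real (N k)" using 1 by linarith
    then have "1 / real (N k) \<le> 2 / y" using 1 y1 by (simp add: field_simps)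
    then show "1 / real (N k) \<le> 16 * real m * \<delta> k" by (simp add: y_def)
  qed
  have NL: "real (N k) powr (1 - \<sigma>) \<le> (1 / \<kappa>) * L k" if "k \<ge> k0" for k
  proof -
    have "real (N k) \<le> 2 powr (s * real k)"
    proof -
      have "2 powr (- s * real k) \<le> \<delta> k" by (simp add: \<delta>_def)
      moreover have "1 * \<delta> k \<le> 8 * real m * \<delta> k" using m2 \<delta>0[of k] by (intro mult_right_mono) auto
      ultimately have "2 powr (- s * real k) \<le> 8 * real m * \<delta> k" by linarith
      then have "1 / (8 * real m * \<delta> k) \<le> 1 / (2 powr (- s * real k))"
        using \<delta>0[of k] m2 by (intro divide_left_mono mult_pos_pos) auto
      also have "\<dots> = 2 powr (s * real k)" by (simp add: powr_minus field_simps)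
      finally show ?thesis using N(2)[OF that] by linarith
    qed
    then have "real (N k) powr (1 - \<sigma>) \<le> (2 powr (s * real k)) powr (1 - \<sigma>)"
      using \<sigma> by (intro powr_mono2) auto
    also have "\<dots> = 2 powr (real k / \<tau>)"
    proof -
      have "s * real k * (1 - \<sigma>) = real k / \<tau>" using s\<sigma> by (metis mult.assoc mult.commute times_divide_eq_left mult_1)
      then show ?thesis by (simp add: powr_powr)
    qed
    also have "\<dots> \<le> 2 powr (real (Suc k) / \<tau>)" using \<tau> by (intro powr_mono divide_right_mono) auto
    also have "\<dots> = (1 / \<kappa>) * L k" using \<kappa>0 by (simp add: L)
    finally show ?thesis .
  qed
  define d where "d k x = detector (N k) (Q k) \<alpha> (f x)" for k x
  define T where "T k = (40 * (real (Q k))\<^sup>2) ^ n * (11 + 8 * (1 / \<kappa>)) ^ m" for k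
  have bound: "set_integrable lborel S (d k)"
      "(LINT x:S|lborel. d k x) \<le> 4 * C * T k / (real (N k) ^ m * real (Q k) ^ n)" if k: "k \<ge> k0" for k
  proof -
    have T: "(\<Sum>v\<in>X. decay_weight \<sigma> v * (cmod (exp_sum (2 * Q k) (transpose \<alpha> *v int_vec v)))\<^sup>2) \<le> T k"
      if "finite X" "\<And>v i. v \<in> X \<Longrightarrow> \<bar>v i\<bar> < int (N k)" for X
      unfolding T_def m_def n_def
    proof (rule sum_decay_weight_kernel[where c = c and \<tau> = \<tau> and N = "N k"])
      show "1 \<le> (c * real (Q k) / real CARD('n)) powr (1 / \<tau>) / real CARD('m)"
        using k0(2)[OF k] by (simp add: L_def m_def n_def)
      show "real (N k) powr (1 - \<sigma>) \<le> 1 / \<kappa> * ((c * real (Q k) / real CARD('n)) powr (1 / \<tau>) / real CARD('m))"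
        using NL[OF k] by (simp add: L_def m_def n_def)
    qed (use \<tau> \<sigma> \<open>c > 0\<close> dioph N(1)[OF k] \<kappa>0 that in \<open>auto simp: Q_def\<close>)
    have "N k > 0" using N(1)[OF k] by simp
    from detector_integral_le[where f = f and Q = "Q k" and \<alpha> = \<alpha> and N = "N k", OF S f decay[folded \<sigma>_def] T this \<open>C \<ge> 0\<close>]
    show "set_integrable lborel S (d k)"
      "(LINT x:S|lborel. d k x) \<le> 4 * C * T k / (real (N k) ^ m * real (Q k) ^ n)"
      unfolding d_def[abs_def] m_def n_def by blast+
  qed
  \<comment> \<open>The factor 80^n is 40^n from the kernel sum times 2^n from Q = 2^(k+1); the last
    factor comes from 1/N \<le> 16 m \<delta>.\<close>
  define C1 where "C1 = 4 * C * (11 + 8 * (1 / \<kappa>)) ^ m * 80 ^ n * (16 * real m) ^ m"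
  have C10: "C1 \<ge> 0" using \<open>C \<ge> 0\<close> \<kappa>0 by (simp add: C1_def)
  define Z where "Z k = C1 * (2 ^ (k * n) * \<psi> (2 ^ k) ^ m + (2 powr (real n - s * real m)) ^ k)" for k
  have IZ: "(LINT x:S|lborel. d k x) \<le> Z k" if k: "k \<ge> k0" for k
  proof -
    have Qn: "real (Q k) ^ n > 0" by (simp add: Q_def)
    have "4 * C * T k / (real (N k) ^ m * real (Q k) ^ n) =
        4 * C * (11 + 8 * (1 / \<kappa>)) ^ m * (40 ^ n * real (Q k) ^ n) * (1 / real (N k)) ^ m"
    proof -
      have "T k = (40 ^ n * real (Q k) ^ n) * real (Q k) ^ n * (11 + 8 * (1 / \<kappa>)) ^ m"
        by (simp add: T_def power_mult_distrib power2_eq_square)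
      then show ?thesis using Qn by (simp add: power_divide)
    qed
    also have "40 ^ n * real (Q k) ^ n = 80 ^ n * 2 ^ (k * n)"
      by (simp add: Q_def power_mult[symmetric] power_mult_distrib[symmetric] mult.assoc[symmetric])
    also have "4 * C * (11 + 8 * (1 / \<kappa>)) ^ m * (80 ^ n * 2 ^ (k * n)) * (1 / real (N k)) ^ m
        \<le> 4 * C * (11 + 8 * (1 / \<kappa>)) ^ m * (80 ^ n * 2 ^ (k * n)) * (16 * real m * \<delta> k) ^ m"
      using N(3)[OF k] \<open>C \<ge> 0\<close> \<kappa>0 by (intro mult_left_mono power_mono) auto
    also have "\<dots> = C1 * (2 ^ (k * n) * \<delta> k ^ m)"
      by (simp add: C1_def power_mult_distrib)
    also have "\<dots> \<le> C1 * (2 ^ (k * n) * (\<psi> (2 ^ k) ^ m + (2 powr (- s * real k)) ^ m))"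
      using \<psi>pos[of "2 ^ k"] C10 by (intro mult_left_mono) (auto simp: \<delta>_def max_def)
    also have "\<dots> = Z k"
    proof -
      have "(2::real) ^ (k * n) * (2 powr (- s * real k)) ^ m = (2 powr (real n - s * real m)) ^ k"
        by (simp add: powr_realpow[symmetric] powr_powr powr_add[symmetric] algebra_simps)
      then show ?thesis by (simp add: Z_def distrib_left)
    qed
    finally show ?thesis using bound(2)[OF k] by linarith
  qed
  have Zsum: "summable Z"
    unfolding Z_def using nsm powr_less_mono[of "real n - s * real m" 0 2]
    by (intro summable_mult summable_add sum2 summable_geometric) auto
  \<comment> \<open>The index starts at \<open>k0\<close>, so that the integral bounds hold for
    every member of the sequence.\<close>
  define A where "A k = {x \<in> S. 1 \<le> d (k + k0) x}" for k
  have dmeas: "(\<lambda>x. indicator S x *\<^sub>R d k x) \<in> borel_measurable borel" for k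
    using borel_measurable_continuous_on_indicator[OF S(1) continuous_on_detector[OF f]] by (simp add: d_def[abs_def])
  have A_eq: "A k = {x \<in> space borel. 1 \<le> indicator S x *\<^sub>R d (k + k0) x}" for k
    by (auto simp: A_def indicator_def)
  have A_sets: "A k \<in> sets lborel" for k
    unfolding A_eq using dmeas by measurable
  have A_le: "emeasure lborel (A k) \<le> emeasure lborel S" for k
    using S by (intro emeasure_mono) (auto simp: A_def)
  then have A_fin: "emeasure lborel (A k) < \<infinity>" for k using S(2) by (meson le_less_trans)
  have A_meas: "measure lborel (A k) \<le> Z (k + k0)" for k
  proof -
    have "measure lborel (A k) = (LINT x|lborel. indicator (A k) x)" by simp
    also have "\<dots> \<le> (LINT x:S|lborel. d (k + k0) x)"
      unfolding set_lebesgue_integral_def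
    proof (rule integral_mono)
      show "integrable lborel (indicat_real (A k))" using A_sets A_fin by simp
      show "integrable lborel (\<lambda>x. indicat_real S x *\<^sub>R d (k + k0) x)"
        using bound(1)[of "k + k0"] by (simp add: set_integrable_def)
    qed (auto simp: A_def indicator_def d_def)
    also have "\<dots> \<le> Z (k + k0)" by (rule IZ) simp
    finally show ?thesis .
  qed
  have "summable (\<lambda>k. measure lborel (A k))"
    by (rule summable_comparison_test'[where N = 0 and g = "\<lambda>k. Z (k + k0)"])
       (use Zsum A_meas in \<open>auto simp: summable_iff_shift\<close>)
  then have "limsup A \<in> null_sets lborel"
    by (intro borel_cantelli_limsup1 A_sets A_fin)
  moreover have "{x \<in> S. f x \<in> inhomogeneously_approximable \<psi> \<alpha>} \<subseteq> limsup A"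
  proof clarify
    fix x assume x: "x \<in> S" "f x \<in> inhomogeneously_approximable \<psi> \<alpha>"
    have "\<exists>j\<ge>i. x \<in> A j" for i
    proof -
      obtain k u v where k: "k \<ge> i + k0" and u: "norm (int_vec u) \<le> 2 ^ Suc k" and
        hit: "norm (\<alpha> *v int_vec u + f x + int_vec v) \<le> \<psi> (2 ^ k)"
        using inhomogeneously_approximable_dyadic[OF anti x(2)] by blast
      have kk: "k \<ge> k0" using k by simp
      have "1 \<le> d k x"
        unfolding d_def
      proof (rule detector_ge_1[where q = u and p = v and \<delta> = "\<delta> k"])
        show "N k > 0" using N(1)[OF kk] by simp
        show "Q k > 0" by (simp add: Q_def)
        show "\<bar>u j\<bar> \<le> int (Q k)" for j
        proof -
          have "\<bar>real_of_int (u j)\<bar> \<le> 2 ^ Suc k" using component_le_norm_cart[of "int_vec u" j] u by simp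
          then have "real_of_int \<bar>u j\<bar> \<le> real_of_int (int (Q k))" by (simp add: Q_def)
          then show ?thesis by (simp only: of_int_le_iff)
        qed
        show "\<bar>(f x + \<alpha> *v int_vec u + int_vec v) $ i\<bar> \<le> \<delta> k" for i
        proof -
          have "\<bar>(f x + \<alpha> *v int_vec u + int_vec v) $ i\<bar> \<le> norm (\<alpha> *v int_vec u + f x + int_vec v)"
            using component_le_norm_cart[of "\<alpha> *v int_vec u + f x + int_vec v" i] by (simp add: add.commute)
          then show ?thesis using hit by (simp add: \<delta>_def)
        qed
        show "real CARD('m) * real (N k) * \<delta> k \<le> 1 / 8"
          using N(2)[OF kk] \<delta>0[of k] m2 by (simp add: m_def field_simps)
      qed
      then have "x \<in> A (k - k0)" using kk x(1) by (simp add: A_def)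
      then show ?thesis using k by (intro exI[of _ "k - k0"]) auto
    qed
    then show "x \<in> limsup A" by (auto simp: limsup_INF_SUP)
  qed
  ultimately show ?thesis
    by (meson negligible_iff_null_sets negligible_subset null_sets_completionI)
qed

section \<open>Van der Corput's lemma\<close>

lemma cis_integrable:
  assumes "continuous_on {a..b::real} g" shows "(\<lambda>t. cis (g t)) integrable_on {a..b}"
  unfolding cis_conv_exp by (intro integrable_continuous_interval continuous_intros assms)

lemma norm_integral_cis_le:
  assumes "a \<le> b" shows "cmod (integral {a..b} (\<lambda>t. cis (g t))) \<le> b - a"
proof (cases "(\<lambda>t. cis (g t)) integrable_on {a..b}")
  case True
  have "cmod (integral {a..b} (\<lambda>t. cis (g t))) \<le> integral {a..b} (\<lambda>t. 1)"
    by (rule integral_norm_bound_integral) (use True in auto)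
  then show ?thesis using assms by simp
\<comment> \<open>Without integrability the integral has the default value 0.\<close>
qed (use assms in \<open>simp add: not_integrable_integral\<close>)

text \<open>Integrate by parts: \<open>cis g = (cis g / (\<i> g'))' + cis g \<cdot> g'' / (\<i> g'\<^sup>2)\<close>.\<close>

lemma norm_integral_cis_by_parts:
  fixes g g1 g2 :: "real \<Rightarrow> real"
  assumes "a \<le> b" "\<Lambda> > 0"
    and g: "\<And>t. t \<in> {a..b} \<Longrightarrow> (g has_real_derivative g1 t) (at t within {a..b})"
    and g1: "\<And>t. t \<in> {a..b} \<Longrightarrow> (g1 has_real_derivative g2 t) (at t within {a..b})"
    and g2: "continuous_on {a..b} g2"
    and low: "\<And>t. t \<in> {a..b} \<Longrightarrow> \<Lambda> \<le> \<bar>g1 t\<bar>"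
  shows "cmod (integral {a..b} (\<lambda>t. cis (g t))) \<le> 2 / \<Lambda> + integral {a..b} (\<lambda>t. \<bar>g2 t\<bar> / (g1 t)\<^sup>2)"
proof -
  have nz: "g1 t \<noteq> 0" if "t \<in> {a..b}" for t using low[OF that] \<open>\<Lambda> > 0\<close> by auto
  have cg: "continuous_on {a..b} g" "continuous_on {a..b} g1"
    by (rule DERIV_continuous_on[OF g], simp) (rule DERIV_continuous_on[OF g1], simp)
  define F where "F t = (1 / (\<i> * of_real (g1 t))) * cis (g t)" for t
  define R where "R t = cis (g t) * of_real (g2 t) / (\<i> * of_real ((g1 t)\<^sup>2))" for t
  have "((\<lambda>t. cis (g t) - R t) has_integral (F b - F a)) {a..b}"
  proof (rule fundamental_theorem_of_calculus[OF \<open>a \<le> b\<close>])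
    fix t assume t: "t \<in> {a..b}"
    have 1: "((\<lambda>t. cis (g t)) has_vector_derivative (of_real (g1 t) * (\<i> * cis (g t)))) (at t within {a..b})"
      unfolding cis_conv_exp
      by (rule has_vector_derivative_eq_rhs, rule field_vector_diff_chain_within[unfolded o_def, where g = exp],
          rule has_vector_derivative_mult_right[where a = \<i>, OF has_vector_derivative_of_real[OF g[OF t]]])
         (auto intro!: derivative_eq_intros simp: field_simps)
    have 2: "((\<lambda>t. 1 / (\<i> * complex_of_real (g1 t))) has_vector_derivative - (of_real (g2 t) / (\<i> * of_real ((g1 t)\<^sup>2)))) (at t within {a..b})"
    proof -
      have "((\<lambda>t. 1 / g1 t) has_real_derivative - (g2 t / (g1 t)\<^sup>2)) (at t within {a..b})"
        using nz[OF t] by (auto intro!: derivative_eq_intros g1[OF t] simp: power2_eq_square)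
      note has_vector_derivative_mult_right[where a = "1/\<i>", OF has_vector_derivative_of_real[OF this]]
      moreover have "1 / (\<i> * z) = 1 / \<i> * (1 / z)" "- (w / (\<i> * z)) = 1 / \<i> * - (w / z)" for w z :: complex
        by (cases "z = 0"; simp add: field_simps)+
      ultimately show ?thesis by simp
    qed
    from has_vector_derivative_mult[OF 2 1]
    show "(F has_vector_derivative (cis (g t) - R t)) (at t within {a..b})"
      using nz[OF t] unfolding F_def R_def by (simp add: field_simps)
  qed
  then have I: "integral {a..b} (\<lambda>t. cis (g t) - R t) = F b - F a" by (rule integral_unique)
  have Rint: "R integrable_on {a..b}"
    unfolding R_def cis_conv_exp using nz
    by (intro integrable_continuous_interval continuous_intros cg g2) auto
  have "integral {a..b} (\<lambda>t. cis (g t)) = (F b - F a) + integral {a..b} R"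
    using I unfolding integral_diff[OF cis_integrable[OF cg(1)] Rint] by (simp only: diff_eq_eq)
  also have "cmod \<dots> \<le> (cmod (F b) + cmod (F a)) + cmod (integral {a..b} R)"
    by (intro order_trans[OF norm_triangle_ineq] add_mono norm_triangle_ineq4 order_refl)
  also have "cmod (F b) \<le> 1 / \<Lambda>"
    using low[of b] \<open>a \<le> b\<close> \<open>\<Lambda> > 0\<close> by (simp add: F_def norm_mult norm_divide field_simps)
  also have "cmod (F a) \<le> 1 / \<Lambda>"
    using low[of a] \<open>a \<le> b\<close> \<open>\<Lambda> > 0\<close> by (simp add: F_def norm_mult norm_divide field_simps)
  also have "cmod (integral {a..b} R) \<le> integral {a..b} (\<lambda>t. \<bar>g2 t\<bar> / (g1 t)\<^sup>2)"
  proof (rule integral_norm_bound_integral[OF Rint])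
    show "(\<lambda>t. \<bar>g2 t\<bar> / (g1 t)\<^sup>2) integrable_on {a..b}"
      using nz by (intro integrable_continuous_interval continuous_intros cg g2) auto
  qed (simp add: R_def norm_mult norm_divide norm_power)
  finally show ?thesis by simp
qed

text \<open>A bound on g'' relative to \<Lambda> replaces the usual monotonicity of g'. This version
  serves derivatives of order 1 along a segment, where g'' need not have a constant sign.\<close>

lemma norm_integral_cis_first_derivative:
  fixes g g1 g2 :: "real \<Rightarrow> real"
  assumes "a \<le> b" "\<Lambda> > 0"
    and g: "\<And>t. t \<in> {a..b} \<Longrightarrow> (g has_real_derivative g1 t) (at t within {a..b})"
    and g1: "\<And>t. t \<in> {a..b} \<Longrightarrow> (g1 has_real_derivative g2 t) (at t within {a..b})"
    and g2: "continuous_on {a..b} g2"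
    and low: "\<And>t. t \<in> {a..b} \<Longrightarrow> \<Lambda> \<le> \<bar>g1 t\<bar>"
    and up: "\<And>t. t \<in> {a..b} \<Longrightarrow> \<bar>g2 t\<bar> \<le> K * \<Lambda>"
  shows "cmod (integral {a..b} (\<lambda>t. cis (g t))) \<le> (2 + K * (b - a)) / \<Lambda>"
proof -
  have nz: "g1 t \<noteq> 0" if "t \<in> {a..b}" for t using low[OF that] \<open>\<Lambda> > 0\<close> by auto
  have cg: "continuous_on {a..b} g1" by (rule DERIV_continuous_on[OF g1])
  have "integral {a..b} (\<lambda>t. \<bar>g2 t\<bar> / (g1 t)\<^sup>2) \<le> integral {a..b} (\<lambda>t. K / \<Lambda>)"
  proof (rule integral_le)
    show "(\<lambda>t. \<bar>g2 t\<bar> / (g1 t)\<^sup>2) integrable_on {a..b}"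
      using nz by (intro integrable_continuous_interval continuous_intros cg g2) auto
    fix t assume t: "t \<in> {a..b}"
    have "\<Lambda>\<^sup>2 \<le> \<bar>g1 t\<bar>\<^sup>2" using low[OF t] \<open>\<Lambda> > 0\<close> by (intro power_mono) auto
    then have "\<bar>g2 t\<bar> / (g1 t)\<^sup>2 \<le> (K * \<Lambda>) / \<Lambda>\<^sup>2"
      using up[OF t] \<open>\<Lambda> > 0\<close> by (intro frac_le) (auto intro: order_trans[OF abs_ge_zero])
    then show "\<bar>g2 t\<bar> / (g1 t)\<^sup>2 \<le> K / \<Lambda>" using \<open>\<Lambda> > 0\<close> by (simp add: power2_eq_square)
  qed auto
  then have "integral {a..b} (\<lambda>t. \<bar>g2 t\<bar> / (g1 t)\<^sup>2) \<le> K * (b - a) / \<Lambda>"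
    using \<open>a \<le> b\<close> by (simp add: mult.commute)
  with norm_integral_cis_by_parts[OF assms(1-6)] show ?thesis by (simp add: add_divide_distrib)
qed

text \<open>For g'' >= 0 the integrand |g''| / g'^2 is the derivative of -1/g', so its integral is a
  boundary term and the constant depends on neither g'' nor the length of the interval.\<close>

lemma norm_integral_cis_convex_phase:
  fixes g g1 g2 :: "real \<Rightarrow> real"
  assumes "a \<le> b" "\<Lambda> > 0"
    and g: "\<And>t. t \<in> {a..b} \<Longrightarrow> (g has_real_derivative g1 t) (at t within {a..b})"
    and g1: "\<And>t. t \<in> {a..b} \<Longrightarrow> (g1 has_real_derivative g2 t) (at t within {a..b})"
    and g2: "continuous_on {a..b} g2"
    and low: "\<And>t. t \<in> {a..b} \<Longrightarrow> \<Lambda> \<le> \<bar>g1 t\<bar>"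
    and pos: "\<And>t. t \<in> {a..b} \<Longrightarrow> 0 \<le> g2 t"
  shows "cmod (integral {a..b} (\<lambda>t. cis (g t))) \<le> 4 / \<Lambda>"
proof -
  have nz: "g1 t \<noteq> 0" if "t \<in> {a..b}" for t using low[OF that] \<open>\<Lambda> > 0\<close> by auto
  have "((\<lambda>t. g2 t / (g1 t)\<^sup>2) has_integral ((- 1 / g1 b) - (- 1 / g1 a))) {a..b}"
  proof (rule fundamental_theorem_of_calculus[OF \<open>a \<le> b\<close>])
    fix t assume t: "t \<in> {a..b}"
    have "((\<lambda>t. - 1 / g1 t) has_real_derivative (g2 t / (g1 t)\<^sup>2)) (at t within {a..b})"
      using nz[OF t] by (auto intro!: derivative_eq_intros g1[OF t] simp: power2_eq_square)
    then show "((\<lambda>t. - 1 / g1 t) has_vector_derivative (g2 t / (g1 t)\<^sup>2)) (at t within {a..b})"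
      by (simp add: has_real_derivative_iff_has_vector_derivative)
  qed
  then have "((\<lambda>t. \<bar>g2 t\<bar> / (g1 t)\<^sup>2) has_integral ((- 1 / g1 b) - (- 1 / g1 a))) {a..b}"
    by (rule has_integral_eq[rotated]) (use pos in auto)
  then have "integral {a..b} (\<lambda>t. \<bar>g2 t\<bar> / (g1 t)\<^sup>2) = (- 1 / g1 b) - (- 1 / g1 a)"
    by (rule integral_unique)
  also have "\<dots> \<le> \<bar>1 / g1 b\<bar> + \<bar>1 / g1 a\<bar>" by linarith
  also have "\<dots> \<le> 1 / \<Lambda> + 1 / \<Lambda>"
    unfolding abs_divide using low[of a] low[of b] \<open>a \<le> b\<close> \<open>\<Lambda> > 0\<close> by (intro add_mono frac_le) auto
  finally show ?thesis using norm_integral_cis_by_parts[OF assms(1-6)] by simp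
qed

text \<open>The function h t - \<Lambda> t is nondecreasing. The point c is the zero of h, or the
  appropriate endpoint when h does not change sign.\<close>

lemma deriv_crossing:
  fixes h h' :: "real \<Rightarrow> real"
  assumes "a \<le> b" and h: "\<And>t. t \<in> {a..b} \<Longrightarrow> (h has_real_derivative h' t) (at t within {a..b})"
    and low: "\<And>t. t \<in> {a..b} \<Longrightarrow> \<Lambda> \<le> h' t"
  obtains c where "c \<in> {a..b}" "\<And>t. t \<in> {a..b} \<Longrightarrow> c < t \<Longrightarrow> \<Lambda> * (t - c) \<le> h t"
    "\<And>t. t \<in> {a..b} \<Longrightarrow> t < c \<Longrightarrow> h t \<le> - (\<Lambda> * (c - t))"
proof -
  have mono: "\<Lambda> * (t - s) \<le> h t - h s" if "a \<le> s" "s \<le> t" "t \<le> b" for s t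
  proof -
    have "h s - \<Lambda> * s \<le> h t - \<Lambda> * t"
    proof (rule DERIV_nonneg_imp_increasing_open[of s t "\<lambda>t. h t - \<Lambda> * t"])
      fix x assume x: "s < x" "x < t"
      then have xi: "x \<in> {a<..<b}" using that by auto
      then have "(h has_real_derivative h' x) (at x)"
        using h[of x] at_within_Icc_at[of a x b] by auto
      then have "((\<lambda>t. h t - \<Lambda> * t) has_real_derivative h' x - \<Lambda>) (at x)"
        by (auto intro!: derivative_eq_intros)
      moreover have "h' x - \<Lambda> \<ge> 0" using low[of x] xi by simp
      ultimately show "\<exists>y. ((\<lambda>t. h t - \<Lambda> * t) has_real_derivative y) (at x) \<and> 0 \<le> y" by blast
    next
      have "continuous_on {a..b} h" by (rule DERIV_continuous_on[OF h])
      then have "continuous_on {s..t} h" by (rule continuous_on_subset) (use that in auto)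
      then show "continuous_on {s..t} (\<lambda>t. h t - \<Lambda> * t)" by (intro continuous_intros)
    qed (use that in auto)
    then show ?thesis by (simp add: algebra_simps)
  qed
  consider "h a \<ge> 0" | "h b \<le> 0" | "h a \<le> 0" "0 \<le> h b" by linarith
  then show thesis
  proof cases
    case 1
    have "\<Lambda> * (t - a) \<le> h t" if "t \<in> {a..b}" for t using mono[of a t] 1 that by simp
    then show ?thesis using that[of a] \<open>a \<le> b\<close> by simp
  next
    case 2
    have "h t \<le> - (\<Lambda> * (b - t))" if "t \<in> {a..b}" for t using mono[of t b] 2 that by simp
    then show ?thesis using that[of b] \<open>a \<le> b\<close> by simp
  next
    case 3
    have "continuous_on {a..b} h" by (rule DERIV_continuous_on[OF h])
    then obtain c where c: "c \<in> {a..b}" "h c = 0" using IVT'[of h a 0 b] 3 \<open>a \<le> b\<close> by auto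
    show ?thesis
    proof (rule that[OF c(1)])
      show "\<Lambda> * (t - c) \<le> h t" if "t \<in> {a..b}" "c < t" for t using mono[of c t] that c by simp
      show "h t \<le> - (\<Lambda> * (c - t))" if "t \<in> {a..b}" "t < c" for t using mono[of t c] that c by simp
    qed
  qed
qed

text \<open>The start 4 is the constant of the convex case. Each further order adds 2 for the
  excised interval of length at most 2 \<delta> and uses the previous constant once on each side of
  it.\<close>

fun vdc_const :: "nat \<Rightarrow> real" where
  "vdc_const 0 = 0"
| "vdc_const (Suc 0) = 4"
| "vdc_const (Suc (Suc j)) = 2 + 2 * vdc_const (Suc j)"

lemma vdc_const_nonneg: "vdc_const j \<ge> 0"
  by (induction j rule: vdc_const.induct) auto

text \<open>Complex conjugation reduces a derivative below -\<Lambda> to one above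
  \<Lambda>.\<close>

lemma norm_integral_cis_uminus:
  "cmod (integral S (\<lambda>t. cis (- g t))) = cmod (integral S (\<lambda>t. cis (g t)))"
proof -
  have "integral S (\<lambda>t. cis (- g t)) = integral S (\<lambda>t. cnj (cis (g t)))" by (simp add: cis_cnj)
  also have "\<dots> = cnj (integral S (\<lambda>t. cis (g t)))" by (rule integral_cnj[symmetric])
  finally show ?thesis by simp
qed

text \<open>If \<open>|g (j + 1)| \<ge> \<Lambda>\<close>, then \<open>g j\<close> is large away from its only zero, so that the
  induction hypothesis applies outside an interval around it. In the step from \<open>j = 1\<close>, the sign
  condition on \<open>g 2\<close> comes for free.\<close>

lemma van_der_Corput:
  fixes g :: "nat \<Rightarrow> real \<Rightarrow> real"
  assumes "1 \<le> j" "a \<le> b" "\<Lambda> > 0"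
    and g: "\<And>i t. i < max 2 j \<Longrightarrow> t \<in> {a..b} \<Longrightarrow> (g i has_real_derivative g (Suc i) t) (at t within {a..b})"
    and g2: "continuous_on {a..b} (g 2)"
    and convex: "j = 1 \<Longrightarrow> (\<forall>t\<in>{a..b}. 0 \<le> g 2 t)"
    and low: "(\<forall>t\<in>{a..b}. \<Lambda> \<le> g j t) \<or> (\<forall>t\<in>{a..b}. g j t \<le> - \<Lambda>)"
  shows "cmod (integral {a..b} (\<lambda>t. cis (g 0 t))) \<le> vdc_const j * \<Lambda> powr - (1 / real j)"
  using assms
proof (induction j arbitrary: a b \<Lambda> g rule: nat_induct_at_least)
  case base
  have "cmod (integral {a..b} (\<lambda>t. cis (g 0 t))) \<le> 4 / \<Lambda>"
  proof (rule norm_integral_cis_convex_phase[OF base(1,2), where ?g1.0 = "g 1" and ?g2.0 = "g 2"])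
    show "(g 0 has_real_derivative g 1 t) (at t within {a..b})" if "t \<in> {a..b}" for t
      using base(3)[of 0 t] that by simp
    show "(g 1 has_real_derivative g 2 t) (at t within {a..b})" if "t \<in> {a..b}" for t
      using base(3)[of 1 t] that by (simp add: numeral_2_eq_2)
    show "\<Lambda> \<le> \<bar>g 1 t\<bar>" if "t \<in> {a..b}" for t
      using base(6) that by (auto dest!: bspec[of _ _ t])
  qed (use base(4,5) in auto)
  then show ?case using \<open>\<Lambda> > 0\<close> by (simp add: powr_minus divide_inverse)
next
  case (Suc j)
  \<comment> \<open>The width \<delta> balances two costs: the interval around the crossing has
    length at most 2 \<delta>, and outside it |g j| >= \<Lambda> \<delta>, so the order j estimate
    contributes a multiple of (\<Lambda> \<delta>)^(-1/j), which equals \<delta>.\<close>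
  define \<delta> where "\<delta> = \<Lambda> powr - (1 / real (Suc j))"
  have \<delta>0: "\<delta> > 0" using \<open>\<Lambda> > 0\<close> by (simp add: \<delta>_def)
  have \<delta>j: "(\<Lambda> * \<delta>) powr - (1 / real j) = \<delta>"
  proof -
    have "\<Lambda> * \<delta> = \<Lambda> powr (1 - 1 / real (Suc j))"
      using \<open>\<Lambda> > 0\<close> by (simp add: \<delta>_def powr_diff powr_minus divide_inverse)
    then have "(\<Lambda> * \<delta>) powr - (1 / real j) = \<Lambda> powr ((1 - 1 / real (Suc j)) * - (1 / real j))"
      by (simp only: powr_powr)
    also have "(1 - 1 / real (Suc j)) * - (1 / real j) = - (1 / real (Suc j))"
      using Suc.hyps by (simp add: field_simps)
    finally show ?thesis by (simp add: \<delta>_def)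
  qed
  \<comment> \<open>Stated for an arbitrary family f so that it applies both to g and to its
    negative.\<close>
  have main: "cmod (integral {a..b} (\<lambda>t. cis (f 0 t))) \<le> (2 + 2 * vdc_const j) * \<delta>"
    if f: "\<And>i t. i < max 2 (Suc j) \<Longrightarrow> t \<in> {a..b} \<Longrightarrow> (f i has_real_derivative f (Suc i) t) (at t within {a..b})"
      and f2: "continuous_on {a..b} (f 2)"
      and low: "\<And>t. t \<in> {a..b} \<Longrightarrow> \<Lambda> \<le> f (Suc j) t" for f
  proof -
    have "j < max 2 (Suc j)" by simp
    from deriv_crossing[OF \<open>a \<le> b\<close> f[OF this] low]
    obtain c where c: "c \<in> {a..b}" and
      c1: "\<And>t. t \<in> {a..b} \<Longrightarrow> c < t \<Longrightarrow> \<Lambda> * (t - c) \<le> f j t" and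
      c2: "\<And>t. t \<in> {a..b} \<Longrightarrow> t < c \<Longrightarrow> f j t \<le> - (\<Lambda> * (c - t))" by blast
    define a' where "a' = max a (c - \<delta>)"
    define b' where "b' = min b (c + \<delta>)"
    have ab: "a \<le> a'" "a' \<le> b'" "b' \<le> b" "b' - a' \<le> 2 * \<delta>"
      using c \<delta>0 by (auto simp: a'_def b'_def)
    have piece: "cmod (integral {x..y} (\<lambda>t. cis (f 0 t))) \<le> vdc_const j * \<delta>"
      if xy: "a \<le> x" "x \<le> y" "y \<le> b"
        and lowj: "(\<forall>t\<in>{x..y}. \<Lambda> * \<delta> \<le> f j t) \<or> (\<forall>t\<in>{x..y}. f j t \<le> - (\<Lambda> * \<delta>))" for x y
    proof -
      have sub: "{x..y} \<subseteq> {a..b}" using xy by auto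
      have "cmod (integral {x..y} (\<lambda>t. cis (f 0 t))) \<le> vdc_const j * (\<Lambda> * \<delta>) powr - (1 / real j)"
      proof (rule Suc.IH)
        show "(f i has_real_derivative f (Suc i) t) (at t within {x..y})" if "i < max 2 j" "t \<in> {x..y}" for i t
          using f[of i t] that sub by (intro DERIV_subset[OF _ sub]) auto
        show "continuous_on {x..y} (f 2)" by (rule continuous_on_subset[OF f2 sub])
        show "\<forall>t\<in>{x..y}. 0 \<le> f 2 t" if "j = 1"
          using low sub that \<open>\<Lambda> > 0\<close> by (force simp: numeral_2_eq_2 intro: order_trans[OF less_imp_le])
      qed (use xy lowj \<open>\<Lambda> > 0\<close> \<delta>0 in auto)
      then show ?thesis by (simp add: \<delta>j)
    qed
    have left: "cmod (integral {a..a'} (\<lambda>t. cis (f 0 t))) \<le> vdc_const j * \<delta>"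
    proof (cases "a < c - \<delta>")
      case True
      have "f j t \<le> - (\<Lambda> * \<delta>)" if "t \<in> {a..c - \<delta>}" for t
      proof -
        have "\<Lambda> * \<delta> \<le> \<Lambda> * (c - t)" using that \<open>\<Lambda> > 0\<close> by (intro mult_left_mono) auto
        then show ?thesis using c2[of t] that c \<delta>0 by auto
      qed
      then show ?thesis using True c \<delta>0 by (intro piece) (auto simp: a'_def)
    next
      case False
      then have "a' = a" by (simp add: a'_def)
      then show ?thesis using \<delta>0 vdc_const_nonneg[of j] by simp
    qed
    have right: "cmod (integral {b'..b} (\<lambda>t. cis (f 0 t))) \<le> vdc_const j * \<delta>"
    proof (cases "c + \<delta> < b")
      case True
      have "\<Lambda> * \<delta> \<le> f j t" if "t \<in> {c + \<delta>..b}" for t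
      proof -
        have "\<Lambda> * \<delta> \<le> \<Lambda> * (t - c)" using that \<open>\<Lambda> > 0\<close> by (intro mult_left_mono) auto
        then show ?thesis using c1[of t] that c \<delta>0 by auto
      qed
      then show ?thesis using True c \<delta>0 by (intro piece) (auto simp: b'_def)
    next
      case False
      then have "b' = b" by (simp add: b'_def)
      then show ?thesis using \<delta>0 vdc_const_nonneg[of j] by simp
    qed
    have "continuous_on {a..b} (f 0)" by (rule DERIV_continuous_on[OF f]) auto
    then have int: "(\<lambda>t. cis (f 0 t)) integrable_on {a..b}" by (rule cis_integrable)
    then have int': "(\<lambda>t. cis (f 0 t)) integrable_on {a'..b}"
      by (rule integrable_on_subinterval) (use ab in auto)
    have "integral {a..b} (\<lambda>t. cis (f 0 t)) = integral {a..a'} (\<lambda>t. cis (f 0 t)) + integral {a'..b} (\<lambda>t. cis (f 0 t))"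
      using ab int by (intro Henstock_Kurzweil_Integration.integral_combine[symmetric]) auto
    also have "integral {a'..b} (\<lambda>t. cis (f 0 t)) = integral {a'..b'} (\<lambda>t. cis (f 0 t)) + integral {b'..b} (\<lambda>t. cis (f 0 t))"
      using ab int' by (intro Henstock_Kurzweil_Integration.integral_combine[symmetric]) auto
    finally have "cmod (integral {a..b} (\<lambda>t. cis (f 0 t))) \<le> cmod (integral {a..a'} (\<lambda>t. cis (f 0 t)))
        + (cmod (integral {a'..b'} (\<lambda>t. cis (f 0 t))) + cmod (integral {b'..b} (\<lambda>t. cis (f 0 t))))"
      by (metis (no_types, lifting) norm_triangle_ineq add_left_mono order_trans)
    also have "\<dots> \<le> vdc_const j * \<delta> + (2 * \<delta> + vdc_const j * \<delta>)"
      using norm_integral_cis_le[OF ab(2), of "f 0"] ab(4) by (intro add_mono left right) auto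
    finally show ?thesis by (simp add: algebra_simps)
  qed
  have K: "vdc_const (Suc j) = 2 + 2 * vdc_const j" using Suc.hyps by (cases j) auto
  show ?case
    using Suc.prems(6)
  proof
    assume "\<forall>t\<in>{a..b}. \<Lambda> \<le> g (Suc j) t"
    then show ?thesis using main[of g] Suc.prems(3,4) by (simp add: K \<delta>_def)
  next
    assume "\<forall>t\<in>{a..b}. g (Suc j) t \<le> - \<Lambda>"
    then have "cmod (integral {a..b} (\<lambda>t. cis (- g 0 t))) \<le> (2 + 2 * vdc_const j) * \<delta>"
      using Suc.prems(3,4) by (intro main[of "\<lambda>i t. - g i t"]) (auto intro!: DERIV_minus continuous_intros simp: minus_le_iff le_minus_iff)
    then show ?thesis by (simp add: K \<delta>_def norm_integral_cis_uminus)
  qed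
qed

section \<open>Iterated partial derivatives\<close>

lemma C_k_on_SucD: "C_k_on (Suc k) f U \<Longrightarrow> C_k_on k f U"
  by (induction k arbitrary: f) (auto intro: differentiable_imp_continuous_on)

lemma C_k_on_mono: "C_k_on k f U \<Longrightarrow> j \<le> k \<Longrightarrow> C_k_on j f U"
  by (induction k) (auto simp: le_Suc_eq dest: C_k_on_SucD simp del: C_k_on.simps(2))

lemma C_k_on_imp_continuous_on: "C_k_on k f U \<Longrightarrow> continuous_on U f"
  by (cases k) (auto intro: differentiable_imp_continuous_on)

lemma C_k_on_iterated_partial:
  "C_k_on k f U \<Longrightarrow> length js \<le> k \<Longrightarrow> C_k_on (k - length js) (iterated_partial js f) U"
proof (induction js)
  case (Cons i js)
  then have "C_k_on (Suc (k - length (i # js))) (iterated_partial js f) U"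
    using Suc_diff_Suc[of "length js" k] by (simp del: C_k_on.simps)
  then show ?case by simp
qed simp

lemma continuous_on_iterated_partial:
  "C_k_on k f U \<Longrightarrow> length js \<le> k \<Longrightarrow> continuous_on U (iterated_partial js f)"
  by (meson C_k_on_imp_continuous_on C_k_on_iterated_partial)

lemma frechet_derivative_eq_sum_partial:
  assumes "f differentiable (at x)"
  shows "frechet_derivative f (at x) h = (\<Sum>i\<in>UNIV. h $ i *\<^sub>R partial_derivative i f x)"
proof -
  have lin: "linear (frechet_derivative f (at x))" using assms by (rule linear_frechet_derivative)
  have "h = (\<Sum>i\<in>UNIV. h $ i *\<^sub>R axis i 1)"
    using basis_expansion[of h] by (simp add: scalar_mult_eq_scaleR)
  then have "frechet_derivative f (at x) h = frechet_derivative f (at x) (\<Sum>i\<in>UNIV. h $ i *\<^sub>R axis i 1)"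
    by (rule arg_cong)
  also have "\<dots> = (\<Sum>i\<in>UNIV. h $ i *\<^sub>R partial_derivative i f x)"
    by (simp add: linear_sum[OF lin] linear_cmul[OF lin] partial_derivative_def)
  finally show ?thesis .
qed

lemma C_k_on_has_derivative:
  assumes "C_k_on (Suc k) f U" "open U" "x \<in> U"
  shows "(f has_derivative (\<lambda>h. \<Sum>i\<in>UNIV. h $ i *\<^sub>R partial_derivative i f x)) (at x)"
proof -
  have d: "f differentiable (at x)"
    using assms by (simp add: differentiable_on_eq_differentiable_at)
  have "frechet_derivative f (at x) = (\<lambda>h. \<Sum>i\<in>UNIV. h $ i *\<^sub>R partial_derivative i f x)"
    by (rule ext) (rule frechet_derivative_eq_sum_partial[OF d])
  then show ?thesis using d by (metis frechet_derivative_works)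
qed

lemma C_k_on_has_vector_derivative_line:
  assumes "C_k_on (Suc k) f U" "open U" "p + t *\<^sub>R u \<in> U"
  shows "((\<lambda>t. f (p + t *\<^sub>R u)) has_vector_derivative
           (\<Sum>i\<in>UNIV. u $ i *\<^sub>R partial_derivative i f (p + t *\<^sub>R u))) (at t within S)"
proof -
  have 1: "((\<lambda>t. p + t *\<^sub>R u) has_derivative (\<lambda>s. s *\<^sub>R u)) (at t within S)"
    by (auto intro!: derivative_eq_intros)
  from has_derivative_compose[OF 1 C_k_on_has_derivative[OF assms]]
  show ?thesis by (simp add: has_vector_derivative_def scaleR_sum_right)
qed

lemma C_k_on_has_vector_derivative_axis:
  assumes "C_k_on (Suc k) f U" "open U" "p + t *\<^sub>R axis i 1 \<in> U"
  shows "((\<lambda>t. f (p + t *\<^sub>R axis i 1)) has_vector_derivative partial_derivative i f (p + t *\<^sub>R axis i 1)) (at t within S)"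
proof -
  have "(\<Sum>j\<in>UNIV. axis i 1 $ j *\<^sub>R partial_derivative j f y) = partial_derivative i f y" for y
    by (simp add: axis_def if_distrib if_distribR cong: if_cong)
  then show ?thesis using C_k_on_has_vector_derivative_line[OF assms] by simp
qed

lemma partial_derivative_cong:
  assumes "open U" "x \<in> U" "\<And>y. y \<in> U \<Longrightarrow> f y = g y"
  shows "partial_derivative i f x = partial_derivative i g x"
proof -
  have "(f has_derivative D) (at x) \<longleftrightarrow> (g has_derivative D) (at x)" for D
    using has_derivative_transform_within_open[OF _ assms(1,2)] assms(3) by metis
  then show ?thesis by (simp add: partial_derivative_def frechet_derivative_def)
qed

section \<open>Symmetry of mixed partial derivatives\<close>

lemma norm_diff_le_of_vector_derivative:
  fixes \<phi> :: "real \<Rightarrow> 'b::real_normed_vector"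
  assumes "0 \<le> h" and d: "\<And>t. t \<in> {0..h} \<Longrightarrow> (\<phi> has_vector_derivative \<phi>' t) (at t within {0..h})"
    and B: "\<And>t. t \<in> {0..h} \<Longrightarrow> norm (\<phi>' t) \<le> B"
  shows "norm (\<phi> h - \<phi> 0) \<le> B * h"
proof -
  have "norm (\<phi> h - \<phi> 0) \<le> B * norm (h - 0)"
  proof (rule differentiable_bound[of "{0..h}" \<phi> "\<lambda>t s. s *\<^sub>R \<phi>' t"])
    show "(\<phi> has_derivative (\<lambda>s. s *\<^sub>R \<phi>' t)) (at t within {0..h})" if "t \<in> {0..h}" for t
      using d[OF that] by (simp add: has_vector_derivative_def)
    show "onorm (\<lambda>s. s *\<^sub>R \<phi>' t) \<le> B" if "t \<in> {0..h}" for t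
      using B[OF that] by (intro onorm_le) (simp add: mult.commute[of B] mult_left_mono)
  qed (use \<open>0 \<le> h\<close> in auto)
  then show ?thesis using \<open>0 \<le> h\<close> by simp
qed

text \<open>The second-order difference quotient over a small square approximates
  \<open>\<partial>\<^sub>a \<partial>\<^sub>b f\<close>, and is symmetric in \<open>a\<close> and \<open>b\<close>.\<close>

lemma second_difference_bound:
  fixes f :: "real ^ 'd::finite \<Rightarrow> 'b::real_normed_vector"
  assumes "C_k_on 2 f U" "open U" "0 \<le> h"
    and sq: "\<And>s t. s \<in> {0..h} \<Longrightarrow> t \<in> {0..h} \<Longrightarrow> x + s *\<^sub>R axis a 1 + t *\<^sub>R axis b 1 \<in> U"
    and \<epsilon>: "\<And>s t. s \<in> {0..h} \<Longrightarrow> t \<in> {0..h} \<Longrightarrow>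
       norm (partial_derivative a (partial_derivative b f) (x + s *\<^sub>R axis a 1 + t *\<^sub>R axis b 1) - D) \<le> \<epsilon>"
  shows "norm (f (x + h *\<^sub>R axis a 1 + h *\<^sub>R axis b 1) - f (x + h *\<^sub>R axis a 1)
               - (f (x + h *\<^sub>R axis b 1) - f x) - (h * h) *\<^sub>R D) \<le> \<epsilon> * (h * h)"
proof -
  let ?b = "partial_derivative b f" and ?A = "axis a 1 :: real ^ 'd" and ?B = "axis b 1 :: real ^ 'd"
  have f1: "C_k_on (Suc 1) f U" and f2: "C_k_on (Suc 0) ?b U"
    using assms(1) by (simp_all add: numeral_2_eq_2)
  \<comment> \<open>The mean value inequality is used twice: here in direction a for the first
    partial derivative, and then in direction b for the difference of f along two opposite sides of
    the square.\<close>
  have inner: "norm (?b (x + h *\<^sub>R ?A + t *\<^sub>R ?B) - ?b (x + t *\<^sub>R ?B) - h *\<^sub>R D) \<le> \<epsilon> * h" if t: "t \<in> {0..h}" for t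
  proof -
    define \<phi> where "\<phi> s = ?b ((x + t *\<^sub>R ?B) + s *\<^sub>R ?A) - s *\<^sub>R D" for s
    have "norm (\<phi> h - \<phi> 0) \<le> \<epsilon> * h"
    proof (rule norm_diff_le_of_vector_derivative[OF \<open>0 \<le> h\<close>])
      fix s assume s: "s \<in> {0..h}"
      have e: "(x + t *\<^sub>R ?B) + s *\<^sub>R ?A = x + s *\<^sub>R ?A + t *\<^sub>R ?B" by simp
      have "(x + t *\<^sub>R ?B) + s *\<^sub>R ?A \<in> U" unfolding e by (rule sq[OF s t])
      from C_k_on_has_vector_derivative_axis[OF f2 \<open>open U\<close> this]
      show "(\<phi> has_vector_derivative (partial_derivative a ?b ((x + t *\<^sub>R ?B) + s *\<^sub>R ?A) - D)) (at s within {0..h})"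
        unfolding \<phi>_def by (auto intro!: derivative_eq_intros)
      show "norm (partial_derivative a ?b ((x + t *\<^sub>R ?B) + s *\<^sub>R ?A) - D) \<le> \<epsilon>"
        unfolding e by (rule \<epsilon>[OF s t])
    qed
    then show ?thesis by (simp add: \<phi>_def add_ac diff_diff_eq)
  qed
  define \<phi> where "\<phi> t = f ((x + h *\<^sub>R ?A) + t *\<^sub>R ?B) - f (x + t *\<^sub>R ?B) - (t * h) *\<^sub>R D" for t
  have "norm (\<phi> h - \<phi> 0) \<le> (\<epsilon> * h) * h"
  proof (rule norm_diff_le_of_vector_derivative[OF \<open>0 \<le> h\<close>])
    fix t assume t: "t \<in> {0..h}"
    have 1: "(x + h *\<^sub>R ?A) + t *\<^sub>R ?B \<in> U" "x + t *\<^sub>R ?B \<in> U"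
      using sq[of h t] sq[of 0 t] t \<open>0 \<le> h\<close> by auto
    show "(\<phi> has_vector_derivative (?b ((x + h *\<^sub>R ?A) + t *\<^sub>R ?B) - ?b (x + t *\<^sub>R ?B) - h *\<^sub>R D)) (at t within {0..h})"
      unfolding \<phi>_def
      by (auto intro!: derivative_eq_intros C_k_on_has_vector_derivative_axis[OF f1 \<open>open U\<close>] 1)
    show "norm (?b ((x + h *\<^sub>R ?A) + t *\<^sub>R ?B) - ?b (x + t *\<^sub>R ?B) - h *\<^sub>R D) \<le> \<epsilon> * h"
      by (rule inner[OF t])
  qed
  then show ?thesis by (simp add: \<phi>_def algebra_simps)
qed

text \<open>Both mixed derivatives, scaled by h^2, are within \<epsilon> h^2 of the same second
  difference, hence within 2 \<epsilon> of each other, while \<epsilon> is a third of their assumed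
  distance.\<close>

lemma partial_derivative_commute:
  fixes f :: "real ^ 'd::finite \<Rightarrow> 'b::real_normed_vector"
  assumes f: "C_k_on 2 f U" and "open U" "x \<in> U"
  shows "partial_derivative a (partial_derivative b f) x = partial_derivative b (partial_derivative a f) x"
proof (rule ccontr)
  let ?P = "\<lambda>a b. partial_derivative a (partial_derivative b f)"
  assume "?P a b x \<noteq> ?P b a x"
  define \<epsilon> where "\<epsilon> = norm (?P a b x - ?P b a x) / 3"
  have \<epsilon>: "\<epsilon> > 0" using \<open>?P a b x \<noteq> ?P b a x\<close> by (simp add: \<epsilon>_def)
  have "continuous_on U (?P a b)" "continuous_on U (?P b a)"
    using f by (simp_all add: numeral_2_eq_2)
  then have "isCont (?P a b) x" "isCont (?P b a) x"
    using assms(2,3) by (simp_all add: continuous_on_eq_continuous_at)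
  then obtain d1 d2 where d: "d1 > 0" "d2 > 0"
    "\<And>y. dist y x < d1 \<Longrightarrow> dist (?P a b y) (?P a b x) < \<epsilon>"
    "\<And>y. dist y x < d2 \<Longrightarrow> dist (?P b a y) (?P b a x) < \<epsilon>"
    using \<epsilon> unfolding continuous_at_eps_delta by metis
  obtain d3 where d3: "d3 > 0" "ball x d3 \<subseteq> U" using assms(2,3) open_contains_ball by blast
  \<comment> \<open>Points of the square are at distance at most 2 h from x, hence strictly inside
    all three balls.\<close>
  define h where "h = min d1 (min d2 d3) / 3"
  have h: "h > 0" "3 * h \<le> d1" "3 * h \<le> d2" "3 * h \<le> d3" using d d3 by (auto simp: h_def)
  have near: "dist (x + s *\<^sub>R axis i 1 + t *\<^sub>R axis j 1) x < 3 * h"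
    if "s \<in> {0..h}" "t \<in> {0..h}" for s t and i j :: 'd
  proof -
    have "dist (x + s *\<^sub>R axis i 1 + t *\<^sub>R axis j 1) x = norm (s *\<^sub>R axis i 1 + t *\<^sub>R axis j (1::real))"
      by (simp add: dist_norm add.assoc)
    also have "\<dots> \<le> norm (s *\<^sub>R axis i (1::real)) + norm (t *\<^sub>R axis j (1::real))" by (rule norm_triangle_ineq)
    also have "\<dots> \<le> h + h" using that by (simp add: norm_axis_1)
    finally show ?thesis using h by linarith
  qed
  have inU: "x + s *\<^sub>R axis i 1 + t *\<^sub>R axis j 1 \<in> U" if "s \<in> {0..h}" "t \<in> {0..h}" for s t and i j :: 'd
    using near[OF that, of i j] h(4) d3(2) by (auto simp: dist_commute subset_iff)
  have e1: "norm (?P a b (x + s *\<^sub>R axis a 1 + t *\<^sub>R axis b 1) - ?P a b x) \<le> \<epsilon>" if "s \<in> {0..h}" "t \<in> {0..h}" for s t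
    using d(3) near[OF that, of a b] h(2) by (simp add: dist_norm less_imp_le)
  have e2: "norm (?P b a (x + s *\<^sub>R axis b 1 + t *\<^sub>R axis a 1) - ?P b a x) \<le> \<epsilon>" if "s \<in> {0..h}" "t \<in> {0..h}" for s t
    using d(4) near[OF that, of b a] h(3) by (simp add: dist_norm less_imp_le)
  let ?\<Delta> = "f (x + h *\<^sub>R axis a 1 + h *\<^sub>R axis b 1) - f (x + h *\<^sub>R axis a 1) - (f (x + h *\<^sub>R axis b 1) - f x)"
  have "norm (?\<Delta> - (h * h) *\<^sub>R ?P a b x) \<le> \<epsilon> * (h * h)"
    by (rule second_difference_bound[OF f \<open>open U\<close> less_imp_le[OF h(1)] inU e1])
  moreover have "norm (?\<Delta> - (h * h) *\<^sub>R ?P b a x) \<le> \<epsilon> * (h * h)"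
    using second_difference_bound[OF f \<open>open U\<close> less_imp_le[OF h(1)] inU e2] by (simp add: algebra_simps)
  ultimately have "norm ((h * h) *\<^sub>R ?P a b x - (h * h) *\<^sub>R ?P b a x) \<le> 2 * \<epsilon> * (h * h)"
    using norm_triangle_ineq4[of "?\<Delta> - (h * h) *\<^sub>R ?P b a x" "?\<Delta> - (h * h) *\<^sub>R ?P a b x"] by (simp add: algebra_simps)
  then have "(h * h) * norm (?P a b x - ?P b a x) \<le> (h * h) * (2 * \<epsilon>)"
    by (simp add: scaleR_diff_right[symmetric] mult_ac)
  then have "norm (?P a b x - ?P b a x) \<le> 2 * \<epsilon>" using h(1) by simp
  then show False using \<epsilon> by (simp add: \<epsilon>_def)
qed

text \<open>Symmetry is recorded for adjacent transpositions, the form in which the polarization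
  argument uses it.\<close>

lemma iterated_partial_swap:
  assumes "C_k_on k f U" "open U" "x \<in> U" "length (pre @ a # b # js) \<le> k"
  shows "iterated_partial (pre @ a # b # js) f x = iterated_partial (pre @ b # a # js) f x"
  using assms(3,4)
proof (induction pre arbitrary: x)
  case Nil
  have "C_k_on (k - length js) (iterated_partial js f) U"
    using Nil.prems by (intro C_k_on_iterated_partial assms) simp
  then have "C_k_on 2 (iterated_partial js f) U" by (rule C_k_on_mono) (use Nil.prems in simp)
  then show ?case using partial_derivative_commute[OF _ \<open>open U\<close> Nil.prems(1)] by simp
next
  case (Cons i pre)
  show ?case unfolding append_Cons iterated_partial.simps
    by (rule partial_derivative_cong[OF \<open>open U\<close> Cons.prems(1)]) (use Cons in simp)
qed

section \<open>Homogeneous forms and polarization\<close>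

text \<open>The homogeneous form \<open>u \<mapsto> \<Sum> u\<^bsub>i\<^sub>1\<^esub> \<cdots> u\<^bsub>i\<^sub>j\<^esub> c [i\<^sub>1, \<dots>, i\<^sub>j]\<close>.\<close>

primrec power_form :: "nat \<Rightarrow> ('d::finite list \<Rightarrow> 'b::real_vector) \<Rightarrow> real ^ 'd \<Rightarrow> 'b" where
  "power_form 0 c u = c []"
| "power_form (Suc j) c u = (\<Sum>a\<in>UNIV. u $ a *\<^sub>R power_form j (\<lambda>js. c (a # js)) u)"

lemma power_form_cong:
  "(\<And>js. length js = j \<Longrightarrow> c js = c' js) \<Longrightarrow> power_form j c u = power_form j c' u"
proof (induction j arbitrary: c c')
  case 0
  from 0[of "[]"] show ?case by simp
next
  case (Suc j)
  have "power_form j (\<lambda>js. c (a # js)) u = power_form j (\<lambda>js. c' (a # js)) u" for a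
    by (rule Suc.IH) (rule Suc.prems, simp)
  then show ?case by (simp only: power_form.simps)
qed

lemma power_form_sum_scaleR:
  "finite I \<Longrightarrow> power_form j (\<lambda>js. \<Sum>i\<in>I. w i *\<^sub>R c i js) u = (\<Sum>i\<in>I. w i *\<^sub>R power_form j (c i) u)"
proof (induction j arbitrary: c)
  case (Suc j)
  have "power_form (Suc j) (\<lambda>js. \<Sum>i\<in>I. w i *\<^sub>R c i js) u =
      (\<Sum>a\<in>UNIV. \<Sum>i\<in>I. w i *\<^sub>R u $ a *\<^sub>R power_form j (\<lambda>js. c i (a # js)) u)"
    using Suc by (simp add: scaleR_sum_right mult.commute)
  also have "\<dots> = (\<Sum>i\<in>I. \<Sum>a\<in>UNIV. w i *\<^sub>R u $ a *\<^sub>R power_form j (\<lambda>js. c i (a # js)) u)"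
    by (rule sum.swap)
  also have "\<dots> = (\<Sum>i\<in>I. w i *\<^sub>R power_form (Suc j) (c i) u)"
    by (simp only: scaleR_sum_right power_form.simps)
  finally show ?case .
qed simp

lemma inner_power_form: "w \<bullet> power_form j c u = power_form j (\<lambda>js. w \<bullet> c js) u"
  for w :: "'b::real_inner"
  by (induction j arbitrary: c) (simp_all add: inner_sum_right)

lemma continuous_on_power_form:
  "(\<And>js. length js = j \<Longrightarrow> continuous_on S (c js)) \<Longrightarrow> continuous_on S (\<lambda>x. power_form j (\<lambda>js. c js x) u)"
  for c :: "'d::finite list \<Rightarrow> 'a::topological_space \<Rightarrow> 'b::real_normed_vector"
proof (induction j arbitrary: c)
  case (Suc j)
  show ?case unfolding power_form.simps by (intro continuous_intros Suc.IH Suc.prems) simp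
qed simp

lemma has_vector_derivative_power_form:
  "(\<And>js. length js = j \<Longrightarrow> ((\<lambda>t. c t js) has_vector_derivative c' js) F) \<Longrightarrow>
     ((\<lambda>t. power_form j (c t) u) has_vector_derivative power_form j c' u) F"
proof (induction j arbitrary: c c')
  case (Suc j)
  show ?case unfolding power_form.simps
    by (intro has_vector_derivative_sum Suc.IH Suc.prems
        bounded_linear.has_vector_derivative[OF bounded_linear_scaleR_right]) simp
qed simp

text \<open>For smooth f this is the j-th derivative of f along the line x + t u at t = 0. Writing
  it as a form in u makes polarization applicable.\<close>

definition directional_derivative ::
    "nat \<Rightarrow> real ^ 'd::finite \<Rightarrow> (real ^ 'd \<Rightarrow> 'b::real_normed_vector) \<Rightarrow> real ^ 'd \<Rightarrow> 'b" where
  "directional_derivative j u f x = power_form j (\<lambda>js. iterated_partial js f x) u"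

lemma directional_derivative_0 [simp]: "directional_derivative 0 u f x = f x"
  by (simp add: directional_derivative_def)

lemma continuous_on_directional_derivative:
  "C_k_on k f U \<Longrightarrow> j \<le> k \<Longrightarrow> continuous_on U (directional_derivative j u f)"
  unfolding directional_derivative_def[abs_def]
  by (intro continuous_on_power_form continuous_on_iterated_partial) auto

lemma has_vector_derivative_directional_derivative:
  assumes "C_k_on k f U" "open U" "j < k" "x + t *\<^sub>R u \<in> U"
  shows "((\<lambda>t. directional_derivative j u f (x + t *\<^sub>R u)) has_vector_derivative
           directional_derivative (Suc j) u f (x + t *\<^sub>R u)) (at t within S)"
proof -
  have "((\<lambda>t. iterated_partial js f (x + t *\<^sub>R u)) has_vector_derivative
      (\<Sum>i\<in>UNIV. u $ i *\<^sub>R iterated_partial (i # js) f (x + t *\<^sub>R u))) (at t within S)" if "length js = j" for js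
  proof -
    have "C_k_on (Suc (k - Suc j)) (iterated_partial js f) U"
      using C_k_on_iterated_partial[OF assms(1), of js] that \<open>j < k\<close> Suc_diff_Suc[of j k] by (simp del: C_k_on.simps)
    from C_k_on_has_vector_derivative_line[OF this assms(2,4)] show ?thesis by simp
  qed
  from has_vector_derivative_power_form[OF this]
  show ?thesis
    unfolding directional_derivative_def by (simp add: power_form_sum_scaleR)
qed

text \<open>Differentiating in direction b puts b into each of the j slots in turn; by symmetry all
  slots contribute equally, hence the factor j.\<close>

lemma has_real_derivative_power_form:
  fixes c :: "'d::finite list \<Rightarrow> real"
  assumes "\<And>pre a b js. c (pre @ a # b # js) = c (pre @ b # a # js)"
  shows "((\<lambda>s. power_form j c (u + s *\<^sub>R axis b 1)) has_real_derivative
           real j * power_form (j - 1) (\<lambda>js. c (b # js)) (u + s *\<^sub>R axis b 1)) (at s)"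
  using assms
proof (induction j arbitrary: c)
  case 0
  show ?case by simp
next
  case (Suc j)
  let ?u = "u + s *\<^sub>R axis b 1"
  note swap = Suc.prems
  have sym: "c (a # pre @ a' # b' # js) = c (a # pre @ b' # a' # js)" for a pre a' b' js
    using Suc.prems[of "a # pre"] by simp
  have coord: "((\<lambda>s. (u + s *\<^sub>R axis b 1) $ a) has_real_derivative axis b 1 $ a) (at s)" for a
    by (auto intro!: derivative_eq_intros)
  have "((\<lambda>s. power_form (Suc j) c (u + s *\<^sub>R axis b 1)) has_real_derivative
      (\<Sum>a\<in>UNIV. axis b 1 $ a * power_form j (\<lambda>js. c (a # js)) ?u +
        (real j * power_form (j - 1) (\<lambda>js. c (a # b # js)) ?u) * ?u $ a)) (at s)"
    unfolding power_form.simps real_scaleR_def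
    by (intro DERIV_sum DERIV_mult coord Suc.IH sym)
  moreover have "(\<Sum>a\<in>UNIV. axis b 1 $ a * power_form j (\<lambda>js. c (a # js)) ?u) = power_form j (\<lambda>js. c (b # js)) ?u"
    by (simp add: axis_def if_distrib if_distribR cong: if_cong)
  moreover have "(\<Sum>a\<in>UNIV. (real j * power_form (j - 1) (\<lambda>js. c (a # b # js)) ?u) * ?u $ a) =
      real j * power_form j (\<lambda>js. c (b # js)) ?u"
  proof (cases j)
    case (Suc i)
    \<comment> \<open>Exchanging the two leading indices moves b to the front, so that the sum over
      a reassembles a form one degree higher.\<close>
    have e: "(\<lambda>js. c (a # b # js)) = (\<lambda>js. c (b # a # js))" for a using swap[of "[]"] by simp
    have "(\<Sum>a\<in>UNIV. (real j * power_form (j - 1) (\<lambda>js. c (a # b # js)) ?u) * ?u $ a) =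
        (\<Sum>a\<in>UNIV. real j * (?u $ a * power_form i (\<lambda>js. c (b # a # js)) ?u))"
      unfolding Suc diff_Suc_1 by (intro sum.cong refl) (simp only: e mult_ac)
    then show ?thesis by (simp only: sum_distrib_left[symmetric] Suc power_form.simps real_scaleR_def)
  qed simp
  ultimately have "((\<lambda>s. power_form (Suc j) c (u + s *\<^sub>R axis b 1)) has_real_derivative
      power_form j (\<lambda>js. c (b # js)) ?u + real j * power_form j (\<lambda>js. c (b # js)) ?u) (at s)"
    by (simp only: sum.distrib)
  then show ?case by (simp add: distrib_right)
qed

text \<open>Polarization, by differentiating the form in a coordinate direction.\<close>

lemma power_form_eq_0_imp:
  fixes c :: "'d::finite list \<Rightarrow> real"
  assumes "\<And>pre a b js. c (pre @ a # b # js) = c (pre @ b # a # js)"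
    and "\<And>u. power_form j c u = 0" and "length js = j"
  shows "c js = 0"
  using assms
proof (induction j arbitrary: c js)
  case 0
  from 0(2,3) show ?case by simp
next
  case (Suc j)
  from Suc.prems(3) obtain b ks where js: "js = b # ks" "length ks = j" by (auto simp: length_Suc_conv)
  have "power_form j (\<lambda>js. c (b # js)) u = 0" for u
  proof -
    have "((\<lambda>s. 0) has_real_derivative real (Suc j) * power_form j (\<lambda>js. c (b # js)) (u + 0 *\<^sub>R axis b 1)) (at 0)"
      using has_real_derivative_power_form[of c "Suc j" u b 0, OF Suc.prems(1)]
      unfolding Suc.prems(2) by simp
    from DERIV_unique[OF this DERIV_const] show ?thesis by simp
  qed
  then have z: "\<And>u. power_form j (\<lambda>js. c (b # js)) u = 0" .
  have swap: "c (b # pre @ a' # b' # js) = c (b # pre @ b' # a' # js)" for pre a' b' js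
    using Suc.prems(1)[of "b # pre"] by simp
  have "(\<lambda>js. c (b # js)) ks = 0"
    by (rule Suc.IH[of "\<lambda>js. c (b # js)", OF swap z js(2)])
  then show ?case by (simp add: js)
qed

text \<open>Restriction to lines only sees pure directional derivatives; by polarization, if w
  annihilated all those of a given order, it would annihilate every mixed partial derivative of that
  order.\<close>

lemma directional_derivative_nonzero:
  fixes f :: "real ^ 'd::finite \<Rightarrow> real ^ 'm::finite"
  assumes "C_k_on k f U" "open U" "x \<in> U" "length js \<le> k" "w \<bullet> iterated_partial js f x \<noteq> 0"
  obtains u where "w \<bullet> directional_derivative (length js) u f x \<noteq> 0"
proof (rule ccontr)
  assume *: "\<not> thesis"
  \<comment> \<open>Cutting off at other lengths makes \<open>c\<close> symmetric on all lists,
    although smoothness gives symmetry only up to order k.\<close>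
  define c where "c ks = (if length ks = length js then w \<bullet> iterated_partial ks f x else 0)" for ks
  have "w \<bullet> directional_derivative (length js) u f x = power_form (length js) c u" for u
    unfolding directional_derivative_def inner_power_form by (rule power_form_cong) (simp add: c_def)
  then have "power_form (length js) c u = 0" for u using * that by force
  moreover have "c (pre @ a # b # ks) = c (pre @ b # a # ks)" for pre a b ks
    using iterated_partial_swap[OF assms(1-3), of pre a b ks] assms(4) by (simp add: c_def)
  ultimately have "c js = 0" by (intro power_form_eq_0_imp[of c]) auto
  then show False using assms(5) by (simp add: c_def)
qed

section \<open>Fourier decay of nondegenerate parametrizations\<close>

lemma bounded_convex_real_interval:
  fixes J :: "real set"
  assumes "convex J" "bounded J" "J \<noteq> {}"
  obtains a b where "a \<le> b" "J \<subseteq> {a..b}" "{a<..<b} \<subseteq> J"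
proof -
  define a b where "a = Inf J" and "b = Sup J"
  have bdd: "bdd_below J" "bdd_above J" using assms(2) by (auto intro: bounded_imp_bdd_below bounded_imp_bdd_above)
  have sub: "J \<subseteq> {a..b}" using bdd by (auto simp: a_def b_def intro: cInf_lower cSup_upper)
  moreover have "{a<..<b} \<subseteq> J"
  proof
    fix t assume t: "t \<in> {a<..<b}"
    then obtain s where s: "s \<in> J" "s < t" using cInf_lessD[OF assms(3), of t] by (auto simp: a_def)
    from t obtain s' where s': "s' \<in> J" "t < s'" using less_cSup_iff[OF assms(3) bdd(2), of t] by (auto simp: b_def)
    have "is_interval J" using assms(1) by (simp add: is_interval_convex_1)
    then show "t \<in> J" using s s' unfolding is_interval_1 by (metis less_imp_le)
  qed
  ultimately show thesis using that[of a b] assms(3) by fastforce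
qed

text \<open>The parameters t for which the segment lies in the ball form an interval, which may be
  replaced by its closure. For j >= 2 van der Corput's lemma applies to the phase along the segment;
  for j = 1 the sign of the second derivative is unknown, and the bound \<open>up\<close> is used
  instead.\<close>

lemma line_oscillatory_integral_bound:
  fixes f :: "real ^ 'd::finite \<Rightarrow> real ^ 'm::finite"
  assumes f: "C_k_on k f U" "open U" "cball x0 r \<subseteq> U" "2 \<le> k" "1 \<le> j" "j \<le> k" and "\<Lambda> > 0" "K \<ge> 0"
    and low: "(\<forall>x\<in>cball x0 r. \<Lambda> \<le> w \<bullet> directional_derivative j u f x) \<or>
              (\<forall>x\<in>cball x0 r. w \<bullet> directional_derivative j u f x \<le> - \<Lambda>)"
    and up: "\<And>x. x \<in> cball x0 r \<Longrightarrow> \<bar>w \<bullet> directional_derivative 2 u f x\<bar> \<le> K * \<Lambda>"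
  shows "cmod (LINT t:{0..1}|lborel. indicat_real (ball x0 r) (x + t *\<^sub>R u) *\<^sub>R cis (w \<bullet> f (x + t *\<^sub>R u)))
           \<le> (2 + K + vdc_const j) * \<Lambda> powr - (1 / real j)"
proof -
  define J where "J = {0..1} \<inter> (\<lambda>t. x + t *\<^sub>R u) -` ball x0 r"
  define G where "G t = cis (w \<bullet> f (x + t *\<^sub>R u))" for t
  have eq: "(LINT t:{0..1}|lborel. indicat_real (ball x0 r) (x + t *\<^sub>R u) *\<^sub>R cis (w \<bullet> f (x + t *\<^sub>R u))) = (LINT t:J|lborel. G t)"
    unfolding set_lebesgue_integral_def G_def
    by (intro Bochner_Integration.integral_cong) (auto simp: J_def indicator_def)
  have R0: "0 \<le> (2 + K + vdc_const j) * \<Lambda> powr - (1 / real j)"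
    using \<open>K \<ge> 0\<close> vdc_const_nonneg[of j] by (intro mult_nonneg_nonneg) auto
  show ?thesis
  proof (cases "J = {}")
    case True
    then show ?thesis unfolding eq using R0 by (simp add: set_lebesgue_integral_def)
  next
    case False
    have "convex ((\<lambda>t. x + t *\<^sub>R u) -` ball x0 r)"
    proof -
      have "(\<lambda>t. x + t *\<^sub>R u) -` ball x0 r = (\<lambda>t. t *\<^sub>R u) -` ((+) x -` ball x0 r)" by auto
      moreover have "(+) x -` ball x0 r = ball (x0 - x) r" by (auto simp: dist_norm algebra_simps)
      ultimately show ?thesis
        by (simp add: convex_linear_vimage[of "\<lambda>t. t *\<^sub>R u"] linear_iff algebra_simps)
    qed
    then have "convex J" unfolding J_def by (intro convex_Int) auto
    moreover have "bounded J" by (rule bounded_subset[of "{0..1}"]) (auto simp: J_def)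
    ultimately obtain a b where ab: "a \<le> b" "J \<subseteq> {a..b}" "{a<..<b} \<subseteq> J"
      using False by (rule bounded_convex_real_interval)
    have ab1: "b - a \<le> 1"
    proof (cases "a < b")
      case True
      have "{a<..<b} \<subseteq> {0..1}" using ab(3) by (auto simp: J_def)
      then show ?thesis using True by (simp add: greaterThanLessThan_subseteq_atLeastAtMost_iff)
    qed (use ab in auto)
    \<comment> \<open>The endpoints may leave the open ball but stay in the closed one, which is why
      the hypotheses are imposed on the closed ball.\<close>
    have inB: "x + t *\<^sub>R u \<in> cball x0 r" if t: "t \<in> {a..b}" for t
    proof (cases "a < b")
      case True
      have "closed ((\<lambda>t. x + t *\<^sub>R u) -` cball x0 r)"
        by (intro closed_vimage continuous_intros closed_cball)
      moreover have "{a<..<b} \<subseteq> (\<lambda>t. x + t *\<^sub>R u) -` cball x0 r"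
        using ab(3) by (auto simp: J_def)
      ultimately have "closure {a<..<b} \<subseteq> (\<lambda>t. x + t *\<^sub>R u) -` cball x0 r" by (rule closure_minimal[rotated])
      then show ?thesis using True t by auto
    next
      case False
      then have "a = b" using ab(1) by simp
      then have "J = {a}" using ab(2) \<open>J \<noteq> {}\<close> by auto
      then show ?thesis using t \<open>a = b\<close> by (auto simp: J_def)
    qed
    define g where "g i t = w \<bullet> directional_derivative i u f (x + t *\<^sub>R u)" for i t
    have g: "(g i has_real_derivative g (Suc i) t) (at t within {a..b})" if "i < k" "t \<in> {a..b}" for i t
    proof -
      have "x + t *\<^sub>R u \<in> U" using inB[OF that(2)] f(3) by auto
      from has_vector_derivative_directional_derivative[OF f(1,2) that(1) this]
      have "((\<lambda>t. w \<bullet> directional_derivative i u f (x + t *\<^sub>R u)) has_vector_derivative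
          w \<bullet> directional_derivative (Suc i) u f (x + t *\<^sub>R u)) (at t within {a..b})"
        by (rule bounded_linear.has_vector_derivative[OF bounded_linear_inner_right])
      then show ?thesis by (simp add: g_def[abs_def] has_real_derivative_iff_has_vector_derivative)
    qed
    have gcont: "continuous_on {a..b} (g i)" if "i \<le> k" for i
    proof -
      have "continuous_on {a..b} (\<lambda>t. directional_derivative i u f (x + t *\<^sub>R u))"
        by (rule continuous_on_compose2[OF continuous_on_directional_derivative[OF f(1) that]])
           (use inB f(3) in \<open>auto intro!: continuous_intros\<close>)
      then show ?thesis unfolding g_def[abs_def] by (intro continuous_intros)
    qed
    have low': "(\<forall>t\<in>{a..b}. \<Lambda> \<le> g j t) \<or> (\<forall>t\<in>{a..b}. g j t \<le> - \<Lambda>)"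
      using low inB by (auto simp: g_def)
    have "cmod (integral {a..b} (\<lambda>t. cis (g 0 t))) \<le> (2 + K + vdc_const j) * \<Lambda> powr - (1 / real j)"
    proof (cases "j = 1")
      case True
      have "cmod (integral {a..b} (\<lambda>t. cis (g 0 t))) \<le> (2 + K * (b - a)) / \<Lambda>"
      proof (rule norm_integral_cis_first_derivative[OF ab(1) \<open>\<Lambda> > 0\<close>])
        show "(g 0 has_real_derivative g 1 t) (at t within {a..b})" if "t \<in> {a..b}" for t
          using g[of 0 t] that f(4) by simp
        show "(g 1 has_real_derivative g 2 t) (at t within {a..b})" if "t \<in> {a..b}" for t
          using g[of 1 t] that f(4) by (simp add: numeral_2_eq_2)
        show "\<Lambda> \<le> \<bar>g 1 t\<bar>" if "t \<in> {a..b}" for t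
          using low' that by (auto simp: True dest!: bspec[of _ _ t])
        show "\<bar>g 2 t\<bar> \<le> K * \<Lambda>" if "t \<in> {a..b}" for t
          using up inB[OF that] by (simp add: g_def)
      qed (use gcont f(4) in auto)
      also have "\<dots> \<le> (2 + K) / \<Lambda>"
        using mult_left_mono[OF ab1 \<open>K \<ge> 0\<close>] \<open>\<Lambda> > 0\<close> by (intro divide_right_mono) auto
      also have "\<dots> = (2 + K) * \<Lambda> powr - (1 / real j)"
        using True \<open>\<Lambda> > 0\<close> by (simp add: powr_minus divide_inverse)
      also have "\<dots> \<le> (2 + K + vdc_const j) * \<Lambda> powr - (1 / real j)"
        using vdc_const_nonneg[of j] by (intro mult_right_mono) auto
      finally show ?thesis .
    next
      case False
      have "cmod (integral {a..b} (\<lambda>t. cis (g 0 t))) \<le> vdc_const j * \<Lambda> powr - (1 / real j)"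
        by (rule van_der_Corput[OF f(5) ab(1) \<open>\<Lambda> > 0\<close> g gcont _ low']) (use f(4,6) False in auto)
      also have "\<dots> \<le> (2 + K + vdc_const j) * \<Lambda> powr - (1 / real j)"
        using \<open>K \<ge> 0\<close> by (intro mult_right_mono) auto
      finally show ?thesis .
    qed
    moreover have "(LINT t:J|lborel. G t) = integral {a..b} (\<lambda>t. cis (g 0 t))"
    proof -
      have contG: "continuous_on {a..b} G"
      proof -
        have "continuous_on {a..b} (\<lambda>t. cis (g 0 t))"
          unfolding cis_conv_exp using gcont[of 0] by (intro continuous_intros) simp
        then show ?thesis by (simp add: g_def[abs_def] G_def[abs_def])
      qed
      then have "set_integrable lborel {a..b} G" by (rule borel_integrable_atLeastAtMost')
      then have "(LINT t:{a..b}|lborel. G t) = integral {a..b} G" by (rule set_borel_integral_eq_integral(2))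
      moreover have "(LINT t:J|lborel. G t) = (LINT t:{a..b}|lborel. G t)"
      proof -
        have "AE t in lborel. t \<noteq> a" "AE t in lborel. t \<noteq> b" by (rule AE_lborel_singleton)+
        then have "AE t in lborel. indicat_real J t *\<^sub>R G t = indicat_real {a..b} t *\<^sub>R G t"
          by eventually_elim (use ab(2,3) in \<open>force simp: indicator_def subset_iff\<close>)
        moreover have "J \<in> sets borel" 
        proof -
          have "open ((\<lambda>t. x + t *\<^sub>R u) -` ball x0 r)" by (intro open_vimage continuous_intros open_ball)
          then show ?thesis by (auto simp: J_def)
        qed
        moreover have Gm: "(\<lambda>t. indicat_real {a..b} t *\<^sub>R G t) \<in> borel_measurable borel"
          by (rule borel_measurable_continuous_on_indicator) (use contG in auto)
        moreover have "(\<lambda>t. indicat_real J t *\<^sub>R G t) = (\<lambda>t. indicat_real J t *\<^sub>R (indicat_real {a..b} t *\<^sub>R G t))"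
          using ab(2) by (auto simp: indicator_def fun_eq_iff)
        moreover have "(\<lambda>t. indicat_real J t *\<^sub>R (indicat_real {a..b} t *\<^sub>R G t)) \<in> borel_measurable borel"
          by (rule borel_measurable_scaleR[OF borel_measurable_indicator[OF \<open>J \<in> sets borel\<close>] Gm])
        ultimately show ?thesis
          unfolding set_lebesgue_integral_def by (intro integral_cong_AE) (simp_all only: measurable_lborel1 measurable_lborel2)
      qed
      ultimately show ?thesis by (simp add: G_def[abs_def] g_def[abs_def])
    qed
    ultimately show ?thesis unfolding eq by simp
  qed
qed

text \<open>Averaging over translations in the direction \<open>u\<close> turns an integral over a ball into
  integrals over line segments, without any change of coordinates.\<close>

lemma norm_integral_le_line_integrals:
  fixes F :: "real ^ 'd::finite \<Rightarrow> complex"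
  assumes [measurable]: "F \<in> borel_measurable borel"
    and supp: "\<And>x. x \<notin> ball x0 r \<Longrightarrow> F x = 0" and bd: "\<And>x. cmod (F x) \<le> 1" and "M \<ge> 0"
    and M: "\<And>x. cmod (LINT t:{0..1}|lborel. F (x + t *\<^sub>R u)) \<le> M"
  shows "cmod (LINT x|lborel. F x) \<le> M * measure lborel (ball x0 (r + norm u))"
proof -
  define H where "H t x = indicat_real {0..1} t *\<^sub>R F (x + t *\<^sub>R u)" for t :: real and x
  let ?B = "ball x0 (r + norm u)"
  \<comment> \<open>Translations by t u with t in [0, 1] move the support by at most norm u, which
    explains the radius of \<open>?B\<close>.\<close>
  have out: "H t x = 0" if "x \<notin> ?B" for t x
  proof -
    have "x + t *\<^sub>R u \<notin> ball x0 r" if "t \<in> {0..1}"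
    proof
      assume "x + t *\<^sub>R u \<in> ball x0 r"
      then have "dist x0 (x + t *\<^sub>R u) < r" by simp
      moreover have "dist (x + t *\<^sub>R u) x \<le> norm u" using that by (simp add: dist_norm mult_left_le_one_le)
      ultimately have "dist x0 x < r + norm u" using dist_triangle[of x0 x "x + t *\<^sub>R u"] by linarith
      then show False using \<open>x \<notin> ?B\<close> by simp
    qed
    then show ?thesis using supp by (auto simp: H_def indicator_def)
  qed
  have meas: "case_prod H \<in> borel_measurable (lborel \<Otimes>\<^sub>M lborel)"
    unfolding H_def[abs_def] by measurable
  have finB: "emeasure lborel ?B < \<infinity>" by (rule emeasure_lborel_ball_finite)
  with emeasure_lborel_cbox_finite[of "0::real" 1] have fin: "emeasure (lborel \<Otimes>\<^sub>M lborel) ({0..1::real} \<times> ?B) < \<infinity>"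
    by (subst lborel.emeasure_pair_measure_Times) (auto simp: ennreal_mult_less_top)
  have Hint: "integrable (lborel \<Otimes>\<^sub>M lborel) (case_prod H)"
  proof (rule integrableI_bounded_set[OF _ meas fin, where B = 1])
    show "AE x in lborel \<Otimes>\<^sub>M lborel. x \<in> {0..1} \<times> ?B \<longrightarrow> norm (case_prod H x) \<le> 1"
      using bd by (auto simp: H_def indicator_def)
    show "AE x in lborel \<Otimes>\<^sub>M lborel. x \<notin> {0..1} \<times> ?B \<longrightarrow> case_prod H x = 0"
      using out by (intro AE_I2) (force simp: H_def indicator_def)
  qed auto
  have "(LINT x|lborel. F x) = (LINT t|lborel. LINT x|lborel. H t x)"
  proof -
    \<comment> \<open>By translation invariance every t in [0, 1] gives the same integral, so
      averaging over t changes nothing.\<close>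
    have "(LINT x|lborel. H t x) = indicat_real {0..1} t *\<^sub>R (LINT x|lborel. F x)" for t
    proof -
      have "(LINT x|lborel. F x) = (LINT x|distr lborel borel ((+) (t *\<^sub>R u)). F x)"
        by (simp add: lborel_distr_plus)
      also have "\<dots> = (LINT x|lborel. F (t *\<^sub>R u + x))" by (subst integral_distr) auto
      finally show ?thesis by (simp add: H_def add.commute)
    qed
    then show ?thesis by simp
  qed
  also have "\<dots> = (LINT x|lborel. LINT t|lborel. H t x)"
    by (rule lborel_pair.Fubini_integral[OF Hint, symmetric])
  also have "cmod \<dots> \<le> (LINT x|lborel. M * indicat_real ?B x)"
  proof (rule Bochner_Integration.integral_norm_bound_integral)
    show "integrable lborel (\<lambda>x. LINT t|lborel. H t x)"
      using lborel_pair.integrable_snd[OF Hint] by simp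
    show "integrable lborel (\<lambda>x. M * indicat_real ?B x)"
      by (intro integrable_mult_right integrable_real_indicator) (use finB in auto)
    show "cmod (LINT t|lborel. H t x) \<le> M * indicat_real ?B x" for x
    proof (cases "x \<in> ?B")
      case True
      then show ?thesis using M[of x] by (simp add: set_lebesgue_integral_def H_def)
    next
      case False
      then show ?thesis using out[OF False] by (simp del: mem_ball)
    qed
  qed
  also have "\<dots> = M * measure lborel ?B" by simp
  finally show ?thesis .
qed

section \<open>Decay uniform in the direction of the frequency\<close>

lemma span_UNIV_imp_inner_nonzero:
  fixes w :: "'a::euclidean_space"
  assumes "span S = UNIV" "w \<noteq> 0"
  obtains v where "v \<in> S" "w \<bullet> v \<noteq> 0"
proof (rule ccontr)
  assume "\<not> thesis"
  then have "\<And>v. v \<in> S \<Longrightarrow> orthogonal w v" using that by (auto simp: orthogonal_def)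
  moreover have "w \<in> span S" using assms by simp
  ultimately have "orthogonal w w" using orthogonal_to_span by blast
  then show False using assms(2) by (simp add: orthogonal_def)
qed

lemma ball_fourier_decay:
  fixes f :: "real ^ 'd::finite \<Rightarrow> real ^ 'm::finite"
  assumes f: "C_k_on k f U" "open U" "cball x0 r \<subseteq> U" "2 \<le> k" "1 \<le> j" "j \<le> k" and "\<Lambda> > 0" "K \<ge> 0"
    and low: "(\<forall>x\<in>cball x0 r. \<Lambda> \<le> w \<bullet> directional_derivative j u f x) \<or>
              (\<forall>x\<in>cball x0 r. w \<bullet> directional_derivative j u f x \<le> - \<Lambda>)"
    and up: "\<And>x. x \<in> cball x0 r \<Longrightarrow> \<bar>w \<bullet> directional_derivative 2 u f x\<bar> \<le> K * \<Lambda>"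
  shows "cmod (LINT x:ball x0 r|lborel. cis (w \<bullet> f x))
           \<le> (2 + K + vdc_const j) * \<Lambda> powr - (1 / real j) * measure lborel (ball x0 (r + norm u))"
proof -
  define F where "F x = indicat_real (ball x0 r) x *\<^sub>R cis (w \<bullet> f x)" for x
  have "continuous_on (ball x0 r) (\<lambda>x. cis (w \<bullet> f x))"
    unfolding cis_conv_exp using f(3) ball_subset_cball
    by (intro continuous_intros continuous_on_subset[OF C_k_on_imp_continuous_on[OF f(1)]]) blast
  from borel_measurable_continuous_on_indicator[OF _ this]
  have "F \<in> borel_measurable borel" by (simp add: F_def[abs_def])
  then have "cmod (LINT x|lborel. F x) \<le> (2 + K + vdc_const j) * \<Lambda> powr - (1 / real j) * measure lborel (ball x0 (r + norm u))"
  proof (rule norm_integral_le_line_integrals)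
    show "0 \<le> (2 + K + vdc_const j) * \<Lambda> powr - (1 / real j)"
      using \<open>K \<ge> 0\<close> vdc_const_nonneg[of j] by (intro mult_nonneg_nonneg) auto
    show "cmod (LINT t:{0..1}|lborel. F (x + t *\<^sub>R u)) \<le> (2 + K + vdc_const j) * \<Lambda> powr - (1 / real j)" for x
      unfolding F_def by (rule line_oscillatory_integral_bound[OF assms])
  qed (auto simp: F_def indicator_def)
  then show ?thesis by (simp add: F_def set_lebesgue_integral_def)
qed

text \<open>Since the derivatives span, one of them is not orthogonal to \<open>w0\<close>, and
  hence some directional derivative of the same order is not. By continuity the lower bound persists
  for nearby points and nearby unit vectors. The claim covers every radius up to \<open>r0\<close>,
  so that finitely many directions can later share one ball.\<close>

lemma fourier_decay_near_direction:
  fixes f :: "real ^ 'd::finite \<Rightarrow> real ^ 'm::finite"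
  assumes f: "C_k_on k f U" "open U" "x0 \<in> U" "2 \<le> k" "l \<le> k"
    and span: "span {iterated_partial js f x0 | js. 1 \<le> length js \<and> length js \<le> l} = UNIV"
    and w0: "norm w0 = 1"
  shows "\<exists>e>0. \<exists>r0>0. \<exists>C\<ge>0. \<forall>r w. 0 < r \<longrightarrow> r \<le> r0 \<longrightarrow> 1 \<le> norm w \<longrightarrow> w /\<^sub>R norm w \<in> ball w0 e \<longrightarrow>
           cmod (LINT x:ball x0 r|lborel. cis (w \<bullet> f x)) \<le> C * norm w powr - (1 / real l)"
proof -
  obtain js where js: "1 \<le> length js" "length js \<le> l" "w0 \<bullet> iterated_partial js f x0 \<noteq> 0"
  proof -
    have "w0 \<noteq> 0" using w0 by auto
    then obtain v where "v \<in> {iterated_partial js f x0 | js. 1 \<le> length js \<and> length js \<le> l}" "w0 \<bullet> v \<noteq> 0"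
      using span_UNIV_imp_inner_nonzero[OF span] by blast
    then show thesis using that by blast
  qed
  define j where "j = length js"
  have j: "1 \<le> j" "j \<le> l" "j \<le> k" using js f(5) by (auto simp: j_def)
  obtain u where u: "w0 \<bullet> directional_derivative j u f x0 \<noteq> 0"
    using directional_derivative_nonzero[OF f(1-3) _ js(3)] j by (auto simp: j_def)
  define D where "D = directional_derivative j u f"
  define D2 where "D2 = directional_derivative 2 u f"
  have cont: "continuous_on U D" "continuous_on U D2"
    using f j by (auto simp: D_def D2_def intro: continuous_on_directional_derivative)
  \<comment> \<open>A deviation of at most c preserves the sign and leaves modulus at least c. Half
    of it is allotted to the change of the point, by \<open>r2\<close>, and half to the change of
    direction, by \<open>e\<close>.\<close>
  define c where "c = \<bar>w0 \<bullet> D x0\<bar> / 2"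
  have c: "c > 0" using u by (simp add: c_def D_def)
  obtain r1 where r1: "r1 > 0" "cball x0 r1 \<subseteq> U" using f(2,3) open_contains_cball by blast
  have "isCont D x0" using cont(1) f(2,3) by (simp add: continuous_on_eq_continuous_at)
  then obtain r2 where r2: "r2 > 0" "\<And>x. dist x x0 < r2 \<Longrightarrow> dist (D x) (D x0) < c / 2"
    using c unfolding continuous_at_eps_delta by (meson half_gt_zero)
  define r0 where "r0 = min r1 (r2 / 2)"
  have r0: "r0 > 0" "r0 \<le> r1" "r0 < r2" using r1 r2 by (auto simp: r0_def)
  define e where "e = c / (2 * (norm (D x0) + c))"
  have e: "e > 0" "e * (norm (D x0) + c) = c / 2" 
  proof -
    have "norm (D x0) + c > 0" using c by (simp add: add_nonneg_pos)
    moreover have "c / (2 * y) * y = c / 2" if "y > 0" for y using that by simp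
    ultimately show "e * (norm (D x0) + c) = c / 2" unfolding e_def by blast
    show "e > 0" using c \<open>norm (D x0) + c > 0\<close> unfolding e_def by (intro divide_pos_pos mult_pos_pos) auto
  qed
  have "bounded (D2 ` cball x0 r1)"
    by (rule compact_imp_bounded[OF compact_continuous_image[OF continuous_on_subset[OF cont(2) r1(2)]]]) simp
  then obtain K' where K': "K' > 0" "\<And>x. x \<in> cball x0 r1 \<Longrightarrow> norm (D2 x) \<le> K'"
    unfolding bounded_pos by auto
  define K where "K = K' / c"
  have close: "\<bar>v \<bullet> D x - w0 \<bullet> D x0\<bar> \<le> c" if v: "v \<in> ball w0 e" "norm v = 1" and x: "x \<in> cball x0 r0" for v x
  proof -
    have dx: "norm (D x - D x0) < c / 2"
    proof -
      have "dist x x0 < r2" using x r0 by (simp add: dist_commute)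
      then show ?thesis using r2(2) by (simp add: dist_norm)
    qed
    have "v \<bullet> D x - w0 \<bullet> D x0 = v \<bullet> (D x - D x0) + (v - w0) \<bullet> D x0"
      by (simp add: inner_diff_left inner_diff_right)
    then have "\<bar>v \<bullet> D x - w0 \<bullet> D x0\<bar> \<le> \<bar>v \<bullet> (D x - D x0)\<bar> + \<bar>(v - w0) \<bullet> D x0\<bar>" by simp
    also have "\<dots> \<le> norm v * norm (D x - D x0) + norm (v - w0) * norm (D x0)"
      by (intro add_mono Cauchy_Schwarz_ineq2)
    also have "\<dots> \<le> 1 * (c / 2) + e * (norm (D x0) + c)"
      using v dx c e(1) by (intro add_mono mult_mono) (auto simp: dist_norm norm_minus_commute)
    also have "\<dots> = c" unfolding e(2) by simp
    finally show ?thesis .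
  qed
  define C where "C = (2 + K + vdc_const j) * c powr - (1 / real j) * measure lborel (ball x0 (r0 + norm u))"
  have K0: "K \<ge> 0" using K' c by (simp add: K_def)
  have C0: "C \<ge> 0" using K0 vdc_const_nonneg[of j] by (auto simp: C_def intro!: mult_nonneg_nonneg)
  have "cmod (LINT x:ball x0 r|lborel. cis (w \<bullet> f x)) \<le> C * norm w powr - (1 / real l)"
    if r: "0 < r" "r \<le> r0" and w: "1 \<le> norm w" "w /\<^sub>R norm w \<in> ball w0 e" for r w
  proof -
    define v where "v = w /\<^sub>R norm w"
    have "norm w \<noteq> 0" using w(1) by linarith
    then have v: "v \<in> ball w0 e" "norm v = 1" "norm w *\<^sub>R v = w"
      using w(2) by (simp_all add: v_def del: mem_ball)
    have sub: "cball x0 r \<subseteq> cball x0 r0" using r by auto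
    have wD: "w \<bullet> D x = norm w * (v \<bullet> D x)" for x
      using arg_cong[OF v(3), of "\<lambda>y. y \<bullet> D x"] by (simp only: inner_scaleR_left)
    have "cmod (LINT x:ball x0 r|lborel. cis (w \<bullet> f x))
         \<le> (2 + K + vdc_const j) * (c * norm w) powr - (1 / real j) * measure lborel (ball x0 (r + norm u))"
    proof (rule ball_fourier_decay[OF f(1,2) _ f(4) j(1,3)])
      show "cball x0 r \<subseteq> U" using sub r1 r0 by (meson order_trans subset_cball)
      show "0 < c * norm w" using c w by (intro mult_pos_pos) auto
      show "(\<forall>x\<in>cball x0 r. c * norm w \<le> w \<bullet> directional_derivative j u f x) \<or>
          (\<forall>x\<in>cball x0 r. w \<bullet> directional_derivative j u f x \<le> - (c * norm w))"
      proof (cases "w0 \<bullet> D x0 > 0")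
        case True
        have "c \<le> v \<bullet> D x" if "x \<in> cball x0 r" for x
          using close[OF v(1,2), of x] that sub True by (auto simp: c_def abs_if split: if_splits)
        then have "norm w * c \<le> w \<bullet> D x" if "x \<in> cball x0 r" for x
          unfolding wD using that by (intro mult_left_mono) auto
        then show ?thesis by (simp add: D_def mult.commute)
      next
        case False
        have "v \<bullet> D x \<le> - c" if "x \<in> cball x0 r" for x
          using close[OF v(1,2), of x] that sub False by (auto simp: c_def abs_if split: if_splits)
        then have "w \<bullet> D x \<le> norm w * (- c)" if "x \<in> cball x0 r" for x
          unfolding wD using that by (intro mult_left_mono) auto
        then show ?thesis by (simp add: D_def mult.commute)
      qed
      show "\<bar>w \<bullet> directional_derivative 2 u f x\<bar> \<le> K * (c * norm w)" if "x \<in> cball x0 r" for x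
      proof -
        have "x \<in> cball x0 r1" using that sub r0 by auto
        then have "\<bar>w \<bullet> D2 x\<bar> \<le> norm w * K'"
          using Cauchy_Schwarz_ineq2[of w "D2 x"] K'(2) by (meson mult_left_mono norm_ge_zero order_trans)
        then show ?thesis using c by (simp add: K_def D2_def mult.commute)
      qed
    qed (rule K0)
    also have "\<dots> \<le> (2 + K + vdc_const j) * (c * norm w) powr - (1 / real j) * measure lborel (ball x0 (r0 + norm u))"
      using K0 vdc_const_nonneg[of j] r
      by (intro mult_left_mono measure_mono_fmeasurable mult_nonneg_nonneg fmeasurableI emeasure_lborel_ball_finite) auto
    also have "\<dots> = C * norm w powr - (1 / real j)"
      unfolding C_def powr_mult by (simp only: mult_ac)
    also have "\<dots> \<le> C * norm w powr - (1 / real l)"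
      using C0 w j by (intro mult_left_mono powr_mono) (auto simp: frac_le)
    finally show ?thesis .
  qed
  then show ?thesis using e(1) r0(1) C0 by blast
qed

text \<open>Finitely many of the neighbourhoods of directions cover the unit sphere; the least of
  their radii and the sum of their constants work for every frequency.\<close>

proposition fourier_decay_of_nondegenerate:
  fixes f :: "real ^ 'd::finite \<Rightarrow> real ^ 'm::finite"
  assumes f: "C_k_on k f U" "open U" "x0 \<in> U" "2 \<le> k" "l \<le> k"
    and span: "span {iterated_partial js f x0 | js. 1 \<le> length js \<and> length js \<le> l} = UNIV"
  obtains r C where "r > 0" "C \<ge> 0" "cball x0 r \<subseteq> U"
    "\<And>w. 1 \<le> norm w \<Longrightarrow> cmod (LINT x:ball x0 r|lborel. cis (w \<bullet> f x)) \<le> C * norm w powr - (1 / real l)"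
proof -
  define P where "P w0 e r0 C \<longleftrightarrow> 0 < e \<and> 0 < r0 \<and> 0 \<le> C \<and>
       (\<forall>r w. 0 < r \<longrightarrow> r \<le> r0 \<longrightarrow> 1 \<le> norm w \<longrightarrow> w /\<^sub>R norm w \<in> ball w0 e \<longrightarrow>
           cmod (LINT x:ball x0 r|lborel. cis (w \<bullet> f x)) \<le> C * norm w powr - (1 / real l))" for w0 e r0 C
  have "\<exists>e r0 C. P w0 e r0 C" if "norm w0 = 1" for w0
    using fourier_decay_near_direction[OF assms that] unfolding P_def by auto
  then obtain e r0 C where P: "\<And>w0. norm w0 = 1 \<Longrightarrow> P w0 (e w0) (r0 w0) (C w0)" by metis
  then have *: "\<And>w0. norm w0 = 1 \<Longrightarrow> e w0 > 0" "\<And>w0. norm w0 = 1 \<Longrightarrow> r0 w0 > 0" "\<And>w0. norm w0 = 1 \<Longrightarrow> C w0 \<ge> 0"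
    by (simp_all add: P_def)
  have "compact (sphere 0 1 :: (real ^ 'm) set)" by simp
  then obtain W where W: "W \<subseteq> sphere 0 1" "finite W" "sphere 0 1 \<subseteq> (\<Union>w0\<in>W. ball w0 (e w0))"
    using *(1) by (elim compactE_image[where C = "sphere 0 1" and f = "\<lambda>w0. ball w0 (e w0)"]) auto
  obtain r1 where r1: "r1 > 0" "cball x0 r1 \<subseteq> U" using f(2,3) open_contains_cball by blast
  define r where "r = Min (insert r1 (r0 ` W))"
  have r: "r > 0" "r \<le> r1" "\<And>w0. w0 \<in> W \<Longrightarrow> r \<le> r0 w0"
    using W *(2) r1 by (auto simp: r_def subset_iff)
  have "cmod (LINT x:ball x0 r|lborel. cis (w \<bullet> f x)) \<le> (\<Sum>w0\<in>W. C w0) * norm w powr - (1 / real l)" if w: "1 \<le> norm w" for w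
  proof -
    have "norm w \<noteq> 0" using w by linarith
    then have "norm (w /\<^sub>R norm w) = 1" by simp
    then have "w /\<^sub>R norm w \<in> sphere 0 1" by simp
    then obtain w0 where w0: "w0 \<in> W" "w /\<^sub>R norm w \<in> ball w0 (e w0)" using W(3) by blast
    have n: "norm w0 = 1" using w0(1) W(1) by auto
    have "cmod (LINT x:ball x0 r|lborel. cis (w \<bullet> f x)) \<le> C w0 * norm w powr - (1 / real l)"
      using P[OF n] r(1) r(3)[OF w0(1)] w w0(2) unfolding P_def by blast
    also have "C w0 \<le> (\<Sum>w0\<in>W. C w0)"
      using W w0 *(3) by (intro member_le_sum) auto
    finally show ?thesis by (simp add: mult_right_mono)
  qed
  moreover have "(\<Sum>w0\<in>W. C w0) \<ge> 0" using W *(3) by (intro sum_nonneg) auto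
  moreover have "cball x0 r \<subseteq> U" using r(2) r1(2) by (meson order_trans subset_cball)
  ultimately show thesis using that r(1) by blast
qed

section \<open>Order of nondegeneracy at almost every point\<close>

lemma negligible_locallyI:
  assumes "\<And>x. x \<in> S \<Longrightarrow> \<exists>r>0. negligible (S \<inter> ball x r)"
  shows "negligible S"
proof (rule locally_negligible_alt[THEN iffD2], rule ballI)
  fix x assume x: "x \<in> S"
  then obtain r where "r > 0" "negligible (S \<inter> ball x r)" using assms by blast
  then show "\<exists>U. openin (top_of_set S) U \<and> x \<in> U \<and> negligible U"
    using x openin_open_Int[OF open_ball, of S x r] by (intro exI[of _ "S \<inter> ball x r"] conjI) simp_all
qed

definition accumulates :: "'a::real_normed_vector \<Rightarrow> 'a \<Rightarrow> 'a set \<Rightarrow> bool" where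
  "accumulates e x E \<longleftrightarrow> (\<forall>\<delta>>0. \<exists>t. 0 < \<bar>t\<bar> \<and> \<bar>t\<bar> < \<delta> \<and> x + t *\<^sub>R e \<in> E)"

text \<open>The points of \<open>E\<close> with no other point of \<open>E\<close> on the segment of length \<open>O(1/n)\<close>
  in direction \<open>e\<close> have infinitely many disjoint translates inside a bounded set.\<close>

lemma negligible_not_accumulates:
  fixes E :: "'a::euclidean_space set"
  assumes "closed E" "e \<noteq> 0"
  shows "negligible {x \<in> E. \<not> accumulates e x E}"
proof -
  define A where "A n = {x \<in> E. \<forall>t. 0 < \<bar>t\<bar> \<and> \<bar>t\<bar> < 1 / real (Suc n) \<longrightarrow> x + t *\<^sub>R e \<notin> E}" for n
  have meas: "A n \<in> sets borel" for n
  proof -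
    \<comment> \<open>The compact sets \<open>T p\<close> exhaust the parameters with 0 < |t| <
      1/(n+1). The sum of a closed and a compact set is closed, so \<open>A n\<close> is the closed
      set E minus a countable union of closed sets.\<close>
    define T where "T p = {t::real. 1 / real (Suc p) \<le> \<bar>t\<bar>} \<inter> cball 0 (1 / real (Suc n) - 1 / real (Suc p))" for p
    have "closed {t::real. 1 / real (Suc p) \<le> \<bar>t\<bar>}" for p by (intro closed_Collect_le continuous_intros)
    then have "compact (T p)" for p unfolding T_def by (intro closed_Int_compact compact_cball) 
    then have cT: "compact ((\<lambda>t. - t *\<^sub>R e) ` T p)" for p by (intro compact_continuous_image continuous_intros)
    have cl: "closed (\<Union>y\<in>E. \<Union>z\<in>(\<lambda>t. - t *\<^sub>R e) ` T p. {y + z})" for p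
      by (rule closed_compact_sums[OF \<open>closed E\<close> cT])
    have "A n = E - (\<Union>p. \<Union>y\<in>E. \<Union>z\<in>(\<lambda>t. - t *\<^sub>R e) ` T p. {y + z})"
    proof (intro set_eqI iffI)
      fix x assume x: "x \<in> A n"
      have "y + - t *\<^sub>R e \<noteq> x" if "y \<in> E" "t \<in> T p" for y t p
      proof
        assume "y + - t *\<^sub>R e = x"
        then have "x + t *\<^sub>R e \<in> E" using that by auto
        moreover have "0 < 1 / real (Suc p)" by simp
        then have "0 < \<bar>t\<bar>" "\<bar>t\<bar> < 1 / real (Suc n)" using that(2) unfolding T_def mem_cball dist_norm real_norm_def mem_Collect_eq Int_iff by linarith+
        ultimately show False using x by (auto simp: A_def)
      qed
      then show "x \<in> E - (\<Union>p. \<Union>y\<in>E. \<Union>z\<in>(\<lambda>t. - t *\<^sub>R e) ` T p. {y + z})"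
        using x unfolding A_def by blast
    next
      fix x assume x: "x \<in> E - (\<Union>p. \<Union>y\<in>E. \<Union>z\<in>(\<lambda>t. - t *\<^sub>R e) ` T p. {y + z})"
      have "x + t *\<^sub>R e \<notin> E" if t: "0 < \<bar>t\<bar>" "\<bar>t\<bar> < 1 / real (Suc n)" for t
      proof
        assume E: "x + t *\<^sub>R e \<in> E"
        have "0 < min \<bar>t\<bar> (1 / real (Suc n) - \<bar>t\<bar>)" using t by simp
        then obtain p where "1 / real (Suc p) < min \<bar>t\<bar> (1 / real (Suc n) - \<bar>t\<bar>)"
          using nat_approx_posE by blast
        then have "t \<in> T p" by (simp add: T_def)
        moreover have "x = (x + t *\<^sub>R e) + - t *\<^sub>R e" by simp
        ultimately show False using x E by blast
      qed
      then show "x \<in> A n" using x by (simp add: A_def)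
    qed
    then show ?thesis using cl \<open>closed E\<close> by auto
  qed
  have negl: "negligible (A n \<inter> cball 0 (real R))" for n R
  proof -
    define D where "D = A n \<inter> cball 0 (real R)"
    have D: "D \<in> lmeasurable"
      unfolding D_def using meas[of n] by (intro bounded_set_imp_lmeasurable) (auto simp: bounded_Int)
    define \<eta> where "\<eta> = 1 / (2 * real (Suc n))"
    have \<eta>2: "1 / real (Suc n) = \<eta> + \<eta>" by (simp add: \<eta>_def field_simps)
    \<comment> \<open>These are distinct numbers in (0, \<eta>], so any two differ by less than 2
      \<eta> = 1/(n+1). By the defining property of \<open>A n\<close> the corresponding translates
      of \<open>D\<close> are disjoint.\<close>
    define s where "s j = 1 / (2 * real (Suc n) * real (Suc j))" for j :: nat
    define F where "F j = (\<lambda>x. s j *\<^sub>R e + x) ` D" for j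
    have s: "0 < s j" "s j \<le> \<eta>" "s j \<le> 1" for j
    proof -
      show "0 < s j" by (simp add: s_def)
      show "s j \<le> \<eta>" unfolding s_def \<eta>_def by (intro divide_left_mono) auto
      also have "\<dots> \<le> 1" by (simp add: \<eta>_def)
      finally show "s j \<le> 1" .
    qed
    have inj: "s i \<noteq> s j" if "i \<noteq> j" for i j using that by (simp add: s_def)
    have disj: "disjnt (F i) (F j)" if "i \<noteq> j" for i j
      unfolding disjnt_iff
    proof (intro allI notI)
      fix x assume "x \<in> F i \<and> x \<in> F j"
      then obtain y z where yz: "y \<in> D" "z \<in> D" "s i *\<^sub>R e + y = s j *\<^sub>R e + z" by (auto simp: F_def)
      then have "y + (s i - s j) *\<^sub>R e = z" by (simp add: algebra_simps)
      then have "y + (s i - s j) *\<^sub>R e \<in> E" using yz(2) by (simp add: D_def A_def)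
      moreover have "\<bar>s i - s j\<bar> < \<eta> + \<eta>" using s[of i] s[of j] by linarith
      then have "\<bar>s i - s j\<bar> < 1 / real (Suc n)" by (simp only: \<eta>2)
      moreover have "0 < \<bar>s i - s j\<bar>" using inj[OF that] by simp
      ultimately show False using yz(1) by (auto simp: D_def A_def)
    qed
    have Fm: "F j \<in> lmeasurable" "measure lebesgue (F j) = measure lebesgue D" for j
      unfolding F_def using D by (auto simp: measurable_translation measure_translation)
    have bound: "real N * measure lebesgue D \<le> measure lebesgue (cball (0::'a) (real R + norm e))" for N :: nat
    proof -
      have "real N * measure lebesgue D = (\<Sum>j<N. measure lebesgue (F j))" by (simp add: Fm)
      also have "\<dots> = measure lebesgue (\<Union>j<N. F j)"
        using Fm disj by (intro measure_UNION'[symmetric]) (auto simp: pairwise_def)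
      also have "\<dots> \<le> measure lebesgue (cball (0::'a) (real R + norm e))"
      proof (intro measure_mono_fmeasurable)
        show "(\<Union>j<N. F j) \<subseteq> cball 0 (real R + norm e)"
        proof clarify
          fix x j assume "x \<in> F j"
          then obtain y where y: "y \<in> D" "x = s j *\<^sub>R e + y" by (auto simp: F_def)
          have "norm x \<le> norm (s j *\<^sub>R e) + norm y" unfolding y(2) by (rule norm_triangle_ineq)
          also have "\<dots> \<le> 1 * norm e + real R"
            using y(1) s[of j] by (intro add_mono) (auto simp: D_def mult_left_le_one_le)
          finally show "x \<in> cball 0 (real R + norm e)" by simp
        qed
        show "(\<Union>j<N. F j) \<in> sets lebesgue" using Fm by (intro sets.finite_UN fmeasurableD) auto
      qed auto
      finally show ?thesis .
    qed
    have "\<not> 0 < measure lebesgue D"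
    proof
      assume "0 < measure lebesgue D"
      then obtain N :: nat where "measure lebesgue (cball (0::'a) (real R + norm e)) < real N * measure lebesgue D"
        using reals_Archimedean3 by blast
      with bound[of N] show False by linarith
    qed
    then have "measure lebesgue D = 0" using measure_nonneg[of lebesgue D] by linarith
    then show ?thesis using D unfolding D_def negligible_iff_measure by simp
  qed
  have "{x \<in> E. \<not> accumulates e x E} \<subseteq> (\<Union>n. \<Union>R. A n \<inter> cball 0 (real R))"
  proof
    fix x assume "x \<in> {x \<in> E. \<not> accumulates e x E}"
    then obtain \<delta> where x: "x \<in> E" and \<delta>: "\<delta> > 0" "\<And>t. 0 < \<bar>t\<bar> \<Longrightarrow> \<bar>t\<bar> < \<delta> \<Longrightarrow> x + t *\<^sub>R e \<notin> E"
      unfolding accumulates_def by blast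
    obtain n where "1 / real (Suc n) < \<delta>" using \<delta>(1) nat_approx_posE by blast
    then have "x \<in> A n" using x \<delta>(2) by (auto simp: A_def)
    moreover obtain R where "norm x \<le> real R" using real_arch_simple by blast
    ultimately show "x \<in> (\<Union>n. \<Union>R. A n \<inter> cball 0 (real R))" by auto
  qed
  moreover have "negligible (\<Union>n. \<Union>R. A n \<inter> cball 0 (real R))"
    by (intro negligible_Union_nat) (intro negl)
  ultimately show ?thesis by (rule negligible_subset[rotated])
qed

lemma negligible_not_accumulates_relatively_closed:
  fixes E :: "'a::euclidean_space set"
  assumes "open N" "closedin (top_of_set N) E" "e \<noteq> 0"
  shows "negligible {x \<in> E. \<not> accumulates e x E}"
proof (rule negligible_locallyI)
  fix x assume "x \<in> {x \<in> E. \<not> accumulates e x E}"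
  then have "x \<in> N" using assms(2) closedin_subset by fastforce
  then obtain r where r: "r > 0" "cball x r \<subseteq> N" using assms(1) open_contains_cball by blast
  obtain T where T: "closed T" "E = N \<inter> T" using assms(2) by (auto simp: closedin_closed)
  have "cball x r \<inter> E = cball x r \<inter> T" using r T by auto
  then have "closed (cball x r \<inter> E)" using T by (simp add: closed_Int)
  then have "negligible {y \<in> cball x r \<inter> E. \<not> accumulates e y (cball x r \<inter> E)}"
    using assms(3) by (rule negligible_not_accumulates)
  moreover have "{x \<in> E. \<not> accumulates e x E} \<inter> ball x r \<subseteq> {y \<in> cball x r \<inter> E. \<not> accumulates e y (cball x r \<inter> E)}"
  proof -
    have "accumulates e y E" if "accumulates e y (cball x r \<inter> E)" for y
      using that unfolding accumulates_def by blast
    then show ?thesis by auto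
  qed
  ultimately show "\<exists>r>0. negligible ({x \<in> E. \<not> accumulates e x E} \<inter> ball x r)"
    using r(1) negligible_subset by blast
qed

section \<open>Quantitative linear independence\<close>

text \<open>With a fixed positive constant, independence passes to limits, which plain independence
  does not. The constants 1/(n+1) exhaust all independent finite families, so countably many
  relatively closed conditions suffice.\<close>

definition uniformly_independent :: "real \<Rightarrow> 'i set \<Rightarrow> ('i \<Rightarrow> 'a::real_normed_vector) \<Rightarrow> bool" where
  "uniformly_independent \<delta> B b \<longleftrightarrow> (\<forall>c. \<delta> * (\<Sum>i\<in>B. \<bar>c i\<bar>) \<le> norm (\<Sum>i\<in>B. c i *\<^sub>R b i))"

text \<open>The coefficients are values of linear functionals dual to the family, and linear
  functionals in finite dimension are bounded.\<close>

lemma uniformly_independentI: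
  fixes b :: "'i \<Rightarrow> 'a::euclidean_space"
  assumes "finite B" "inj_on b B" "independent (b ` B)"
  obtains \<delta> where "\<delta> > 0" "uniformly_independent \<delta> B b"
proof -
  define P where "P i g \<longleftrightarrow> linear g \<and> (\<forall>v\<in>b ` B. g v = (if v = b i then 1 else 0::real))" for i g
  have "\<exists>g. P i g" for i
    unfolding P_def by (rule linear_independent_extend[OF assms(3)])
  then obtain g where "\<And>i. P i (g i)" by metis
  then have g: "\<And>i. linear (g i)" "\<And>i v. v \<in> b ` B \<Longrightarrow> g i v = (if v = b i then 1 else 0::real)"
    unfolding P_def by blast+
  have coef: "g i (\<Sum>j\<in>B. c j *\<^sub>R b j) = c i" if "i \<in> B" for i and c :: "'i \<Rightarrow> real"
  proof -
    have "g i (\<Sum>j\<in>B. c j *\<^sub>R b j) = (\<Sum>j\<in>B. c j * (if j = i then 1 else 0))"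
      using g(2) assms(2) that by (simp add: linear_sum[OF g(1)] linear_cmul[OF g(1)] inj_on_eq_iff cong: sum.cong)
    then show ?thesis using that assms(1) by (simp add: if_distrib cong: if_cong)
  qed
  obtain K where K: "\<And>i v. \<bar>g i v\<bar> \<le> K i * norm v" 
  proof -
    have "\<exists>K. \<forall>v. norm (g i v) \<le> K * norm v" for i using linear_bounded[OF g(1)] by simp
    then show thesis using that unfolding real_norm_def by metis
  qed
  define S where "S = 1 + (\<Sum>i\<in>B. \<bar>K i\<bar>)"
  have S: "S > 0" unfolding S_def by (intro add_pos_nonneg sum_nonneg) auto
  have "(1 / S) * (\<Sum>i\<in>B. \<bar>c i\<bar>) \<le> norm (\<Sum>i\<in>B. c i *\<^sub>R b i)" for c
  proof -
    let ?v = "\<Sum>i\<in>B. c i *\<^sub>R b i"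
    have "(\<Sum>i\<in>B. \<bar>c i\<bar>) \<le> (\<Sum>i\<in>B. \<bar>K i\<bar> * norm ?v)"
    proof (rule sum_mono)
      fix i assume "i \<in> B"
      then have "\<bar>c i\<bar> \<le> K i * norm ?v" using K[of i ?v] coef[of i c] by simp
      also have "\<dots> \<le> \<bar>K i\<bar> * norm ?v" by (intro mult_right_mono) auto
      finally show "\<bar>c i\<bar> \<le> \<bar>K i\<bar> * norm ?v" .
    qed
    also have "\<dots> \<le> S * norm ?v" by (simp add: S_def sum_distrib_right[symmetric] distrib_right)
    finally show ?thesis using S by (simp add: field_simps)
  qed
  then show thesis using that[of "1 / S"] S by (auto simp: uniformly_independent_def)
qed

lemma uniformly_independent_imp_independent:
  fixes b :: "'i \<Rightarrow> 'a::real_normed_vector"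
  assumes "finite B" "\<delta> > 0" "uniformly_independent \<delta> B b"
  shows "inj_on b B" "independent (b ` B)"
proof -
  have zero: "c i = 0" if "(\<Sum>i\<in>B. c i *\<^sub>R b i) = 0" "i \<in> B" for c i
  proof -
    have "\<delta> * (\<Sum>i\<in>B. \<bar>c i\<bar>) \<le> 0" using assms(3)[unfolded uniformly_independent_def, rule_format, of c] unfolding that(1) by simp
    then have "(\<Sum>i\<in>B. \<bar>c i\<bar>) \<le> 0" using assms(2) by (simp add: mult_le_0_iff)
    then have "(\<Sum>i\<in>B. \<bar>c i\<bar>) = 0" by (intro antisym sum_nonneg) auto
    then show ?thesis using that(2) assms(1) by (simp add: sum_nonneg_eq_0_iff)
  qed
  show inj: "inj_on b B"
  proof (rule inj_onI, rule ccontr)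
    fix i j assume ij: "i \<in> B" "j \<in> B" "b i = b j" "i \<noteq> j"
    define c where "c k = (if k = i then 1 else 0) - (if k = j then 1 else 0::real)" for k
    have "(\<Sum>k\<in>B. c k *\<^sub>R b k) = (\<Sum>k\<in>B. (if k = i then 1 else 0) *\<^sub>R b k) - (\<Sum>k\<in>B. (if k = j then 1 else 0) *\<^sub>R b k)"
      by (simp add: c_def scaleR_diff_left sum_subtractf)
    also have "\<dots> = 0" using ij assms(1) by (simp add: if_distrib[of "\<lambda>r. r *\<^sub>R _"] cong: if_cong)
    finally have "c i = 0" using zero ij(1) by blast
    then show False using ij(4) by (simp add: c_def)
  qed
  show "independent (b ` B)"
  proof
    assume "dependent (b ` B)"
    then obtain u where u: "\<exists>v\<in>b ` B. u v \<noteq> 0" "(\<Sum>v\<in>b ` B. u v *\<^sub>R v) = 0"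
      using assms(1) by (auto simp: dependent_finite)
    have "(\<Sum>i\<in>B. u (b i) *\<^sub>R b i) = 0" using u(2) inj by (simp add: sum.reindex)
    from zero[OF this] show False using u(1) by auto
  qed
qed

lemma span_imageE:
  assumes "finite B" "v \<in> span (b ` B)"
  obtains c where "v = (\<Sum>i\<in>B. c i *\<^sub>R b i)"
proof -
  let ?S = "range (\<lambda>c. \<Sum>i\<in>B. c i *\<^sub>R b i)"
  have "span (b ` B) \<subseteq> ?S"
  proof (rule span_minimal)
    show "b ` B \<subseteq> ?S"
    proof clarify
      fix i assume i: "i \<in> B"
      have "b i = (\<Sum>j\<in>B. (if j = i then 1 else 0) *\<^sub>R b j)"
        using assms(1) i by (simp add: if_distrib[of "\<lambda>r. r *\<^sub>R _"] cong: if_cong)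
      then show "b i \<in> ?S"
        by (rule range_eqI[where x = "\<lambda>j. if j = i then 1 else 0"])
    qed
    show "subspace (?S)"
    proof (rule subspaceI)
      show "0 \<in> ?S" by (rule range_eqI[of _ _ "\<lambda>_. 0"]) simp
    next
      fix x y assume "x \<in> ?S" "y \<in> ?S"
      then obtain c d where "x = (\<Sum>i\<in>B. c i *\<^sub>R b i)" "y = (\<Sum>i\<in>B. d i *\<^sub>R b i)" by blast
      then have "x + y = (\<Sum>i\<in>B. (c i + d i) *\<^sub>R b i)" by (simp add: scaleR_add_left sum.distrib)
      then show "x + y \<in> ?S" by (rule range_eqI[where x = "\<lambda>i. c i + d i"])
    next
      fix r x assume "x \<in> ?S"
      then obtain c where "x = (\<Sum>i\<in>B. c i *\<^sub>R b i)" by blast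
      then have "r *\<^sub>R x = (\<Sum>i\<in>B. (r * c i) *\<^sub>R b i)" by (simp add: scaleR_sum_right)
      then show "r *\<^sub>R x \<in> ?S" by (rule range_eqI[where x = "\<lambda>i. r * c i"])
    qed
  qed
  then show thesis using assms(2) that by blast
qed

text \<open>Uniform independence bounds the coefficients of \<open>us n\<close>. Replacing
  \<open>bs n\<close> by its limit with the same coefficients therefore costs an error tending to 0,
  so u is a limit of points of the span of b, which is closed.\<close>

lemma span_limit:
  fixes b :: "'i \<Rightarrow> 'a::euclidean_space"
  assumes "finite B" "\<delta> > 0" and ind: "\<And>n. uniformly_independent \<delta> B (bs n)"
    and b: "\<And>i. i \<in> B \<Longrightarrow> (\<lambda>n. bs n i) \<longlonglongrightarrow> b i" and u: "us \<longlonglongrightarrow> u"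
    and span: "\<And>n. us n \<in> span (bs n ` B)"
  shows "u \<in> span (b ` B)"
proof -
  have "\<exists>c. us n = (\<Sum>i\<in>B. c i *\<^sub>R bs n i)" for n
    by (rule span_imageE[OF assms(1) span[of n]]) blast
  then have "\<forall>n. \<exists>c. us n = (\<Sum>i\<in>B. c i *\<^sub>R bs n i)" ..
  from choice[OF this] obtain c where c: "\<And>n. us n = (\<Sum>i\<in>B. c n i *\<^sub>R bs n i)" by blast
  obtain M where M: "\<And>n. norm (us n) \<le> M"
    using convergent_imp_Bseq[OF convergentI[OF u]] unfolding Bseq_def by blast
  have ci: "\<bar>c n i\<bar> \<le> M / \<delta>" if "i \<in> B" for n i
  proof -
    have "\<delta> * (\<Sum>i\<in>B. \<bar>c n i\<bar>) \<le> M"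
      using ind[of n, unfolded uniformly_independent_def, rule_format, of "c n"] M[of n] unfolding c[symmetric] by linarith
    moreover have "\<bar>c n i\<bar> \<le> (\<Sum>i\<in>B. \<bar>c n i\<bar>)" using that assms(1) by (intro member_le_sum) auto
    then have "\<delta> * \<bar>c n i\<bar> \<le> \<delta> * (\<Sum>i\<in>B. \<bar>c n i\<bar>)" using assms(2) by (intro mult_left_mono) auto
    ultimately have "\<delta> * \<bar>c n i\<bar> \<le> M" by linarith
    then show ?thesis using assms(2) by (simp add: field_simps)
  qed
  have "(\<lambda>n. \<Sum>i\<in>B. c n i *\<^sub>R (b i - bs n i)) \<longlonglongrightarrow> (\<Sum>i\<in>B. 0)"
  proof (rule tendsto_sum)
    fix i assume i: "i \<in> B"
    have "(\<lambda>n. (M / \<delta>) * norm (b i - bs n i)) \<longlonglongrightarrow> (M / \<delta>) * norm (b i - b i)"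
      by (intro tendsto_intros b i)
    then have lim0: "(\<lambda>n. (M / \<delta>) * norm (b i - bs n i)) \<longlonglongrightarrow> 0" by simp
    have bd: "norm (c n i *\<^sub>R (b i - bs n i)) \<le> (M / \<delta>) * norm (b i - bs n i)" for n
      unfolding norm_scaleR by (intro mult_right_mono ci[OF i]) simp
    show "(\<lambda>n. c n i *\<^sub>R (b i - bs n i)) \<longlonglongrightarrow> 0"
      by (rule Lim_null_comparison[OF always_eventually[OF allI[OF bd]] lim0])
  qed
  from tendsto_add[OF u this] have "(\<lambda>n. us n + (\<Sum>i\<in>B. c n i *\<^sub>R (b i - bs n i))) \<longlonglongrightarrow> u" by simp
  moreover have "us n + (\<Sum>i\<in>B. c n i *\<^sub>R (b i - bs n i)) = (\<Sum>i\<in>B. c n i *\<^sub>R b i)" for n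
    unfolding scaleR_diff_right sum_subtractf c[symmetric] by simp
  ultimately have lim: "(\<lambda>n. \<Sum>i\<in>B. c n i *\<^sub>R b i) \<longlonglongrightarrow> u" by simp
  show ?thesis
    by (rule closed_sequentially[OF closed_span _ lim]) (intro span_sum span_mul span_base imageI)
qed

lemma uniformly_independent_limit:
  assumes "finite B" and ind: "\<And>n. uniformly_independent \<delta> B (bs n)"
    and b: "\<And>i. i \<in> B \<Longrightarrow> (\<lambda>n. bs n i) \<longlonglongrightarrow> b i"
  shows "uniformly_independent \<delta> B b"
  unfolding uniformly_independent_def
proof
  fix c
  have "(\<lambda>n. norm (\<Sum>i\<in>B. c i *\<^sub>R bs n i)) \<longlonglongrightarrow> norm (\<Sum>i\<in>B. c i *\<^sub>R b i)"
    by (intro tendsto_intros b)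
  then show "\<delta> * (\<Sum>i\<in>B. \<bar>c i\<bar>) \<le> norm (\<Sum>i\<in>B. c i *\<^sub>R b i)"
    by (rule LIMSEQ_le_const) (use ind in \<open>auto simp: uniformly_independent_def\<close>)
qed

lemma uniformly_independent_perturb:
  assumes "finite B" "uniformly_independent \<delta> B b" "\<And>i. i \<in> B \<Longrightarrow> norm (b' i - b i) \<le> \<delta> / 2"
  shows "uniformly_independent (\<delta> / 2) B b'"
  unfolding uniformly_independent_def
proof
  fix c
  have "norm (\<Sum>i\<in>B. c i *\<^sub>R (b' i - b i)) \<le> (\<Sum>i\<in>B. \<bar>c i\<bar> * (\<delta> / 2))"
    by (rule order_trans[OF norm_sum], rule sum_mono) (auto simp only: norm_scaleR intro!: mult_left_mono assms(3) abs_ge_zero)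
  also have "\<dots> = \<delta> / 2 * (\<Sum>i\<in>B. \<bar>c i\<bar>)" by (simp add: sum_distrib_left mult.commute)
  finally have 1: "norm (\<Sum>i\<in>B. c i *\<^sub>R (b' i - b i)) \<le> \<delta> / 2 * (\<Sum>i\<in>B. \<bar>c i\<bar>)" .
  have 2: "\<delta> * (\<Sum>i\<in>B. \<bar>c i\<bar>) \<le> norm (\<Sum>i\<in>B. c i *\<^sub>R b i)" using assms(2) by (simp add: uniformly_independent_def)
  have "(\<Sum>i\<in>B. c i *\<^sub>R b' i) = (\<Sum>i\<in>B. c i *\<^sub>R b i) + (\<Sum>i\<in>B. c i *\<^sub>R (b' i - b i))"
    by (simp add: scaleR_diff_right sum_subtractf)
  then have "norm (\<Sum>i\<in>B. c i *\<^sub>R b i) - norm (\<Sum>i\<in>B. c i *\<^sub>R (b' i - b i)) \<le> norm (\<Sum>i\<in>B. c i *\<^sub>R b' i)"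
    by (metis norm_diff_ineq)
  then show "\<delta> / 2 * (\<Sum>i\<in>B. \<bar>c i\<bar>) \<le> norm (\<Sum>i\<in>B. c i *\<^sub>R b' i)" using 1 2 by linarith
qed

lemma has_vector_derivative_difference_quotient:
  assumes "(\<phi> has_vector_derivative d) (at 0)"
  shows "((\<lambda>h. (\<phi> h - \<phi> 0) /\<^sub>R h) \<longlongrightarrow> d) (at 0)"
proof -
  have "((\<lambda>h. norm (\<phi> (0 + h) - \<phi> 0 - h *\<^sub>R d) / norm h) \<longlongrightarrow> 0) (at 0)"
    using assms unfolding has_vector_derivative_def has_derivative_at by blast
  moreover have "eventually (\<lambda>h. norm (\<phi> (0 + h) - \<phi> 0 - h *\<^sub>R d) / norm h = norm ((\<phi> h - \<phi> 0) /\<^sub>R h - d)) (at 0)"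
  proof (rule eventually_at_topological[THEN iffD2, OF exI[of _ UNIV]], safe)
    fix h :: real assume "h \<noteq> 0"
    then have "(\<phi> h - \<phi> 0) /\<^sub>R h - d = (\<phi> h - \<phi> 0 - h *\<^sub>R d) /\<^sub>R h" by (simp add: scaleR_diff_right)
    then show "norm (\<phi> (0 + h) - \<phi> 0 - h *\<^sub>R d) / norm h = norm ((\<phi> h - \<phi> 0) /\<^sub>R h - d)"
      by (simp add: divide_inverse mult.commute)
  qed simp_all
  ultimately have "((\<lambda>h. norm ((\<phi> h - \<phi> 0) /\<^sub>R h - d)) \<longlongrightarrow> 0) (at 0)"
    by (rule Lim_transform_eventually)
  then have "((\<lambda>h. (\<phi> h - \<phi> 0) /\<^sub>R h - d) \<longlongrightarrow> 0) (at 0)" by (rule tendsto_norm_zero_cancel)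
  then show ?thesis by (rule LIM_zero_cancel)
qed

section \<open>Growth of the span of the derivatives\<close>

definition jet_span :: "nat \<Rightarrow> (real ^ 'd::finite \<Rightarrow> 'b::real_normed_vector) \<Rightarrow> real ^ 'd \<Rightarrow> 'b set" where
  "jet_span j f x = span {iterated_partial js f x | js. 1 \<le> length js \<and> length js \<le> j}"

definition multi_indices :: "nat \<Rightarrow> 'd list set" where
  "multi_indices j = {js. 1 \<le> length js \<and> length js \<le> j}"

lemma finite_multi_indices [simp]: "finite (multi_indices j :: 'd::finite list set)"
  by (rule finite_subset[OF _ finite_lists_length_le[of UNIV j]]) (auto simp: multi_indices_def)

lemma jet_span_eq: "jet_span j f x = span ((\<lambda>js. iterated_partial js f x) ` multi_indices j)"
  unfolding jet_span_def multi_indices_def by (rule arg_cong[of _ _ span]) auto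

lemma jet_span_mono: "i \<le> j \<Longrightarrow> jet_span i f x \<subseteq> jet_span j f x"
  unfolding jet_span_def by (intro span_mono) auto

text \<open>The basis is given by a set of indices rather than of vectors, so that the same set B
  can be tested at neighbouring points.\<close>

lemma jet_span_basis:
  fixes f :: "real ^ 'd::finite \<Rightarrow> 'b::euclidean_space"
  obtains B \<delta> where "B \<subseteq> multi_indices j" "\<delta> > 0" "uniformly_independent \<delta> B (\<lambda>js. iterated_partial js f x)"
    "span ((\<lambda>js. iterated_partial js f x) ` B) = jet_span j f x"
proof -
  let ?D = "\<lambda>js. iterated_partial js f x"
  obtain S where S: "S \<subseteq> ?D ` multi_indices j" "independent S" "?D ` multi_indices j \<subseteq> span S"
    by (rule maximal_independent_subset)
  then obtain B where B: "B \<subseteq> multi_indices j" "inj_on ?D B" "S = ?D ` B"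
    by (auto simp: subset_image_inj)
  have "finite B" using B(1) finite_multi_indices finite_subset by blast
  then obtain \<delta> where "\<delta> > 0" "uniformly_independent \<delta> B ?D"
    using uniformly_independentI[of B ?D] B S(2) by blast
  moreover have "span (?D ` B) = jet_span j f x"
    unfolding jet_span_eq B(3)[symmetric] by (rule antisym[OF span_mono[OF S(1)] span_minimal[OF S(3) subspace_span]])
  ultimately show thesis using that B(1) by blast
qed

text \<open>Almost every point of a set on which the span of the jet does not grow from order \<open>j\<close> to
  order \<open>j + 1\<close> is an accumulation point of that set in every coordinate direction. Differentiating
  along such a direction shows that the span does not grow from order \<open>j + 1\<close> to order \<open>j + 2\<close>.\<close>

lemma jet_span_stationary:
  fixes f :: "real ^ 'd::finite \<Rightarrow> 'b::euclidean_space"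
  assumes f: "C_k_on k f N" "open N" "Suc (Suc j) \<le> k"
  shows "negligible {x \<in> N. jet_span (Suc j) f x = jet_span j f x \<and> jet_span (Suc (Suc j)) f x \<noteq> jet_span (Suc j) f x}"
proof -
  define D where "D x js = iterated_partial js f x" for x js
  \<comment> \<open>At points of \<open>E B n\<close> the derivatives indexed by B form a basis of
    the span up to order j + 1, with independence constant 1/(n+1). For B of order at most j the
    span has stopped growing there. There are finitely many B and countably many n, and each such
    set is relatively closed.\<close>
  define E where "E B n = {x \<in> N. uniformly_independent (1 / real (Suc n)) B (D x) \<and>
      (\<forall>js\<in>multi_indices (Suc j). D x js \<in> span (D x ` B))}" for B n
  have D_lim: "(\<lambda>n. D (xs n) js) \<longlonglongrightarrow> D x js"
    if "xs \<longlonglongrightarrow> x" "\<And>n. xs n \<in> N" "x \<in> N" "js \<in> multi_indices (Suc j)" for xs x js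
  proof -
    have "continuous_on N (\<lambda>x. D x js)"
      unfolding D_def using that(4) f(3) by (intro continuous_on_iterated_partial[OF f(1)]) (simp add: multi_indices_def)
    from continuous_on_tendsto_compose[OF this that(1,3) always_eventually] that(2) show ?thesis by simp
  qed
  have finB: "finite B" if "B \<subseteq> multi_indices j" for B :: "'d list set"
    using that finite_multi_indices finite_subset by blast
  have B_Suc: "B \<subseteq> multi_indices (Suc j)" if "B \<subseteq> multi_indices j" for B :: "'d list set"
    using that by (auto simp: multi_indices_def)
  have closed: "closedin (top_of_set N) (E B n)" if B: "B \<subseteq> multi_indices j" for B n
    unfolding closedin_limpt
  proof (intro conjI allI impI)
    fix x assume x: "x islimpt E B n \<and> x \<in> N"
    then obtain xs where xs: "\<And>i. xs i \<in> E B n" "xs \<longlonglongrightarrow> x"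
      unfolding islimpt_sequential by blast
    have xsN: "\<And>i. xs i \<in> N" using xs(1) by (auto simp: E_def)
    have lim: "(\<lambda>i. D (xs i) js) \<longlonglongrightarrow> D x js" if "js \<in> multi_indices (Suc j)" for js
      using D_lim[OF xs(2) xsN _ that] x by simp
    have ind: "\<And>i. uniformly_independent (1 / real (Suc n)) B (D (xs i))" using xs(1) by (auto simp: E_def)
    have "uniformly_independent (1 / real (Suc n)) B (D x)"
      by (rule uniformly_independent_limit[where bs = "\<lambda>i. D (xs i)", OF finB[OF B] ind])
         (rule lim[OF subsetD[OF B_Suc[OF B]]])
    moreover have "D x js \<in> span (D x ` B)" if "js \<in> multi_indices (Suc j)" for js
    proof (rule span_limit[where bs = "\<lambda>i. D (xs i)", OF finB[OF B] _ ind])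
      show "0 < 1 / real (Suc n)" by simp
      show "(\<lambda>i. D (xs i) \<beta>) \<longlonglongrightarrow> D x \<beta>" if "\<beta> \<in> B" for \<beta>
        by (rule lim[OF subsetD[OF B_Suc[OF B] that]])
      show "(\<lambda>i. D (xs i) js) \<longlonglongrightarrow> D x js" by (rule lim[OF that])
      show "D (xs i) js \<in> span (D (xs i) ` B)" for i using xs(1)[of i] that by (auto simp: E_def)
    qed
    ultimately show "x \<in> E B n" using x by (simp add: E_def)
  qed (auto simp: E_def)
  have step: "jet_span (Suc (Suc j)) f x = jet_span (Suc j) f x"
    if B: "B \<subseteq> multi_indices j" and x: "x \<in> E B n" and acc: "\<And>i. accumulates (axis i 1) x (E B n)" for B n x
  proof -
    have span_eq: "span (D y ` B) = jet_span (Suc j) f y" if "y \<in> E B n" for y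
    proof (rule antisym)
      show "span (D y ` B) \<subseteq> jet_span (Suc j) f y"
        unfolding jet_span_eq D_def using B_Suc[OF B] by (intro span_mono image_mono)
      show "jet_span (Suc j) f y \<subseteq> span (D y ` B)"
        unfolding jet_span_eq using that by (intro span_minimal subspace_span) (auto simp: E_def D_def)
    qed
    have "D x js \<in> jet_span (Suc j) f x" if js: "js \<in> multi_indices (Suc (Suc j))" for js
    proof (cases "length js \<le> Suc j")
      case True
      then have "js \<in> multi_indices (Suc j)" using js by (simp add: multi_indices_def)
      then show ?thesis unfolding jet_span_eq D_def by (intro span_base imageI)
    next
      case False
      then obtain i ks where ks: "js = i # ks" "length ks = Suc j"
        using js by (cases js) (auto simp: multi_indices_def)
      have ksm: "ks \<in> multi_indices (Suc j)" using ks by (simp add: multi_indices_def)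
      then have "D x ks \<in> span (D x ` B)" using x by (simp add: E_def)
      then obtain c where c: "D x ks = (\<Sum>\<beta>\<in>B. c \<beta> *\<^sub>R D x \<beta>)" by (rule span_imageE[OF finB[OF B]])
      have "\<exists>t. 0 < \<bar>t\<bar> \<and> \<bar>t\<bar> < 1 / real (Suc p) \<and> x + t *\<^sub>R axis i 1 \<in> E B n" for p
        using acc[of i] unfolding accumulates_def by simp
      then obtain t where t: "\<And>p. 0 < \<bar>t p\<bar>" "\<And>p. \<bar>t p\<bar> < 1 / real (Suc p)" "\<And>p. x + t p *\<^sub>R axis i 1 \<in> E B n"
        by metis
      define y where "y p = x + t p *\<^sub>R axis i 1" for p
      have t0: "t \<longlonglongrightarrow> 0"
        by (rule Lim_null_comparison[OF _ LIMSEQ_inverse_real_of_nat])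
           (use t(2) in \<open>auto intro!: always_eventually less_imp_le simp: inverse_eq_divide\<close>)
      then have ylim: "y \<longlonglongrightarrow> x" unfolding y_def by (auto intro!: tendsto_eq_intros)
      have yE: "y p \<in> E B n" for p unfolding y_def by (rule t(3))
      have xN: "x \<in> N" using x by (simp add: E_def)
      have quot: "(\<lambda>p. (D (y p) ls - D x ls) /\<^sub>R t p) \<longlonglongrightarrow> D x (i # ls)" if ls: "ls \<in> multi_indices (Suc j)" for ls
      proof -
        have "length ls < k" using ls f(3) by (simp add: multi_indices_def)
        then have "C_k_on (Suc (k - Suc (length ls))) (iterated_partial ls f) N"
          using C_k_on_iterated_partial[OF f(1), of ls] by (simp only: Suc_diff_Suc less_imp_le)
        from C_k_on_has_vector_derivative_axis[OF this f(2), of x 0 i UNIV] xN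
        have "((\<lambda>t. D (x + t *\<^sub>R axis i 1) ls) has_vector_derivative D x (i # ls)) (at 0)"
          by (simp add: D_def)
        from has_vector_derivative_difference_quotient[OF this]
        have "((\<lambda>h. (D (x + h *\<^sub>R axis i 1) ls - D x ls) /\<^sub>R h) \<longlongrightarrow> D x (i # ls)) (at 0)"
          by simp
        moreover have "filterlim t (at 0) sequentially"
          unfolding filterlim_at using t0 t(1) by (intro conjI always_eventually allI) auto
        ultimately show ?thesis unfolding y_def by (rule filterlim_compose)
      qed
      \<comment> \<open>The coefficients are frozen at their values at x. The numerator then
        vanishes at x, so \<open>u\<close> is a difference quotient, and at y p it lies in the span
        of the derivatives indexed by B because y p belongs to the same set.\<close>
      define u where "u p = (D (y p) ks - (\<Sum>\<beta>\<in>B. c \<beta> *\<^sub>R D (y p) \<beta>)) /\<^sub>R t p" for p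
      have u_eq: "u p = (D (y p) ks - D x ks) /\<^sub>R t p - (\<Sum>\<beta>\<in>B. c \<beta> *\<^sub>R ((D (y p) \<beta> - D x \<beta>) /\<^sub>R t p))" for p
      proof -
        have "(\<Sum>\<beta>\<in>B. c \<beta> *\<^sub>R ((D (y p) \<beta> - D x \<beta>) /\<^sub>R t p)) = ((\<Sum>\<beta>\<in>B. c \<beta> *\<^sub>R D (y p) \<beta>) - (\<Sum>\<beta>\<in>B. c \<beta> *\<^sub>R D x \<beta>)) /\<^sub>R t p"
          by (simp add: scaleR_sum_right sum_subtractf[symmetric] scaleR_diff_right mult.commute)
        then show ?thesis by (simp only: u_def c[symmetric] scaleR_diff_right[symmetric]) (simp add: algebra_simps)
      qed
      have ulim: "u \<longlonglongrightarrow> D x (i # ks) - (\<Sum>\<beta>\<in>B. c \<beta> *\<^sub>R D x (i # \<beta>))"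
      proof -
        have "(\<lambda>p. (D (y p) ks - D x ks) /\<^sub>R t p - (\<Sum>\<beta>\<in>B. c \<beta> *\<^sub>R ((D (y p) \<beta> - D x \<beta>) /\<^sub>R t p)))
            \<longlonglongrightarrow> D x (i # ks) - (\<Sum>\<beta>\<in>B. c \<beta> *\<^sub>R D x (i # \<beta>))"
          by (intro tendsto_diff tendsto_sum tendsto_scaleR tendsto_const quot ksm subsetD[OF B_Suc[OF B]])
        then show ?thesis by (simp only: u_eq[abs_def, symmetric])
      qed
      have "D x (i # ks) - (\<Sum>\<beta>\<in>B. c \<beta> *\<^sub>R D x (i # \<beta>)) \<in> span (D x ` B)"
      proof (rule span_limit[where bs = "\<lambda>p. D (y p)" and us = u, OF finB[OF B] _ _ _ ulim])
        show "0 < 1 / real (Suc n)" by simp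
        show "uniformly_independent (1 / real (Suc n)) B (D (y p))" for p using yE[of p] by (simp add: E_def)
        show "(\<lambda>p. D (y p) \<beta>) \<longlonglongrightarrow> D x \<beta>" if "\<beta> \<in> B" for \<beta>
          by (rule D_lim[OF ylim _ xN]) (use yE that B_Suc[OF B] in \<open>auto simp: E_def\<close>)
        show "u p \<in> span (D (y p) ` B)" for p
          unfolding u_def using yE[of p] ksm
          by (intro span_mul span_diff span_sum) (auto simp: E_def intro: span_base)
      qed
      then have "D x (i # ks) - (\<Sum>\<beta>\<in>B. c \<beta> *\<^sub>R D x (i # \<beta>)) \<in> jet_span (Suc j) f x"
        unfolding span_eq[OF x] .
      \<comment> \<open>This is where the order of B matters: its indices have order at most j, so
        one more derivative stays within order j + 1.\<close>
      moreover have "(\<Sum>\<beta>\<in>B. c \<beta> *\<^sub>R D x (i # \<beta>)) \<in> jet_span (Suc j) f x"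
        unfolding jet_span_eq
      proof (intro span_sum span_mul span_base)
        fix \<beta> assume "\<beta> \<in> B"
        then have "i # \<beta> \<in> multi_indices (Suc j)" using B by (auto simp: multi_indices_def)
        then show "D x (i # \<beta>) \<in> (\<lambda>js. iterated_partial js f x) ` multi_indices (Suc j)" by (auto simp: D_def simp del: iterated_partial.simps)
      qed
      ultimately have "(D x (i # ks) - (\<Sum>\<beta>\<in>B. c \<beta> *\<^sub>R D x (i # \<beta>))) + (\<Sum>\<beta>\<in>B. c \<beta> *\<^sub>R D x (i # \<beta>)) \<in> jet_span (Suc j) f x"
        unfolding jet_span_def by (rule span_add)
      then show ?thesis by (simp add: ks)
    qed
    then have "jet_span (Suc (Suc j)) f x \<subseteq> jet_span (Suc j) f x"
      unfolding jet_span_eq[of "Suc (Suc j)"] by (intro span_minimal) (auto simp: D_def jet_span_def)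
    then show ?thesis using jet_span_mono[of "Suc j" "Suc (Suc j)" f x] by auto
  qed
  have "{x \<in> N. jet_span (Suc j) f x = jet_span j f x \<and> jet_span (Suc (Suc j)) f x \<noteq> jet_span (Suc j) f x}
      \<subseteq> (\<Union>B\<in>Pow (multi_indices j). \<Union>n. \<Union>i. {x \<in> E B n. \<not> accumulates (axis i 1) x (E B n)})"
  proof
    fix x assume "x \<in> {x \<in> N. jet_span (Suc j) f x = jet_span j f x \<and> jet_span (Suc (Suc j)) f x \<noteq> jet_span (Suc j) f x}"
    then have x: "x \<in> N" "jet_span (Suc j) f x = jet_span j f x" "jet_span (Suc (Suc j)) f x \<noteq> jet_span (Suc j) f x" by auto
    obtain B \<delta> where B: "B \<subseteq> multi_indices j" "\<delta> > 0" "uniformly_independent \<delta> B (D x)" "span (D x ` B) = jet_span j f x"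
      unfolding D_def by (rule jet_span_basis)
    obtain n where n: "1 / real (Suc n) < \<delta>" using B(2) nat_approx_posE by blast
    have "uniformly_independent (1 / real (Suc n)) B (D x)"
      unfolding uniformly_independent_def
    proof
      fix c
      have "1 / real (Suc n) * (\<Sum>i\<in>B. \<bar>c i\<bar>) \<le> \<delta> * (\<Sum>i\<in>B. \<bar>c i\<bar>)"
        using n by (intro mult_right_mono sum_nonneg) auto
      also have "\<dots> \<le> norm (\<Sum>i\<in>B. c i *\<^sub>R D x i)" using B(3) by (simp add: uniformly_independent_def)
      finally show "1 / real (Suc n) * (\<Sum>i\<in>B. \<bar>c i\<bar>) \<le> norm (\<Sum>i\<in>B. c i *\<^sub>R D x i)" .
    qed
    moreover have "D x js \<in> span (D x ` B)" if "js \<in> multi_indices (Suc j)" for js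
      using that unfolding B(4) x(2)[symmetric] by (auto simp: jet_span_eq D_def intro: span_base)
    ultimately have "x \<in> E B n" using x(1) by (simp add: E_def)
    moreover obtain i where "\<not> accumulates (axis i 1) x (E B n)" using step[OF B(1) \<open>x \<in> E B n\<close>] x(3) by blast
    ultimately show "x \<in> (\<Union>B\<in>Pow (multi_indices j). \<Union>n. \<Union>i. {x \<in> E B n. \<not> accumulates (axis i 1) x (E B n)})"
      using B(1) by blast
  qed
  moreover have "negligible (\<Union>B\<in>Pow (multi_indices j). \<Union>n. \<Union>i. {x \<in> E B n. \<not> accumulates (axis i 1) x (E B n)})"
  proof (intro negligible_Union finite_imageI)
    fix S assume "S \<in> (\<lambda>B. \<Union>n. \<Union>i. {x \<in> E B n. \<not> accumulates (axis i 1) x (E B n)}) ` Pow (multi_indices j)"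
    then obtain B where B: "B \<subseteq> multi_indices j" "S = (\<Union>n. \<Union>i. {x \<in> E B n. \<not> accumulates (axis i 1) x (E B n)})" by blast
    have "negligible {x \<in> E B n. \<not> accumulates (axis i 1) x (E B n)}" for n i
      by (rule negligible_not_accumulates_relatively_closed[OF f(2) closed[OF B(1)]]) (simp add: axis_eq_0_iff)
    then have "negligible (\<Union>i. {x \<in> E B n. \<not> accumulates (axis i 1) x (E B n)})" for n
      by (intro negligible_Union finite_imageI) auto
    then show "negligible S" unfolding B(2) by (rule negligible_Union_nat)
  qed simp
  ultimately show ?thesis by (rule negligible_subset[rotated])
qed

text \<open>A basis chosen among the derivatives stays independent under small perturbations, and a
  family of as many independent vectors as the dimension still spans.\<close>

lemma jet_span_UNIV_open:
  fixes f :: "real ^ 'd::finite \<Rightarrow> 'b::euclidean_space"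
  assumes f: "C_k_on k f N" "open N" "x \<in> N" "jet_span k f x = UNIV"
  obtains r where "r > 0" "ball x r \<subseteq> N" "\<And>y. y \<in> ball x r \<Longrightarrow> jet_span k f y = UNIV"
proof -
  define D where "D y js = iterated_partial js f y" for y js
  obtain B \<delta> where B: "B \<subseteq> multi_indices k" "\<delta> > 0" "uniformly_independent \<delta> B (D x)" "span (D x ` B) = UNIV"
    unfolding D_def f(4)[symmetric] by (rule jet_span_basis)
  have finB: "finite B" using B(1) finite_multi_indices finite_subset by blast
  have "card B = DIM('b)"
  proof -
    have "independent (D x ` B)" "inj_on (D x) B"
      using uniformly_independent_imp_independent[OF finB B(2,3)] by auto
    then have "dim (D x ` B) = card B" by (simp add: dim_eq_card_independent card_image)
    moreover have "dim (D x ` B) = DIM('b)" using dim_span[of "D x ` B"] by (simp add: B(4))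
    ultimately show ?thesis by simp
  qed
  have "\<forall>\<beta>\<in>B. eventually (\<lambda>y. norm (D y \<beta> - D x \<beta>) \<le> \<delta> / 2) (at x)"
  proof
    fix \<beta> assume "\<beta> \<in> B"
    then have "continuous_on N (\<lambda>y. D y \<beta>)"
      unfolding D_def using B(1) by (intro continuous_on_iterated_partial[OF f(1)]) (auto simp: multi_indices_def)
    then have "((\<lambda>y. D y \<beta>) \<longlongrightarrow> D x \<beta>) (at x)"
      using f(2,3) by (simp add: continuous_on_eq_continuous_at isCont_def)
    then have "eventually (\<lambda>y. dist (D y \<beta>) (D x \<beta>) < \<delta> / 2) (at x)"
      using B(2) by (intro tendstoD) auto
    then show "eventually (\<lambda>y. norm (D y \<beta> - D x \<beta>) \<le> \<delta> / 2) (at x)"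
      by (rule eventually_mono) (simp add: dist_norm)
  qed
  then have "eventually (\<lambda>y. \<forall>\<beta>\<in>B. norm (D y \<beta> - D x \<beta>) \<le> \<delta> / 2) (at x)"
    using finB by (simp only: eventually_ball_finite)
  then obtain r1 where r1: "r1 > 0" "\<And>y. y \<noteq> x \<Longrightarrow> dist y x < r1 \<Longrightarrow> \<forall>\<beta>\<in>B. norm (D y \<beta> - D x \<beta>) \<le> \<delta> / 2"
    unfolding eventually_at by auto
  obtain r2 where r2: "r2 > 0" "ball x r2 \<subseteq> N" using f(2,3) open_contains_ball by blast
  have "jet_span k f y = UNIV" if y: "y \<in> ball x (min r1 r2)" for y
  proof -
    have "\<forall>\<beta>\<in>B. norm (D y \<beta> - D x \<beta>) \<le> \<delta> / 2"
      using r1(2)[of y] y B(2) by (cases "y = x") (auto simp: dist_commute)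
    then have "uniformly_independent (\<delta> / 2) B (D y)"
      by (intro uniformly_independent_perturb[OF finB B(3)]) auto
    from uniformly_independent_imp_independent[OF finB _ this] B(2)
    have "inj_on (D y) B" "independent (D y ` B)" by auto
    then have "UNIV \<subseteq> span (D y ` B)"
      using \<open>card B = DIM('b)\<close> by (intro card_ge_dim_independent) (auto simp: card_image)
    moreover have "span (D y ` B) \<subseteq> jet_span k f y"
      unfolding jet_span_eq D_def using B(1) by (intro span_mono image_mono)
    ultimately show ?thesis by auto
  qed
  moreover have "ball x (min r1 r2) \<subseteq> N"
    by (rule order_trans[OF subset_ball r2(2)]) simp
  moreover have "min r1 r2 > 0" using r1(1) r2(1) by simp
  ultimately show thesis using that[of "min r1 r2"] by blast
qed

text \<open>Off the exceptional null sets a chain of spans that stops once has stopped up to order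
  k. Either it grows strictly in each of the first DIM('b) steps and is full by dimension, or it
  stops earlier and already equals the full span of order k.\<close>

proposition jet_span_UNIV_ae:
  fixes f :: "real ^ 'd::finite \<Rightarrow> 'b::euclidean_space"
  assumes f: "C_k_on k f N" "open N"
  shows "negligible {x \<in> N. jet_span k f x = UNIV \<and> jet_span (min k DIM('b)) f x \<noteq> UNIV}"
proof -
  let ?Z = "\<lambda>j. {x \<in> N. jet_span (Suc j) f x = jet_span j f x \<and> jet_span (Suc (Suc j)) f x \<noteq> jet_span (Suc j) f x}"
  have "{x \<in> N. jet_span k f x = UNIV \<and> jet_span (min k DIM('b)) f x \<noteq> UNIV} \<subseteq> (\<Union>j\<in>{j. Suc (Suc j) \<le> k}. ?Z j)"
  proof (rule subsetI, rule ccontr)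
    fix x assume "x \<in> {x \<in> N. jet_span k f x = UNIV \<and> jet_span (min k DIM('b)) f x \<noteq> UNIV}"
      and nz: "x \<notin> (\<Union>j\<in>{j. Suc (Suc j) \<le> k}. ?Z j)"
    then have x: "x \<in> N" "jet_span k f x = UNIV" "jet_span (min k DIM('b)) f x \<noteq> UNIV" by auto
    let ?m = "DIM('b)"
    have mk: "?m < k" using x(2,3) by (cases "?m < k") (auto simp: min_def split: if_splits)
    have propagate: "jet_span (Suc i) f x = jet_span i f x" if "jet_span (Suc j) f x = jet_span j f x" "j \<le> i" "Suc i \<le> k" for i j
      using that(2,3)
    proof (induction i rule: dec_induct)
      case base
      show ?case by (rule that(1))
    next
      case (step i)
      then have "jet_span (Suc i) f x = jet_span i f x" by simp
      then show ?case using nz x(1) step.prems by blast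
    qed
    have "\<exists>j<?m. jet_span (Suc j) f x = jet_span j f x"
    proof (rule ccontr)
      assume "\<not> ?thesis"
      then have ne: "jet_span (Suc j) f x \<noteq> jet_span j f x" if "j < ?m" for j using that by blast
      have "j \<le> dim (jet_span j f x)" if "j \<le> ?m" for j
        using that
      proof (induction j)
        case (Suc j)
        have sub: "subspace (jet_span i f x)" for i by (simp add: jet_span_def)
        have "jet_span j f x \<subset> jet_span (Suc j) f x"
          using jet_span_mono[of j "Suc j" f x] ne[of j] Suc.prems by auto
        then have "dim (jet_span j f x) < dim (jet_span (Suc j) f x)"
          by (intro dim_psubset) (simp add: jet_span_def span_span)
        then show ?case using Suc by simp
      qed simp
      from this[OF order_refl] have "dim (jet_span ?m f x) = DIM('b)"
        using dim_subset_UNIV[of "jet_span ?m f x"] by simp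
      then have "jet_span ?m f x = UNIV"
        using dim_eq_full[of "jet_span ?m f x"] by (simp add: jet_span_def span_span)
      then show False using x(3) mk by simp
    qed
    then obtain j where j: "j < ?m" "jet_span (Suc j) f x = jet_span j f x" by blast
    have "jet_span i f x = jet_span j f x" if "j \<le> i" "i \<le> k" for i
      using that
    proof (induction i rule: dec_induct)
      case (step i)
      then show ?case using propagate[OF j(2), of i] by simp
    qed simp
    from this[of k] have "jet_span j f x = UNIV" using j(1) mk x(2) by simp
    then have "jet_span ?m f x = UNIV" using jet_span_mono[of j ?m f x] j(1) by auto
    then show False using x(3) mk by simp
  qed
  moreover have "finite {j. Suc (Suc j) \<le> k}" by (rule finite_subset[of _ "{..k}"]) auto
  then have "negligible (\<Union>j\<in>{j. Suc (Suc j) \<le> k}. ?Z j)"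
    by (intro negligible_Union finite_imageI) (auto intro: jet_span_stationary[OF f])
  ultimately show ?thesis by (rule negligible_subset[rotated])
qed

section \<open>Null sets on manifolds\<close>

lemma differentiable_imp_locally_Lipschitz_at:
  fixes h :: "'a::real_normed_vector \<Rightarrow> 'b::real_normed_vector"
  assumes "h differentiable (at w0)"
  obtains r B where "r > 0" "\<And>w. dist w w0 < r \<Longrightarrow> norm (h w - h w0) \<le> B * norm (w - w0)"
proof -
  obtain h' where h': "(h has_derivative h') (at w0)" using assms by (auto simp: differentiable_def)
  then have bl: "bounded_linear h'" by (rule has_derivative_bounded_linear)
  obtain K where K: "\<And>v. norm (h' v) \<le> norm v * K" using bounded_linear.bounded[OF bl] by blast
  obtain r where r: "r > 0" "\<And>w. norm (w - w0) < r \<Longrightarrow> norm (h w - h w0 - h' (w - w0)) \<le> 1 * norm (w - w0)"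
    using h' unfolding has_derivative_at_alt by (meson zero_less_one)
  have "norm (h w - h w0) \<le> (1 + K) * norm (w - w0)" if "dist w w0 < r" for w
  proof -
    have "norm (h w - h w0) \<le> norm (h w - h w0 - h' (w - w0)) + norm (h' (w - w0))"
      using norm_triangle_ineq[of "h w - h w0 - h' (w - w0)" "h' (w - w0)"] by simp
    also have "\<dots> \<le> 1 * norm (w - w0) + norm (w - w0) * K"
      using r(2)[of w] that K by (intro add_mono) (auto simp: dist_norm)
    finally show ?thesis by (simp add: algebra_simps)
  qed
  then show thesis using that r(1) by blast
qed

text \<open>An injective derivative satisfies |f' v| >= B |v|, and close to \<open>z0\<close> the
  remainder consumes at most half of this.\<close>

lemma immersion_locally_expanding_at:
  fixes f :: "'a::euclidean_space \<Rightarrow> 'b::euclidean_space"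
  assumes "f differentiable (at z0)" "inj (frechet_derivative f (at z0))"
  obtains r c where "r > 0" "c > 0" "\<And>z. dist z z0 < r \<Longrightarrow> c * norm (z - z0) \<le> norm (f z - f z0)"
proof -
  let ?f' = "frechet_derivative f (at z0)"
  have f': "(f has_derivative ?f') (at z0)" using assms(1) by (simp add: frechet_derivative_works)
  then have lin: "linear ?f'" using has_derivative_bounded_linear bounded_linear.linear by blast
  obtain B where B: "B > 0" "\<And>v. B * norm v \<le> norm (?f' v)"
    using linear_inj_bounded_below_pos[OF lin assms(2)] by blast
  have "B / 2 > 0" using B(1) by simp
  then obtain r where r: "r > 0" "\<And>z. norm (z - z0) < r \<Longrightarrow> norm (f z - f z0 - ?f' (z - z0)) \<le> B / 2 * norm (z - z0)"
    using f' unfolding has_derivative_at_alt by meson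
  have "B / 2 * norm (z - z0) \<le> norm (f z - f z0)" if "dist z z0 < r" for z
  proof -
    have "norm (?f' (z - z0)) \<le> norm (f z - f z0) + norm (f z - f z0 - ?f' (z - z0))"
      using norm_triangle_ineq4[of "f z - f z0" "f z - f z0 - ?f' (z - z0)"] by simp
    moreover have "norm (f z - f z0 - ?f' (z - z0)) \<le> B / 2 * norm (z - z0)" using r(2) that by (simp add: dist_norm)
    moreover have "B * norm (z - z0) = B / 2 * norm (z - z0) + B / 2 * norm (z - z0)" by simp
    ultimately show ?thesis using B(2)[of "z - z0"] by linarith
  qed
  then show thesis using that r(1) B(1) by (metis half_gt_zero)
qed

text \<open>A change of parametrization is Lipschitz at every point, hence preserves null sets.\<close>

lemma negligible_reparametrization:
  fixes f :: "'a::euclidean_space \<Rightarrow> 'b::euclidean_space" and h :: "'c::euclidean_space \<Rightarrow> 'b"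
  assumes hom: "homeomorphism U (f ` U) f g"
    and diff: "\<And>z. z \<in> U \<Longrightarrow> f differentiable (at z)" and inj: "\<And>z. z \<in> U \<Longrightarrow> inj (frechet_derivative f (at z))"
    and h: "\<And>w. w \<in> S \<Longrightarrow> h differentiable (at w)" "h ` S \<subseteq> f ` U"
    and "negligible S" "DIM('c) \<le> DIM('a)"
  shows "negligible ((g \<circ> h) ` S)"
proof (rule negligible_locally_Lipschitz_image[OF \<open>DIM('c) \<le> DIM('a)\<close> \<open>negligible S\<close>])
  fix w0 assume w0: "w0 \<in> S"
  define z0 where "z0 = g (h w0)"
  have fg: "f (g y) = y" "g y \<in> U" if "y \<in> f ` U" for y
    using hom that unfolding homeomorphism_def by auto
  have hw: "h w \<in> f ` U" if "w \<in> S" for w using h(2) that by blast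
  have z0: "z0 \<in> U" "f z0 = h w0" unfolding z0_def using fg hw[OF w0] by auto
  obtain r c where rc: "r > 0" "c > 0" "\<And>z. dist z z0 < r \<Longrightarrow> c * norm (z - z0) \<le> norm (f z - f z0)"
    using immersion_locally_expanding_at[OF diff[OF z0(1)] inj[OF z0(1)]] by blast
  obtain s B where sB: "s > 0" "\<And>w. dist w w0 < s \<Longrightarrow> norm (h w - h w0) \<le> B * norm (w - w0)"
    using differentiable_imp_locally_Lipschitz_at[OF h(1)[OF w0]] by blast
  have "continuous_on (f ` U) g" using hom by (simp add: homeomorphism_def)
  moreover have "h w0 \<in> f ` U" by (rule hw[OF w0])
  ultimately obtain e where e: "e > 0" "\<And>y. y \<in> f ` U \<Longrightarrow> dist y (h w0) < e \<Longrightarrow> dist (g y) (g (h w0)) < r"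
    unfolding continuous_on_iff using rc(1) by meson
  have "isCont h w0" using differentiable_imp_continuous_within[OF h(1)[OF w0]] by simp
  then obtain t where t: "t > 0" "\<And>w. dist w w0 < t \<Longrightarrow> dist (h w) (h w0) < e"
    unfolding continuous_at_eps_delta using e(1) by meson
  have "norm ((g \<circ> h) w - (g \<circ> h) w0) \<le> (B / c) * norm (w - w0)" if w: "w \<in> S \<inter> ball w0 (min s t)" for w
  proof -
    have d: "dist w w0 < s" "dist w w0 < t" "w \<in> S" using w by (auto simp: dist_commute)
    have "dist (g (h w)) z0 < r" unfolding z0_def by (rule e(2)[OF hw[OF d(3)] t(2)[OF d(2)]])
    then have "c * norm (g (h w) - z0) \<le> norm (f (g (h w)) - f z0)" by (rule rc(3))
    also have "\<dots> = norm (h w - h w0)" by (simp add: fg(1)[OF hw[OF d(3)]] z0(2))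
    also have "\<dots> \<le> B * norm (w - w0)" by (rule sB(2)[OF d(1)])
    finally show ?thesis using rc(2) by (simp add: z0_def field_simps)
  qed
  then show "\<exists>T B. open T \<and> w0 \<in> T \<and> (\<forall>w\<in>S \<inter> T. norm ((g \<circ> h) w - (g \<circ> h) w0) \<le> B * norm (w - w0))"
    using sB(1) t(1) by (intro exI[of _ "ball w0 (min s t)"] exI[of _ "B / c"]) auto
qed

text \<open>Each of the m factors is at least |v|^(-1/m^2), because |v_i| \<le> |v| and |v| >= 1;
  their product is |v|^(-1/m). This is the origin of the exponent 1/m^2.\<close>

lemma decay_weight_ge:
  fixes v :: "'m::finite \<Rightarrow> int"
  assumes "v \<noteq> (\<lambda>_. 0)"
  shows "norm (int_vec v) powr - (1 / real CARD('m)) \<le> decay_weight (1 / (real CARD('m))\<^sup>2) v"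
proof -
  let ?m = "real CARD('m)" and ?N = "norm (int_vec v)"
  have "int_vec v \<noteq> 0" using assms by (auto simp: vec_eq_iff fun_eq_iff)
  then have N1: "1 \<le> ?N" by (intro norm_int_points_ge_1) (auto simp: int_points_eq_range)
  have "?N powr - (1 / ?m) = (?N powr - (1 / ?m\<^sup>2)) ^ CARD('m)"
  proof -
    have "?N powr - (1 / ?m\<^sup>2) > 0" using \<open>int_vec v \<noteq> 0\<close> by simp
    then have "(?N powr - (1 / ?m\<^sup>2)) ^ CARD('m) = ?N powr (- (1 / ?m\<^sup>2) * ?m)"
      by (simp only: powr_realpow[symmetric] powr_powr)
    moreover have "- (1 / ?m\<^sup>2) * ?m = - (1 / ?m)" by (simp add: power2_eq_square)
    ultimately show ?thesis by simp
  qed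
  also have "\<dots> = (\<Prod>i\<in>(UNIV :: 'm set). ?N powr - (1 / ?m\<^sup>2))" by simp
  also have "\<dots> \<le> decay_weight (1 / ?m\<^sup>2) v"
    unfolding decay_weight_def
  proof (intro prod_mono conjI)
    fix i
    have "\<bar>real_of_int (v i)\<bar> \<le> ?N" using component_le_norm_cart[of "int_vec v" i] by simp
    then show "?N powr - (1 / ?m\<^sup>2) \<le> max 1 \<bar>real_of_int (v i)\<bar> powr - (1 / ?m\<^sup>2)"
      using N1 by (intro powr_mono2') auto
  qed simp
  finally show ?thesis .
qed

section \<open>Exceptional sets in local parametrizations\<close>

locale convergence_hypotheses =
  fixes \<alpha> :: "real ^ 'n::finite ^ 'm::finite" and \<psi> :: "real \<Rightarrow> real"
  assumes dim: "CARD('m) \<ge> 2"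
    and irrationality: "irrationality_exponent (transpose \<alpha>) <
           ereal (inverse (real CARD('n) / real CARD('m) - real CARD('n) / (2 * (real CARD('m))\<^sup>2 * (real CARD('m) - 1))))"
    and approximation: "approximation_function \<psi>"
    and summable: "summable (\<lambda>q. real (Suc q) ^ (CARD('n) - 1) * \<psi> (real (Suc q)) ^ CARD('m))"
begin

text \<open>Decay at an order not exceeding m is at least as strong as |v|^(-1/m), which the product
  weight dominates.\<close>

lemma negligible_near_nondegenerate_jet:
  fixes f :: "real ^ 'd::finite \<Rightarrow> real ^ 'm"
  assumes f: "C_k_on k f U" "open U" "x0 \<in> U" "2 \<le> k" and jet: "jet_span (min k CARD('m)) f x0 = UNIV"
  obtains r where "r > 0" "negligible {x \<in> ball x0 r. f x \<in> inhomogeneously_approximable \<psi> \<alpha>}"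
proof -
  let ?l = "min k CARD('m)" and ?\<sigma> = "1 / (real CARD('m))\<^sup>2"
  have l: "1 \<le> ?l" "?l \<le> CARD('m)" "?l \<le> k" using f(4) dim by auto
  obtain r C where r: "r > 0" "C \<ge> 0" "cball x0 r \<subseteq> U" and
    decay: "\<And>w. 1 \<le> norm w \<Longrightarrow> cmod (LINT x:ball x0 r|lborel. cis (w \<bullet> f x)) \<le> C * norm w powr - (1 / real ?l)"
    using fourier_decay_of_nondegenerate[OF f l(3) jet[unfolded jet_span_def]] by blast
  have cont: "continuous_on (ball x0 r) f"
    using continuous_on_subset[OF C_k_on_imp_continuous_on[OF f(1)]] r(3) ball_subset_cball by blast
  \<comment> \<open>The volume pays for the zero frequency, where the integral does not
    decay.\<close>
  define V where "V = measure lborel (ball x0 r)"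
  have "cmod (LINT x:ball x0 r|lborel. cis (2 * pi * (int_vec v \<bullet> f x))) \<le> (C + V) * decay_weight ?\<sigma> v" for v
  proof (cases "v = (\<lambda>_. 0)")
    case True
    then have "int_vec v = 0" by (simp add: vec_eq_iff)
    moreover have "decay_weight ?\<sigma> v = 1" by (simp add: True decay_weight_def)
    moreover have "cmod (LINT x|lborel. indicat_real (ball x0 r) x *\<^sub>R 1) \<le> V"
      using integral_norm_bound[of lborel "\<lambda>x. indicat_real (ball x0 r) x *\<^sub>R (1 :: complex)"] by (simp add: V_def)
    ultimately show ?thesis using r(2) by (simp add: set_lebesgue_integral_def)
  next
    case False
    let ?N = "norm (int_vec v)"
    have "int_vec v \<noteq> 0" using False by (auto simp: vec_eq_iff fun_eq_iff)
    then have N1: "1 \<le> ?N" by (intro norm_int_points_ge_1) (auto simp: int_points_eq_range)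
    have N2: "?N \<le> norm ((2 * pi) *\<^sub>R int_vec v)"
      using mult_right_mono[of 1 "2 * pi" ?N] pi_gt3 by simp
    have "cmod (LINT x:ball x0 r|lborel. cis (2 * pi * (int_vec v \<bullet> f x)))
        \<le> C * norm ((2 * pi) *\<^sub>R int_vec v) powr - (1 / real ?l)"
      using decay[of "(2 * pi) *\<^sub>R int_vec v"] N1 N2 by simp
    also have "\<dots> \<le> C * ?N powr - (1 / real ?l)"
      using N1 N2 r(2) by (intro mult_left_mono powr_mono2') auto
    also have "\<dots> \<le> C * ?N powr - (1 / real CARD('m))"
      using N1 l r(2) by (intro mult_left_mono powr_mono) (auto simp: frac_le)
    also have "\<dots> \<le> C * decay_weight ?\<sigma> v"
      by (intro mult_left_mono decay_weight_ge False r(2))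
    also have "\<dots> \<le> (C + V) * decay_weight ?\<sigma> v"
      by (intro mult_right_mono) (auto simp: V_def)
    finally show ?thesis .
  qed
  then have "negligible {x \<in> ball x0 r. f x \<in> inhomogeneously_approximable \<psi> \<alpha>}"
    using r(2) dim irrationality approximation summable cont emeasure_lborel_ball_finite
    by (intro inhomogeneously_approximable_negligible_of_fourier_decay[where C = "C + V"]) (auto simp: V_def)
  then show thesis using that r(1) by blast
qed

text \<open>Full span at order k is an open condition, and almost every point with it has full span
  already at order min k m. These points have small balls in which the exceptional set is null, and
  null sets are determined locally.\<close>

lemma negligible_near_nondegenerate_point:
  fixes f :: "real ^ 'd::finite \<Rightarrow> real ^ 'm"
  assumes f: "C_k_on k f U" "open U" "x0 \<in> U" "2 \<le> k" and jet: "jet_span k f x0 = UNIV"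
  obtains r where "r > 0" "ball x0 r \<subseteq> U" "negligible {x \<in> ball x0 r. f x \<in> inhomogeneously_approximable \<psi> \<alpha>}"
proof -
  let ?T = "inhomogeneously_approximable \<psi> \<alpha>" and ?l = "min k CARD('m)"
  obtain r where r: "r > 0" "ball x0 r \<subseteq> U" "\<And>y. y \<in> ball x0 r \<Longrightarrow> jet_span k f y = UNIV"
    by (rule jet_span_UNIV_open[OF f(1-3) jet]) blast
  have "negligible {x \<in> ball x0 r. jet_span ?l f x = UNIV \<and> f x \<in> ?T}"
  proof (rule negligible_locallyI)
    fix x assume "x \<in> {x \<in> ball x0 r. jet_span ?l f x = UNIV \<and> f x \<in> ?T}"
    then have "x \<in> U" "jet_span ?l f x = UNIV" using r(2) by auto
    then obtain s where "s > 0" "negligible {y \<in> ball x s. f y \<in> ?T}"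
      using negligible_near_nondegenerate_jet[OF f(1,2) _ f(4)] by blast
    then show "\<exists>s>0. negligible ({x \<in> ball x0 r. jet_span ?l f x = UNIV \<and> f x \<in> ?T} \<inter> ball x s)"
      by (intro exI[of _ s] conjI) (auto elim: negligible_subset)
  qed
  moreover have "negligible {x \<in> U. jet_span k f x = UNIV \<and> jet_span ?l f x \<noteq> UNIV}"
    using jet_span_UNIV_ae[OF f(1,2)] by simp
  ultimately have "negligible ({x \<in> ball x0 r. jet_span ?l f x = UNIV \<and> f x \<in> ?T} \<union>
      {x \<in> U. jet_span k f x = UNIV \<and> jet_span ?l f x \<noteq> UNIV})"
    by (rule negligible_Un)
  moreover have "{x \<in> ball x0 r. f x \<in> ?T} \<subseteq> {x \<in> ball x0 r. jet_span ?l f x = UNIV \<and> f x \<in> ?T} \<union>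
      {x \<in> U. jet_span k f x = UNIV \<and> jet_span ?l f x \<noteq> UNIV}"
    using r(2,3) by blast
  ultimately have "negligible {x \<in> ball x0 r. f x \<in> ?T}" by (rule negligible_subset)
  then show thesis using that r(1,2) by blast
qed

text \<open>The identity is a smooth nondegenerate parametrization of the whole space. This case
  settles parametrizations that are nondegenerate with first derivatives only.\<close>

lemma negligible_inhomogeneously_approximable: "negligible (inhomogeneously_approximable \<psi> \<alpha>)"
proof (rule negligible_locallyI)
  fix x0 :: "real ^ 'm"
  let ?id = "\<lambda>x :: real ^ 'm. x"
  have p1: "partial_derivative i ?id = (\<lambda>_. axis i 1)" for i
    by (rule ext) (simp add: partial_derivative_def)
  have p2: "partial_derivative i (\<lambda>_ :: real ^ 'm. c) = (\<lambda>_. 0)" for i and c :: "real ^ 'm"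
    by (rule ext) (simp add: partial_derivative_def)
  have "C_k_on 2 ?id UNIV" by (simp add: numeral_2_eq_2 p1 p2)
  moreover have "jet_span 2 ?id x0 = UNIV"
  proof -
    have "axis i 1 \<in> {iterated_partial js ?id x0 | js. 1 \<le> length js \<and> length js \<le> 2}" for i :: 'm
      by (intro CollectI exI[of _ "[i]"]) (simp add: p1)
    then have "Basis \<subseteq> {iterated_partial js ?id x0 | js. 1 \<le> length js \<and> length js \<le> 2}"
      by (auto simp: Basis_vec_def)
    then have "span Basis \<subseteq> jet_span 2 ?id x0" unfolding jet_span_def by (rule span_mono)
    then show ?thesis by (simp add: top.extremum_unique)
  qed
  ultimately obtain r where "r > 0" "negligible {x \<in> ball x0 r. x \<in> inhomogeneously_approximable \<psi> \<alpha>}"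
    using negligible_near_nondegenerate_point[of 2 ?id UNIV x0] by auto
  then show "\<exists>r>0. negligible (inhomogeneously_approximable \<psi> \<alpha> \<inter> ball x0 r)"
    by (intro exI[of _ r] conjI) (auto elim: negligible_subset)
qed

text \<open>The parametrization h that witnesses nondegeneracy need not be the given f, which is
  only C^1; exceptional sets are transported by \<open>g \<circ> h\<close>. The oscillatory argument
  uses second derivatives, so k = 1 is treated apart: m spanning first derivatives force the
  dimension of the manifold to be at least m, and the null set of the ambient space is pulled
  back.\<close>

lemma negligible_near_nondegenerate_manifold_point:
  fixes f :: "real ^ 'd::finite \<Rightarrow> real ^ 'm"
  assumes param: "local_parametrization M U f" and x: "x \<in> U" "nondegenerate_at TYPE('d) M (f x)"
  shows "\<exists>r>0. negligible ({z \<in> U. f z \<in> inhomogeneously_approximable \<psi> \<alpha>} \<inter> ball x r)"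
proof -
  let ?T = "inhomogeneously_approximable \<psi> \<alpha>"
  obtain U' :: "(real ^ 'd) set" and h x' k where h: "local_parametrization M U' h" "x' \<in> U'" "h x' = f x" "C_k_on k h U'"
    and jet: "jet_span k h x' = UNIV"
    using x(2) unfolding nondegenerate_at_def jet_span_def by blast
  obtain g where g: "homeomorphism U (f ` U) f g" using param by (auto simp: local_parametrization_def)
  have U: "open U" "\<And>z. z \<in> U \<Longrightarrow> f differentiable (at z)" "\<And>z. z \<in> U \<Longrightarrow> inj (frechet_derivative f (at z))"
    using param by (auto simp: local_parametrization_def differentiable_on_eq_differentiable_at)
  have U': "open U'" "\<And>z. z \<in> U' \<Longrightarrow> h differentiable (at z)"
    using h(1) by (auto simp: local_parametrization_def differentiable_on_eq_differentiable_at)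
  have gf: "g (f z) = z" if "z \<in> U" for z using g that by (simp add: homeomorphism_def)
  have "k \<noteq> 0"
  proof
    assume "k = 0"
    then have "jet_span k h x' = {0}" unfolding jet_span_def by (auto simp: span_empty)
    moreover have "axis undefined 1 \<noteq> (0 :: real ^ 'm)" by (simp add: axis_eq_0_iff)
    ultimately show False using jet by (metis UNIV_I singletonD)
  qed
  show ?thesis
  proof (cases "k = 1")
    case True
    have "CARD('m) \<le> CARD('d)"
    proof -
      have "{iterated_partial js h x' | js. 1 \<le> length js \<and> length js \<le> 1} = range (\<lambda>i. iterated_partial [i] h x')"
      proof -
        have "1 \<le> length js \<and> length js \<le> 1 \<longleftrightarrow> (\<exists>i. js = [i])" for js :: "'d list"
          by (cases js) auto
        then show ?thesis by (auto simp del: iterated_partial.simps)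
      qed
      then have "dim (UNIV :: (real ^ 'm) set) \<le> card (range (\<lambda>i. iterated_partial [i] h x'))"
        using jet True by (intro dim_le_card) (auto simp: jet_span_def)
      also have "\<dots> \<le> CARD('d)" by (rule card_image_le) simp
      finally show ?thesis by simp
    qed
    \<comment> \<open>The identity of the ambient space takes the place of the second
      parametrization; the dimension inequality is what the Lipschitz image argument
      requires.\<close>
    then have "negligible ((g \<circ> (\<lambda>y. y)) ` (?T \<inter> f ` U))"
      using negligible_inhomogeneously_approximable
      by (intro negligible_reparametrization[OF g U(2,3)]) (auto intro: negligible_Int)
    moreover have "{z \<in> U. f z \<in> ?T} \<inter> ball x 1 \<subseteq> (g \<circ> (\<lambda>y. y)) ` (?T \<inter> f ` U)"
    proof
      fix z assume z: "z \<in> {z \<in> U. f z \<in> ?T} \<inter> ball x 1"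
      then have "z = (g \<circ> (\<lambda>y. y)) (f z)" "f z \<in> ?T \<inter> f ` U" using gf by auto
      then show "z \<in> (g \<circ> (\<lambda>y. y)) ` (?T \<inter> f ` U)" by (rule image_eqI)
    qed
    ultimately have "negligible ({z \<in> U. f z \<in> ?T} \<inter> ball x 1)" by (rule negligible_subset)
    then show ?thesis by (intro exI[of _ 1]) simp
  next
    case False
    with \<open>k \<noteq> 0\<close> have "2 \<le> k" by simp
    then obtain r where r: "r > 0" "ball x' r \<subseteq> U'" "negligible {w \<in> ball x' r. h w \<in> ?T}"
      using negligible_near_nondegenerate_point[OF h(4) U'(1) h(2) _ jet] by blast
    define S where "S = {w \<in> ball x' r. h w \<in> ?T \<inter> f ` U}"
    have "negligible S" by (rule negligible_subset[OF r(3)]) (auto simp: S_def)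
    then have null: "negligible ((g \<circ> h) ` S)"
      using U'(2) r(2) by (intro negligible_reparametrization[OF g U(2,3)]) (auto simp: S_def)
    obtain g' where g': "homeomorphism U' (h ` U') h g'" using h(1) by (auto simp: local_parametrization_def)
    \<comment> \<open>The image of the ball under h is relatively open in M, so f maps a
      neighbourhood of x into it and \<open>g \<circ> h\<close> reaches every exceptional parameter
      near x.\<close>
    have "openin (top_of_set (h ` U')) (h ` ball x' r)"
    proof (rule homeomorphism_imp_open_map[OF g'])
      show "openin (top_of_set U') (ball x' r)"
        using openin_open_Int[OF open_ball, of U' x' r] r(2) by (simp add: Int_absorb1)
    qed
    moreover have "openin (top_of_set M) (h ` U')" using h(1) by (simp add: local_parametrization_def)
    ultimately have "openin (top_of_set M) (h ` ball x' r)" by (rule openin_trans)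
    then obtain W where W: "open W" "h ` ball x' r = M \<inter> W" by (auto simp: openin_open)
    have "continuous_on U f" using g by (simp add: homeomorphism_def)
    then have "open (U \<inter> f -` W)" using U(1) W(1) by (simp add: continuous_openin_preimage_gen openin_open_eq[symmetric] continuous_on_open_vimage Int_commute)
    moreover have fM: "f z \<in> M" if "z \<in> U" for z
      using param that openin_imp_subset unfolding local_parametrization_def by blast
    have "f x \<in> W" 
    proof -
      have "h x' \<in> h ` ball x' r" using r(1) by simp
      then show ?thesis using W(2) h(3) by auto
    qed
    ultimately obtain e where e: "e > 0" "ball x e \<subseteq> U \<inter> f -` W"
      using x(1) open_contains_ball by blast
    have "{z \<in> U. f z \<in> ?T} \<inter> ball x e \<subseteq> (g \<circ> h) ` S"
    proof
      fix z assume z: "z \<in> {z \<in> U. f z \<in> ?T} \<inter> ball x e"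
      then have "f z \<in> M \<inter> W" using e(2) fM by auto
      then have "f z \<in> h ` ball x' r" by (simp only: W(2))
      then obtain w where w: "w \<in> ball x' r" "f z = h w" by blast
      have "f z \<in> ?T \<inter> f ` U" using z by blast
      then have "w \<in> S" using w by (simp add: S_def)
      moreover have "z = (g \<circ> h) w" unfolding o_apply w(2)[symmetric] using gf z by simp
      ultimately show "z \<in> (g \<circ> h) ` S" by blast
    qed
    then have "negligible ({z \<in> U. f z \<in> ?T} \<inter> ball x e)" using null negligible_subset by blast
    then show ?thesis using e(1) by blast
  qed
qed

text \<open>The degenerate points are null by the definition of \<open>nondegenerate\<close>; the
  others are treated locally in the given parametrization.\<close>

theorem null_on_nondegenerate_manifold:
  assumes "nondegenerate TYPE('d::finite) M"
  shows "null_on_manifold TYPE('d) M (M \<inter> inhomogeneously_approximable \<psi> \<alpha>)"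
  unfolding null_on_manifold_def
proof (intro allI impI)
  fix U :: "(real ^ 'd) set" and f assume param: "local_parametrization M U f"
  let ?T = "inhomogeneously_approximable \<psi> \<alpha>"
  have "{x \<in> U. f x \<in> {y \<in> M. \<not> nondegenerate_at TYPE('d) M y}} \<in> null_sets lebesgue"
    using assms param unfolding nondegenerate_def null_on_manifold_def by blast
  then have "negligible {x \<in> U. f x \<in> {y \<in> M. \<not> nondegenerate_at TYPE('d) M y}}"
    by (simp add: negligible_iff_null_sets)
  moreover have "negligible {x \<in> U. f x \<in> ?T \<and> nondegenerate_at TYPE('d) M (f x)}"
  proof (rule negligible_locallyI)
    fix x assume x: "x \<in> {x \<in> U. f x \<in> ?T \<and> nondegenerate_at TYPE('d) M (f x)}"
    then obtain r where "r > 0" "negligible ({z \<in> U. f z \<in> ?T} \<inter> ball x r)"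
      using negligible_near_nondegenerate_manifold_point[OF param] by blast
    then show "\<exists>r>0. negligible ({x \<in> U. f x \<in> ?T \<and> nondegenerate_at TYPE('d) M (f x)} \<inter> ball x r)"
      by (intro exI[of _ r] conjI) (auto elim: negligible_subset)
  qed
  ultimately have "negligible ({x \<in> U. f x \<in> {y \<in> M. \<not> nondegenerate_at TYPE('d) M y}} \<union>
      {x \<in> U. f x \<in> ?T \<and> nondegenerate_at TYPE('d) M (f x)})"
    by (rule negligible_Un)
  then have "negligible {x \<in> U. f x \<in> M \<inter> ?T}" by (rule negligible_subset) auto
  then show "{x \<in> U. f x \<in> M \<inter> ?T} \<in> null_sets lebesgue" by (simp add: negligible_iff_null_sets)
qed

end

theorem theorem1p2:
  fixes \<alpha> :: "real ^ 'n::finite ^ 'm::finite" and \<psi> :: "real \<Rightarrow> real"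
  defines "m \<equiv> CARD('m)" and "n \<equiv> CARD('n)"
  assumes "m \<ge> 2"
    and "irrationality_exponent (transpose \<alpha>) <
           ereal (inverse (real n / real m - real n / (2 * (real m)\<^sup>2 * (real m - 1))))"
    and "approximation_function \<psi>" and "doubling \<psi>"
    and "summable (\<lambda>q. real (Suc q) ^ (n - 1) * \<psi> (real (Suc q)) ^ m)"
  shows "(\<forall>M. nondegenerate_curve M \<longrightarrow>
            null_on_manifold TYPE(1) M (M \<inter> inhomogeneously_approximable \<psi> \<alpha>)) \<and>
         (\<forall>M. nondegenerate_analytic_submanifold TYPE('d::finite) M \<longrightarrow>
            null_on_manifold TYPE('d) M (M \<inter> inhomogeneously_approximable \<psi> \<alpha>))"
proof -
  interpret convergence_hypotheses \<alpha> \<psi>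
    by unfold_locales (use assms in \<open>simp_all add: m_def n_def\<close>)
  show ?thesis
    using null_on_nondegenerate_manifold[where 'd = 1] null_on_nondegenerate_manifold[where 'd = 'd]
    by (auto simp: nondegenerate_curve_def nondegenerate_analytic_submanifold_def)
qed

end
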